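(* Let $-1/h_\tau<\kappa<1/h_\tau$. There exists a matrix $\mu=[\mu_{T,T'}]_{T,T'\in\mathcal{Y}(\tau)}$ of complex Baire measures on $\mathbb{T}^N$ such that $\int_{\mathbb{T}^N}x^{-\alpha}\,\mathrm{d}\mu_{T,T'}(x)=(A_\alpha)_{T,T'}$ for all $\alpha\in\mathbb{Z}^N$, each $\mu_{T,T}$ is a positive measure, and $$\langle f,g\rangle_{\mathbb{T}}=\sum_{T,T'\in\mathcal{Y}(\tau)}\int_{\mathbb{T}^N}\overline{f_T(x)}\,g_{T'}(x)\,\mathrm{d}\mu_{T,T'}(x)$$ for all Laurent polynomials $f,g$ with coefficients in $V_\tau$ (in particular for all $\zeta_{\alpha,T}$), where $f_T$ denotes the coordinates of $f$ in the orthonormal basis $\{\langle T,T\rangle_0^{-1/2}T\}$.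
   Context: Fix $N\ge2$ and a partition $\tau$ of $N$ that is neither $(N)$ nor $(1,\ldots,1)$; $\ell(\tau)$ is its number of nonzero parts, $h_\tau:=\tau_1+\ell(\tau)-1$. A reverse standard Young tableau (RSYT) of shape $\tau$ is a filling of the Ferrers diagram $\{(i,j):1\le i\le\ell(\tau),1\le j\le\tau_i\}$ with $1,\ldots,N$, each once, entries decreasing along each row and down each column; $\mathcal{Y}(\tau)$ is the set of them. For $T\in\mathcal{Y}(\tau)$ the entry $i$ sits in row $\mathrm{rw}(i,T)$, column $\mathrm{cm}(i,T)$, and its content is $c(i,T)=\mathrm{cm}(i,T)-\mathrm{rw}(i,T)$. $V_\tau$ is the vector space with basis $\mathcal{Y}(\tau)$, with Hermitian inner product $\langle T,T'\rangle_0=\delta_{T,T'}\prod_{1\le i<j\le N,\ c(i,T)\le c(j,T)-2}\big(1-(c(i,T)-c(j,T))^{-2}\big)$. The representation $\tau$ of the symmetric group $\mathcal{S}_N$ on $V_\tau$ is defined on simple transpositions $s_i=(i,i+1)$ by: if $i,i+1$ are in the same row of $T$, $\tau(s_i)T=T$; if in the same column, $\tau(s_i)T=-T$; otherwise, with $T^{(i)}$ the RSYT obtained by interchanging $i,i+1$ and $b=1/(c(i,T)-c(i+1,T))$, $\tau(s_i)T=T^{(i)}+bT$ if $\mathrm{rw}(i,T)<\mathrm{rw}(i+1,T)$ and $\tau(s_i)T=(1-b^2)T^{(i)}+bT$ if $\mathrm{rw}(i,T)>\mathrm{rw}(i+1,T)$. Each $\tau(w)$ is orthogonal for $\langle\cdot,\cdot\rangle_0$;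 write $\tau(i,j)$ for $\tau$ of the transposition $(i,j)$. $\kappa$ is a real parameter. $\mathcal{P}_\tau$ is the space of polynomials in $x=(x_1,\ldots,x_N)$ with coefficients in $V_\tau$; $\mathcal{S}_N$ acts by $(wp)(x)=\tau(w)p(xw)$ where $(xw)_i=x_{w(i)}$, and on multi-indices by $(w\alpha)_i=\alpha_{w^{-1}(i)}$. Dunkl operators: $\mathcal{D}_ip(x)=\partial_ip(x)+\kappa\sum_{j\ne i}\tau(i,j)\frac{p(x)-p(x(i,j))}{x_i-x_j}$; Cherednik–Dunkl operators: $\mathcal{U}_ip(x)=\mathcal{D}_i(x_ip(x))-\kappa\sum_{j<i}\tau(i,j)p(x(i,j))$. For $\alpha\in\mathbb{N}_0^N$, $\alpha^+$ is its nonincreasing rearrangement; $\alpha\prec\beta$ means $\sum_{j\le i}\alpha_j\le\sum_{j\le i}\beta_j$ for all $i$ and $\alpha\ne\beta$; $\alpha\vartriangleleft\beta$ means $|\alpha|=|\beta|$ and ($\alpha^+\prec\beta^+$, or $\alpha^+=\beta^+$ and $\alpha\prec\beta$). The rank function $r_\alpha(i)=\#\{j:\alpha_j>\alpha_i\}+\#\{j\le i:\alpha_j=\alpha_i\}$ is a permutation. The nonsymmetric Jack polynomial $\zeta_{\alpha,T}$ ($\alpha\in\mathbb{N}_0^N$, $T\in\mathcal{Y}(\tau)$) is the unique element of $\mathcal{P}_\tau$ of the form $x^\alpha\otimes\tau(r_\alpha^{-1})T+\sum_{\beta\vartriangleleft\alpha}x^\beta\otimes t_{\alpha\beta}$ with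 $\mathcal{U}_i\zeta_{\alpha,T}=\xi_{\alpha,T}(i)\zeta_{\alpha,T}$, $\xi_{\alpha,T}(i)=\alpha_i+1+\kappa c(r_\alpha(i),T)$, $1\le i\le N$. $\kappa$ is generic if $(\alpha,T)\ne(\beta,T')$ implies $\xi_{\alpha,T}\ne\xi_{\beta,T'}$; then $\{\zeta_{\alpha,T}\}$ is a basis of $\mathcal{P}_\tau$. For $\varepsilon=\pm1$, $\mathcal{E}_\varepsilon(\alpha,T)=\prod_{1\le i<j\le N,\ \alpha_i<\alpha_j}\big(1+\frac{\varepsilon\kappa}{\alpha_j-\alpha_i+\kappa(c(r_\alpha(j),T)-c(r_\alpha(i),T))}\big)$. The Hermitian form $\langle\cdot,\cdot\rangle_{\mathbb{T}}$ on $\mathcal{P}_\tau$ (conjugate-linear in the first argument) is defined by $\langle\zeta_{\alpha,T},\zeta_{\beta,T'}\rangle_{\mathbb{T}}=0$ if $(\alpha,T)\ne(\beta,T')$, $\langle\zeta_{\lambda,T},\zeta_{\lambda,T}\rangle_{\mathbb{T}}=\langle T,T\rangle_0\prod_{1\le i<j\le N}\prod_{\ell=1}^{\lambda_i-\lambda_j}\big(1-\big(\frac{\kappa}{\ell+\kappa(c(i,T)-c(j,T))}\big)^2\big)$ for partitions $\lambda$, and $\langle\zeta_{\alpha,T},\zeta_{\alpha,T}\rangle_{\mathbb{T}}=(\mathcal{E}_1(\alpha,T)\mathcal{E}_{-1}(\alpha,T))^{-1}\langle\zeta_{\alpha^+,T},\zeta_{\alpha^+,T}\rangle_{\mathbb{T}}$.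 The form extends to $V_\tau$-valued Laurent polynomials via $\zeta_{\alpha,T}:=(x_1\cdots x_N)^{-m}\zeta_{\alpha+m\mathbf{1},T}$ for $\alpha\in\mathbb{Z}^N$, $m\ge-\min_i\alpha_i$ (same defining formulas). For $-1/h_\tau<\kappa<1/h_\tau$ the $\zeta_{\alpha,T}$ and the form are well defined (the latter then positive definite). Coefficient matrices: $\boldsymbol{Z}_N=\{\gamma\in\mathbb{Z}^N:\sum_i\gamma_i=0\}$. For $\gamma\in\boldsymbol{Z}_N$ let $\gamma^\pi_i=\max(\gamma_i,0)$, $\gamma^\nu_i=\max(-\gamma_i,0)$; $(A_\gamma)_{T,T'}=(\langle T,T\rangle_0\langle T',T'\rangle_0)^{-1/2}\langle x^{\gamma^\pi}\otimes T,x^{\gamma^\nu}\otimes T'\rangle_{\mathbb{T}}$ for $\gamma\in\boldsymbol{Z}_N$, $A_\gamma=0$ otherwise. $\mathbb{T}^N=\{x\in\mathbb{C}^N:|x_j|=1\}$. *)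

theory Defs
  imports "HOL-Probability.Probability" "HOL-Library.Function_Algebras"
begin

text \<open>Indices (variables x_1..x_N and tableau entries) are 1-based.
 A reverse standard Young tableau T is encoded as a map from entries to cells (row, column),
 both 1-based, and (0,0) outside 1..N. Vectors of V_tau are functions from tableaux to complex
 numbers (supported on the set of RSYT). A (Laurent) polynomial with coefficients in V_tau is
 its coefficient function from multi-indices (nat => int, supported on 1..N) to V_tau.\<close>

type_synonym tab = "nat \<Rightarrow> nat \<times> nat"
type_synonym vec = "tab \<Rightarrow> complex"
type_synonym mi = "nat \<Rightarrow> int"
type_synonym lpoly = "mi \<Rightarrow> vec"

definition sw :: "nat \<Rightarrow> nat \<Rightarrow> nat \<Rightarrow> nat" where
  "sw i j k = (if k = i then j else if k = j then i else k)"

definition part :: "nat list \<Rightarrow> nat \<Rightarrow> nat" where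
  "part \<tau> i = (if 1 \<le> i \<and> i \<le> length \<tau> then \<tau> ! (i - 1) else 0)"

definition is_partition :: "nat \<Rightarrow> nat list \<Rightarrow> bool" where
  "is_partition N \<tau> \<longleftrightarrow> sorted (rev \<tau>) \<and> 0 \<notin> set \<tau> \<and> sum_list \<tau> = N"

definition htau :: "nat list \<Rightarrow> nat" where
  "htau \<tau> = part \<tau> 1 + length \<tau> - 1"

definition ferrers :: "nat list \<Rightarrow> (nat \<times> nat) set" where
  "ferrers \<tau> = {(i, j). 1 \<le> i \<and> i \<le> length \<tau> \<and> 1 \<le> j \<and> j \<le> part \<tau> i}"

definition rw :: "nat \<Rightarrow> tab \<Rightarrow> nat" where "rw i T = fst (T i)"
definition cm :: "nat \<Rightarrow> tab \<Rightarrow> nat" where "cm i T = snd (T i)"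

definition RSYT :: "nat \<Rightarrow> nat list \<Rightarrow> tab set" where
  "RSYT N \<tau> = {T. bij_betw T {1..N} (ferrers \<tau>) \<and> (\<forall>i. i \<notin> {1..N} \<longrightarrow> T i = (0, 0))
     \<and> (\<forall>i\<in>{1..N}. \<forall>j\<in>{1..N}. rw i T = rw j T \<and> cm i T < cm j T \<longrightarrow> j < i)
     \<and> (\<forall>i\<in>{1..N}. \<forall>j\<in>{1..N}. cm i T = cm j T \<and> rw i T < rw j T \<longrightarrow> j < i)}"

definition cont :: "nat \<Rightarrow> tab \<Rightarrow> int" where
  "cont i T = int (cm i T) - int (rw i T)"

definition ip0 :: "nat \<Rightarrow> tab \<Rightarrow> real" where
  "ip0 N T = (\<Prod>(i, j)\<in>{(i, j). 1 \<le> i \<and> i < j \<and> j \<le> N \<and> cont i T \<le> cont j T - 2}.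
               1 - 1 / (real_of_int (cont i T - cont j T))\<^sup>2)"

definition bv :: "tab \<Rightarrow> vec" where
  "bv T = (\<lambda>S. if S = T then 1 else 0)"

definition tau_sb :: "nat \<Rightarrow> tab \<Rightarrow> vec" where
  "tau_sb i T =
    (if rw i T = rw (Suc i) T then bv T
     else if cm i T = cm (Suc i) T then - bv T
     else (let T' = T \<circ> sw i (Suc i);
               b = 1 / real_of_int (cont i T - cont (Suc i) T)
           in if rw i T < rw (Suc i) T
              then (\<lambda>S. bv T' S + complex_of_real b * bv T S)
              else (\<lambda>S. complex_of_real (1 - b\<^sup>2) * bv T' S + complex_of_real b * bv T S)))"

definition tau_s :: "nat \<Rightarrow> nat list \<Rightarrow> nat \<Rightarrow> vec \<Rightarrow> vec" where
  "tau_s N \<tau> i v = (\<lambda>S. \<Sum>T\<in>RSYT N \<tau>. v T * tau_sb i T S)"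

definition word_perm :: "nat list \<Rightarrow> nat \<Rightarrow> nat" where
  "word_perm ws = foldr (\<lambda>i f. sw i (Suc i) \<circ> f) ws id"

definition tau_word :: "nat \<Rightarrow> nat list \<Rightarrow> nat list \<Rightarrow> vec \<Rightarrow> vec" where
  "tau_word N \<tau> ws = foldr (\<lambda>i g. tau_s N \<tau> i \<circ> g) ws id"

definition tau_perm :: "nat \<Rightarrow> nat list \<Rightarrow> (nat \<Rightarrow> nat) \<Rightarrow> vec \<Rightarrow> vec" where
  "tau_perm N \<tau> w = tau_word N \<tau> (SOME ws. set ws \<subseteq> {1..<N} \<and> word_perm ws = w)"

definition tau_tr :: "nat \<Rightarrow> nat list \<Rightarrow> nat \<Rightarrow> nat \<Rightarrow> vec \<Rightarrow> vec" where
  "tau_tr N \<tau> i j = tau_perm N \<tau> (sw i j)"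

definition supp_ok :: "nat \<Rightarrow> mi \<Rightarrow> bool" where
  "supp_ok N \<beta> \<longleftrightarrow> (\<forall>k. k \<notin> {1..N} \<longrightarrow> \<beta> k = 0)"

definition is_lpoly :: "nat \<Rightarrow> nat list \<Rightarrow> lpoly \<Rightarrow> bool" where
  "is_lpoly N \<tau> p \<longleftrightarrow> finite {\<beta>. p \<beta> \<noteq> 0} \<and> (\<forall>\<beta>. p \<beta> \<noteq> 0 \<longrightarrow> supp_ok N \<beta>)
     \<and> (\<forall>\<beta> T. p \<beta> T \<noteq> 0 \<longrightarrow> T \<in> RSYT N \<tau>)"

definition is_poly :: "nat \<Rightarrow> nat list \<Rightarrow> lpoly \<Rightarrow> bool" where
  "is_poly N \<tau> p \<longleftrightarrow> is_lpoly N \<tau> p \<and> (\<forall>\<beta>. p \<beta> \<noteq> 0 \<longrightarrow> (\<forall>k. 0 \<le> \<beta> k))"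

definition monov :: "mi \<Rightarrow> vec \<Rightarrow> lpoly" where
  "monov \<beta> v = (\<lambda>\<gamma>. if \<gamma> = \<beta> then v else 0)"

definition xmul :: "nat \<Rightarrow> lpoly \<Rightarrow> lpoly" where
  "xmul i p = (\<lambda>\<beta>. p (\<beta>(i := \<beta> i - 1)))"

definition pder :: "nat \<Rightarrow> lpoly \<Rightarrow> lpoly" where
  "pder i p = (\<lambda>\<beta> S. of_int (\<beta> i + 1) * p (\<beta>(i := \<beta> i + 1)) S)"

definition swv :: "nat \<Rightarrow> nat \<Rightarrow> lpoly \<Rightarrow> lpoly" where
  "swv i j p = (\<lambda>\<beta>. p (\<beta> \<circ> sw i j))"

text \<open>(p(x) - p(x(i,j))) / (x_i - x_j) for a polynomial p (i \<noteq> j), coefficientwise.\<close>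
definition ddiff :: "nat \<Rightarrow> nat \<Rightarrow> lpoly \<Rightarrow> lpoly" where
  "ddiff i j p = (\<lambda>\<gamma> S. if 0 \<le> \<gamma> i \<and> 0 \<le> \<gamma> j then
      (\<Sum>b\<in>{0..min (\<gamma> i) (\<gamma> j)}.
          p (\<gamma>(i := \<gamma> i + \<gamma> j + 1 - b, j := b)) S - p (\<gamma>(i := b, j := \<gamma> i + \<gamma> j + 1 - b)) S)
      else 0)"

definition dunkl :: "nat \<Rightarrow> nat list \<Rightarrow> real \<Rightarrow> nat \<Rightarrow> lpoly \<Rightarrow> lpoly" where
  "dunkl N \<tau> \<kappa> i p = (\<lambda>\<beta> S. pder i p \<beta> S
      + complex_of_real \<kappa> * (\<Sum>j\<in>{1..N} - {i}. tau_tr N \<tau> i j (ddiff i j p \<beta>) S))"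

definition cherednik :: "nat \<Rightarrow> nat list \<Rightarrow> real \<Rightarrow> nat \<Rightarrow> lpoly \<Rightarrow> lpoly" where
  "cherednik N \<tau> \<kappa> i p = (\<lambda>\<beta> S. dunkl N \<tau> \<kappa> i (xmul i p) \<beta> S
      - complex_of_real \<kappa> * (\<Sum>j\<in>{1..<i}. tau_tr N \<tau> i j (swv i j p \<beta>) S))"

definition msum :: "nat \<Rightarrow> mi \<Rightarrow> int" where
  "msum N \<beta> = (\<Sum>k\<in>{1..N}. \<beta> k)"

definition dom_lt :: "nat \<Rightarrow> mi \<Rightarrow> mi \<Rightarrow> bool" where
  "dom_lt N \<alpha> \<beta> \<longleftrightarrow> (\<forall>i\<in>{1..N}. (\<Sum>j\<in>{1..i}. \<alpha> j) \<le> (\<Sum>j\<in>{1..i}. \<beta> j)) \<and> \<alpha> \<noteq> \<beta>"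

definition mplus :: "nat \<Rightarrow> mi \<Rightarrow> mi" where
  "mplus N \<alpha> = (THE lam. (\<exists>w. w permutes {1..N} \<and> lam = \<alpha> \<circ> w)
                  \<and> (\<forall>i j. 1 \<le> i \<longrightarrow> i \<le> j \<longrightarrow> j \<le> N \<longrightarrow> lam j \<le> lam i))"

definition tri_lt :: "nat \<Rightarrow> mi \<Rightarrow> mi \<Rightarrow> bool" where
  "tri_lt N \<alpha> \<beta> \<longleftrightarrow> msum N \<alpha> = msum N \<beta> \<and>
     (dom_lt N (mplus N \<alpha>) (mplus N \<beta>) \<or> (mplus N \<alpha> = mplus N \<beta> \<and> dom_lt N \<alpha> \<beta>))"

definition rank :: "nat \<Rightarrow> mi \<Rightarrow> nat \<Rightarrow> nat" where
  "rank N \<alpha> i = card {j\<in>{1..N}. \<alpha> j > \<alpha> i} + card {j\<in>{1..i}. \<alpha> j = \<alpha> i}"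

definition rank_inv :: "nat \<Rightarrow> mi \<Rightarrow> nat \<Rightarrow> nat" where
  "rank_inv N \<alpha> = (\<lambda>k. if k \<in> {1..N} then inv_into {1..N} (rank N \<alpha>) k else k)"

definition xi :: "nat \<Rightarrow> real \<Rightarrow> mi \<Rightarrow> tab \<Rightarrow> nat \<Rightarrow> real" where
  "xi N \<kappa> \<alpha> T i = real_of_int (\<alpha> i) + 1 + \<kappa> * real_of_int (cont (rank N \<alpha> i) T)"

definition zeta :: "nat \<Rightarrow> nat list \<Rightarrow> real \<Rightarrow> mi \<Rightarrow> tab \<Rightarrow> lpoly" where
  "zeta N \<tau> \<kappa> \<alpha> T = (THE p. is_poly N \<tau> p
      \<and> p \<alpha> = tau_perm N \<tau> (rank_inv N \<alpha>) (bv T)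
      \<and> (\<forall>\<beta>. \<beta> \<noteq> \<alpha> \<and> p \<beta> \<noteq> 0 \<longrightarrow> tri_lt N \<beta> \<alpha>)
      \<and> (\<forall>i\<in>{1..N}. cherednik N \<tau> \<kappa> i p = (\<lambda>\<beta> S. complex_of_real (xi N \<kappa> \<alpha> T i) * p \<beta> S)))"

definition shiftm :: "nat \<Rightarrow> int \<Rightarrow> lpoly \<Rightarrow> lpoly" where
  "shiftm N m p = (\<lambda>\<beta>. p (\<lambda>k. if k \<in> {1..N} then \<beta> k + m else \<beta> k))"

definition zetaL :: "nat \<Rightarrow> nat list \<Rightarrow> real \<Rightarrow> mi \<Rightarrow> tab \<Rightarrow> lpoly" where
  "zetaL N \<tau> \<kappa> \<alpha> T = (let m = max 0 (- Min (\<alpha> ` {1..N})) in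
      shiftm N m (zeta N \<tau> \<kappa> (\<lambda>k. if k \<in> {1..N} then \<alpha> k + m else \<alpha> k) T))"

definition Efac :: "nat \<Rightarrow> real \<Rightarrow> real \<Rightarrow> mi \<Rightarrow> tab \<Rightarrow> real" where
  "Efac N \<kappa> \<epsilon> \<alpha> T = (\<Prod>(i, j)\<in>{(i, j). 1 \<le> i \<and> i < j \<and> j \<le> N \<and> \<alpha> i < \<alpha> j}.
     1 + \<epsilon> * \<kappa> / (real_of_int (\<alpha> j - \<alpha> i)
                     + \<kappa> * real_of_int (cont (rank N \<alpha> j) T - cont (rank N \<alpha> i) T)))"

text \<open>norm of zeta_{lambda,T} for lambda a partition (also with negative entries)\<close>
definition normpart :: "nat \<Rightarrow> real \<Rightarrow> mi \<Rightarrow> tab \<Rightarrow> real" where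
  "normpart N \<kappa> lam T = ip0 N T * (\<Prod>(i, j)\<in>{(i, j). 1 \<le> i \<and> i < j \<and> j \<le> N}.
     \<Prod>l\<in>{1..nat (lam i - lam j)}.
       1 - (\<kappa> / (real l + \<kappa> * real_of_int (cont i T - cont j T)))\<^sup>2)"

definition nrm :: "nat \<Rightarrow> real \<Rightarrow> mi \<Rightarrow> tab \<Rightarrow> real" where
  "nrm N \<kappa> \<alpha> T = normpart N \<kappa> (mplus N \<alpha>) T / (Efac N \<kappa> 1 \<alpha> T * Efac N \<kappa> (-1) \<alpha> T)"

definition Idx :: "nat \<Rightarrow> nat list \<Rightarrow> (mi \<times> tab) set" where
  "Idx N \<tau> = {(\<alpha>, T). supp_ok N \<alpha> \<and> T \<in> RSYT N \<tau>}"

definition coeffs :: "nat \<Rightarrow> nat list \<Rightarrow> real \<Rightarrow> lpoly \<Rightarrow> mi \<times> tab \<Rightarrow> complex" where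
  "coeffs N \<tau> \<kappa> f = (THE c. finite {k. c k \<noteq> 0} \<and> (\<forall>k. c k \<noteq> 0 \<longrightarrow> k \<in> Idx N \<tau>)
      \<and> f = (\<Sum>k\<in>{k. c k \<noteq> 0}. (\<lambda>\<beta> S. c k * zetaL N \<tau> \<kappa> (fst k) (snd k) \<beta> S)))"

definition formT :: "nat \<Rightarrow> nat list \<Rightarrow> real \<Rightarrow> lpoly \<Rightarrow> lpoly \<Rightarrow> complex" where
  "formT N \<tau> \<kappa> f g = (\<Sum>k\<in>{k. coeffs N \<tau> \<kappa> f k \<noteq> 0}.
      cnj (coeffs N \<tau> \<kappa> f k) * coeffs N \<tau> \<kappa> g k * complex_of_real (nrm N \<kappa> (fst k) (snd k)))"

definition Amat :: "nat \<Rightarrow> nat list \<Rightarrow> real \<Rightarrow> mi \<Rightarrow> tab \<Rightarrow> tab \<Rightarrow> complex" where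
  "Amat N \<tau> \<kappa> \<gamma> T T' = (if msum N \<gamma> = 0 then
      complex_of_real (1 / sqrt (ip0 N T * ip0 N T'))
      * formT N \<tau> \<kappa> (monov (\<lambda>k. max (\<gamma> k) 0) (bv T)) (monov (\<lambda>k. max (- \<gamma> k) 0) (bv T'))
    else 0)"

definition circle :: "complex set" where "circle = {z. cmod z = 1}"

text \<open>The torus T^N with its Borel (= Baire) sigma algebra.\<close>
definition torusM :: "nat \<Rightarrow> (nat \<Rightarrow> complex) measure" where
  "torusM N = PiM {1..N} (\<lambda>_. restrict_space borel circle)"

text \<open>A complex measure, represented by a Jordan decomposition nu1 - nu2 + i (nu3 - nu4)
  into finite positive measures.\<close>
type_synonym cmeas = "(nat \<Rightarrow> complex) measure \<times> (nat \<Rightarrow> complex) measure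
                      \<times> (nat \<Rightarrow> complex) measure \<times> (nat \<Rightarrow> complex) measure"

definition cm1 :: "cmeas \<Rightarrow> (nat \<Rightarrow> complex) measure" where "cm1 \<mu> = fst \<mu>"
definition cm2 :: "cmeas \<Rightarrow> (nat \<Rightarrow> complex) measure" where "cm2 \<mu> = fst (snd \<mu>)"
definition cm3 :: "cmeas \<Rightarrow> (nat \<Rightarrow> complex) measure" where "cm3 \<mu> = fst (snd (snd \<mu>))"
definition cm4 :: "cmeas \<Rightarrow> (nat \<Rightarrow> complex) measure" where "cm4 \<mu> = snd (snd (snd \<mu>))"

definition cmeasure_on :: "(nat \<Rightarrow> complex) measure \<Rightarrow> cmeas \<Rightarrow> bool" where
  "cmeasure_on M \<mu> \<longleftrightarrow> (\<forall>\<nu>\<in>{cm1 \<mu>, cm2 \<mu>, cm3 \<mu>, cm4 \<mu>}. finite_measure \<nu> \<and> sets \<nu> = sets M)"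

definition cval :: "cmeas \<Rightarrow> (nat \<Rightarrow> complex) set \<Rightarrow> complex" where
  "cval \<mu> A = complex_of_real (measure (cm1 \<mu>) A - measure (cm2 \<mu>) A)
              + \<i> * complex_of_real (measure (cm3 \<mu>) A - measure (cm4 \<mu>) A)"

definition cpositive :: "(nat \<Rightarrow> complex) measure \<Rightarrow> cmeas \<Rightarrow> bool" where
  "cpositive M \<mu> \<longleftrightarrow> (\<forall>A\<in>sets M. cval \<mu> A \<in> \<real> \<and> 0 \<le> Re (cval \<mu> A))"

definition cint :: "cmeas \<Rightarrow> ((nat \<Rightarrow> complex) \<Rightarrow> complex) \<Rightarrow> complex" where
  "cint \<mu> f = (integral\<^sup>L (cm1 \<mu>) f - integral\<^sup>L (cm2 \<mu>) f)
              + \<i> * (integral\<^sup>L (cm3 \<mu>) f - integral\<^sup>L (cm4 \<mu>) f)"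

definition xpow :: "nat \<Rightarrow> (nat \<Rightarrow> complex) \<Rightarrow> mi \<Rightarrow> complex" where
  "xpow N x \<beta> = (\<Prod>k\<in>{1..N}. x k powi \<beta> k)"

text \<open>f_T(x): coordinate of f(x) in the orthonormal basis <T,T>_0^(-1/2) T\<close>
definition coord :: "nat \<Rightarrow> lpoly \<Rightarrow> tab \<Rightarrow> (nat \<Rightarrow> complex) \<Rightarrow> complex" where
  "coord N f T x = complex_of_real (sqrt (ip0 N T)) * (\<Sum>\<beta>\<in>{\<beta>. f \<beta> \<noteq> 0}. f \<beta> T * xpow N x \<beta>)"

end

theory Submission
  imports Defs
begin

text \<open>
  The form \<open>\<langle>f, g\<rangle>\<^sub>T\<close> is invariant under multiplication of both arguments by a variable, so the matrices
  \<open>A\<^sub>\<gamma>\<close> are the Gram matrix of the monomials, and \<open>\<gamma> \<mapsto> v\<^sup>* A\<^sub>\<gamma> v\<close> is a positive definite function on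
  \<open>\<int>\<^sup>N\<close> for every vector \<open>v\<close>. It is therefore the Fourier transform of a positive measure on the torus, and
  polarization in \<open>v\<close> gives the off-diagonal measures.

  Invariance comes from the affine structure. The simple transpositions act on Jack polynomials by
  \<open>2 \<times> 2\<close> blocks that are self-adjoint for the given norms, and the affine step \<open>\<Theta> = x\<^sub>N w\<close>, with \<open>w\<close> the
  cyclic shift, permutes the Jack polynomials and preserves their norms. Both facts become visible once the norm
  is written as \<open>\<langle>T, T\<rangle>\<^sub>0 \<Prod>\<^bsub>i \<noteq> j\<^esub> \<Prod>\<^bsub>l = 1\<^esub>\<^bsup>\<alpha>\<^sub>i - \<alpha>\<^sub>j - [j < i]\<^esup> (1 - (\<kappa> / (l + \<kappa> (c(r i) - c(r j))))\<^sup>2)\<close>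
  with \<open>r\<close> the rank function, in which the factors of \<open>E\<^sub>1 E\<^sub>-\<^sub>1\<close> have cancelled.

  The Jack polynomials themselves are obtained from \<open>1 \<otimes> T\<close> by these two kinds of steps. Triangularity need
  not be tracked along the way: since the contents of \<open>\<tau>\<close> differ by less than \<open>h\<^sub>\<tau>\<close>, the eigenvalues of the
  Cherednik--Dunkl operators determine \<open>\<alpha>\<close> when \<open>\<bar>\<kappa>\<bar> < 1 / h\<^sub>\<tau>\<close>, so every maximal exponent of a joint
  eigenvector with eigenvalues \<open>\<xi>\<^bsub>\<alpha>,T\<^esub>\<close> must be \<open>\<alpha>\<close>.
\<close>

section \<open>Fourier coefficients of measures on the torus\<close>

text \<open>The representation, the Jack polynomials and the coordinates entering the form are given
  by choice or description operators, so the Coxeter relations, the existence and uniqueness of the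
  joint eigenvectors and their being a basis have to be settled before anything can be computed.
  \<kappa> may be non-generic, for instance 0, and then eigenvalues do not separate tableaux: a Jack
  polynomial is pinned down by its leading coefficient, and self-adjointness of transpositions is
  read off from blocks and norms rather than from the spectrum. Multiplication by x_N is far from
  diagonal in the Jack basis; it becomes accessible because it is \<Theta> composed with the inverse
  cyclic shift, and conjugation by a transposition reaches the other variables. The bound on
  \<kappa> is used a second time for positivity: the norm factors contain one more \<kappa> than the
  eigenvalue differences, and h exceeds the largest content difference by 1. Weak limits of measures
  are taken on an interval; a continuous curve through all dyadic points of the unit cube connects
  it with the torus.\<close>

lemma dyadic_expansion:
  "j < 2 ^ n \<Longrightarrow> \<exists>b. (\<forall>k. b k \<le> (1::nat)) \<and> (\<Sum>k<n. real (b k) * (1/2) ^ Suc k) = real j / 2 ^ n"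
proof (induction n arbitrary: j)
  case 0
  thus ?case by (intro exI[of _ "\<lambda>_. 0"]) auto
next
  case (Suc n)
  hence "j div 2 < 2 ^ n" by auto
  then obtain b where b: "\<forall>k. b k \<le> (1::nat)" "(\<Sum>k<n. real (b k) * (1/2) ^ Suc k) = real (j div 2) / 2 ^ n"
    using Suc.IH by blast
  define b' where "b' = b(n := j mod 2)"
  have "(\<Sum>k<n. real (b' k) * (1/2) ^ Suc k) = (\<Sum>k<n. real (b k) * (1/2) ^ Suc k)"
    by (intro sum.cong) (auto simp: b'_def)
  hence "(\<Sum>k<Suc n. real (b' k) * (1/2) ^ Suc k) = real (j div 2) / 2 ^ n + real (j mod 2) * (1/2) ^ Suc n"
    using b(2) by (simp add: b'_def)
  also have "\<dots> = (2 * real (j div 2) + real (j mod 2)) / 2 ^ Suc n"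
    by (simp add: power_divide add_divide_distrib)
  also have "2 * real (j div 2) + real (j mod 2) = real j"
    by (metis mult_div_mod_eq of_nat_add of_nat_mult of_nat_numeral)
  finally have "(\<Sum>k<Suc n. real (b' k) * (1/2) ^ Suc k) = real j / 2 ^ Suc n" .
  moreover have "\<forall>k. b' k \<le> 1" using b(1) by (auto simp: b'_def)
  ultimately show ?case by blast
qed

text \<open>A profile for Schoenberg's space-filling curve: continuous, \<open>2\<close>-periodic, \<open>0\<close> on \<open>[0, 1/3]\<close>
  and \<open>1\<close> on \<open>[2/3, 1]\<close>, so that it reads off ternary digits \<open>0\<close> and \<open>2\<close>.\<close>
definition schoen :: "real \<Rightarrow> real" where
  "schoen t = max 0 (min 1 (1/2 - cos (pi * t)))"

text \<open>The integer \<open>m\<close> only adds full periods. The digit places the rest in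
  [0, 1/3] or [2/3, 1], where the cosine is at least 1/2 or at most -1/2, so that the clamping in
  \<open>schoen\<close> takes effect.\<close>

lemma schoen_digit:
  assumes "a \<le> (1::nat)" "0 \<le> r" "r \<le> 1"
  shows "schoen (2 * real_of_int m + (2 * real a + r) / 3) = real a"
proof -
  let ?s = "(2 * real a + r) / 3"
  have "cos (pi * (2 * real_of_int m + ?s)) = cos (2 * pi * real_of_int m + pi * ?s)" by (simp add: algebra_simps)
  also have "\<dots> = cos (pi * ?s)" unfolding cos_add by simp
  finally have c: "cos (pi * (2 * real_of_int m + ?s)) = cos (pi * ?s)" .
  have s: "0 \<le> pi * ?s" "pi * ?s \<le> pi" using assms mult_left_le[of ?s pi] by auto
  consider "a = 0" | "a = 1" using assms(1) by linarith
  thus ?thesis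
  proof cases
    case 1
    have "cos (pi / 3) \<le> cos (pi * ?s)" using s 1 assms by (intro cos_monotone_0_pi_le) auto
    thus ?thesis unfolding schoen_def c using 1 by (simp add: cos_60)
  next
    case 2
    have "cos (pi * ?s) \<le> cos (2 * pi / 3)" using s 2 assms by (intro cos_monotone_0_pi_le) auto
    thus ?thesis unfolding schoen_def c using 2 by (simp add: cos_120)
  qed
qed

text \<open>\<open>t i\<close> is the tail of the ternary expansion from digit \<open>i\<close> on.
  Multiplying by 3 moves one digit in front of the point; all digits are 0 or 2, so the integer
  split off is even and is a multiple of the period of \<open>schoen\<close>.\<close>

lemma ternary_digit:
  fixes a :: "nat \<Rightarrow> nat"
  assumes a: "\<And>j. a j \<le> 1" "\<And>j. K \<le> j \<Longrightarrow> a j = 0"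
  defines "t \<equiv> \<lambda>i. \<Sum>j<K. 2 * real (a (i + j)) / 3 ^ Suc j"
  shows "0 \<le> t i \<and> t i \<le> 1" and "schoen (3 ^ i * t 0) = real (a i)"
proof -
  have "(\<Sum>j<L. 2 * real (a (i + j)) / 3 ^ Suc j) \<le> 1 - 1 / 3 ^ L" for L i
  proof (induction L)
    case (Suc L)
    have "2 * real (a (i + L)) / 3 ^ Suc L \<le> 2 / 3 ^ Suc L"
      using a(1)[of "i + L"] by (intro divide_right_mono) auto
    thus ?case using Suc by simp
  qed simp
  hence t1: "t i \<le> 1" for i unfolding t_def by (rule order_trans) simp
  have t0: "0 \<le> t i" for i unfolding t_def by (intro sum_nonneg) auto
  show "0 \<le> t i \<and> t i \<le> 1" using t0 t1 by simp
  have step: "3 * t i = 2 * real (a i) + t (Suc i)" for i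
  proof (cases K)
    case 0
    thus ?thesis using a(2) by (simp add: t_def)
  next
    case (Suc K')
    have "t i = 2 * real (a i) / 3 + (\<Sum>j<K'. 2 * real (a (i + Suc j)) / 3 ^ Suc (Suc j))"
      unfolding t_def Suc sum.lessThan_Suc_shift by simp
    moreover have "t (Suc i) = (\<Sum>j<K'. 2 * real (a (i + Suc j)) / 3 ^ Suc j)"
      unfolding t_def Suc sum.lessThan_Suc using a(2)[of "Suc i + K'"] Suc by simp
    moreover have "(\<Sum>j<K'. 2 * real (a (i + Suc j)) / 3 ^ Suc j) = 3 * (\<Sum>j<K'. 2 * real (a (i + Suc j)) / 3 ^ Suc (Suc j))"
      unfolding sum_distrib_left by (intro sum.cong) auto
    ultimately show ?thesis by simp
  qed
  have "\<exists>m::int. 3 ^ i * t 0 = 2 * real_of_int m + t i"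
  proof (induction i)
    case 0
    show ?case by (intro exI[of _ 0]) simp
  next
    case (Suc i)
    then obtain m :: int where m: "3 ^ i * t 0 = 2 * real_of_int m + t i" by blast
    have "3 ^ Suc i * t 0 = 3 * (2 * real_of_int m + t i)" using m by simp
    also have "\<dots> = 2 * real_of_int (3 * m + int (a i)) + t (Suc i)" using step[of i] by simp
    finally show ?case by blast
  qed
  then obtain m :: int where m: "3 ^ i * t 0 = 2 * real_of_int m + t i" by blast
  moreover have "t i = (2 * real (a i) + t (Suc i)) / 3" using step[of i] by simp
  ultimately show "schoen (3 ^ i * t 0) = real (a i)"
    using schoen_digit[OF a(1) t0 t1] by simp
qed

text \<open>Coordinate functions of Schoenberg's space-filling curve: the ternary digits of
  \<open>t\<close> are dealt out cyclically, and those at positions \<open>N * k + m\<close> become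
  the binary digits of coordinate \<open>m\<close>.\<close>

definition curve :: "nat \<Rightarrow> nat \<Rightarrow> real \<Rightarrow> real" where
  "curve N m t = (\<Sum>k. schoen (3 ^ (N * k + m) * t) * (1/2) ^ Suc k)"

lemma isCont_curve: "isCont (curve N m) t"
proof -
  let ?f = "\<lambda>k t. schoen (3 ^ (N * k + m) * t) * (1/2) ^ Suc k"
  have "uniform_limit UNIV (\<lambda>n t. \<Sum>k<n. ?f k t) (\<lambda>t. \<Sum>k. ?f k t) sequentially"
  proof (rule Weierstrass_m_test)
    show "norm (?f k t) \<le> (1/2) ^ Suc k" for k t
      by (auto simp: schoen_def abs_mult intro!: mult_left_le_one_le)
    show "summable (\<lambda>k. (1/2 :: real) ^ Suc k)" by (subst summable_Suc_iff) (simp add: summable_geometric)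
  qed
  moreover have "continuous_on UNIV (\<lambda>t. \<Sum>k<n. ?f k t)" for n
    unfolding schoen_def by (intro continuous_intros)
  ultimately have "continuous_on UNIV (curve N m)"
    unfolding curve_def[abs_def] by (intro uniform_limit_theorem[where F = sequentially]) auto
  thus ?thesis by (simp add: continuous_on_eq_continuous_at)
qed

text \<open>Only dyadic points have to be reached, because the measures transported by the curve
  live on dyadic grids. Finitely many digits therefore suffice.\<close>

lemma curve_hits:
  assumes N: "1 \<le> N" and q: "\<And>m. m \<in> {1..N} \<Longrightarrow> q m < 2 ^ n"
  shows "\<exists>t. 0 \<le> t \<and> t \<le> 1 \<and> (\<forall>m\<in>{1..N}. curve N m t = real (q m) / 2 ^ n)"
proof -
  have "\<forall>m\<in>{1..N}. \<exists>b. (\<forall>k. b k \<le> (1::nat)) \<and> (\<Sum>k<n. real (b k) * (1/2) ^ Suc k) = real (q m) / 2 ^ n"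
    using dyadic_expansion q by blast
  then obtain b where b: "\<And>m k. m \<in> {1..N} \<Longrightarrow> b m k \<le> (1::nat)"
    "\<And>m. m \<in> {1..N} \<Longrightarrow> (\<Sum>k<n. real (b m k) * (1/2) ^ Suc k) = real (q m) / 2 ^ n"
    unfolding bchoice_iff by blast
  \<comment> \<open>Coordinates are numbered from 1, so position \<open>j = N * k + m\<close>
    corresponds to \<open>(j - 1) div N = k\<close> and \<open>(j - 1) mod N + 1 = m\<close>;
    position 0 belongs to no coordinate and gets the digit 0.\<close>
  define a where "a j = (if 1 \<le> j \<and> (j - 1) div N < n then b ((j - 1) mod N + 1) ((j - 1) div N) else 0)" for j
  have "(j - 1) mod N + 1 \<in> {1..N}" for j using N by (simp add: Suc_leI)
  hence a1: "a j \<le> 1" for j unfolding a_def using b(1) by auto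
  have a0: "a j = 0" if "N * n + 1 \<le> j" for j
  proof -
    have "n \<le> (j - 1) div N" using N that by (simp add: less_eq_div_iff_mult_less_eq mult.commute)
    thus ?thesis by (simp add: a_def)
  qed
  define t where "t = (\<Sum>j<N * n + 1. 2 * real (a (0 + j)) / 3 ^ Suc j)"
  note tern = ternary_digit[of a "N * n + 1", OF a1 a0]
  have t: "0 \<le> t \<and> t \<le> 1" unfolding t_def by (rule tern(1))
  moreover have "curve N m t = real (q m) / 2 ^ n" if m: "m \<in> {1..N}" for m
  proof -
    have dig: "schoen (3 ^ (N * k + m) * t) = (if k < n then real (b m k) else 0)" for k
    proof -
      have "N * k + m - 1 = (m - 1) + N * k" "m - 1 < N" using m by auto
      hence "(N * k + m - 1) div N = k" "(N * k + m - 1) mod N = m - 1" by auto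
      hence "a (N * k + m) = (if k < n then b m k else 0)" using m by (auto simp: a_def)
      moreover have "schoen (3 ^ (N * k + m) * t) = real (a (N * k + m))" unfolding t_def by (rule tern(2))
      ultimately show ?thesis by simp
    qed
    have "curve N m t = (\<Sum>k<n. (if k < n then real (b m k) else 0) * (1/2) ^ Suc k)"
      unfolding curve_def dig by (rule suminf_finite) auto
    thus ?thesis using b(2)[OF m] by simp
  qed
  ultimately show ?thesis by blast
qed

section \<open>Characters of the torus and their orthogonality on grids of roots of unity\<close>

lemma sum_cis_grid:
  assumes "0 < M" "\<bar>d\<bar> < int M"
  shows "(\<Sum>i<M. cis (of_int d * (2 * pi * (real i / real M)))) = (if d = 0 then of_nat M else 0)"
proof (cases "d = 0")
  case False
  let ?w = "cis (2 * pi * (of_int d / real M))"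
  have "cis (of_int d * (2 * pi * (real i / real M))) = ?w ^ i" for i
  proof -
    have "?w ^ i = cis (real i * (2 * pi * (of_int d / real M)))" by (rule Complex.DeMoivre)
    also have "\<dots> = cis (of_int d * (2 * pi * (real i / real M)))" by (rule arg_cong[where f = cis]) simp
    finally show ?thesis ..
  qed
  moreover have "?w \<noteq> 1"
  proof
    assume "?w = 1"
    hence "cos (2 * pi * (of_int d / real M)) = 1" by (metis cis.simps(1) one_complex.simps(1))
    then obtain l :: int where "2 * pi * (of_int d / real M) = l * 2 * pi" by (auto simp: cos_one_2pi_int)
    hence "(2 * pi) * real_of_int d = (2 * pi) * (of_int l * real M)" using assms(1) by (simp add: field_simps)
    hence "real_of_int d = of_int (l * int M)" by simp
    hence "d = l * int M" by linarith
    hence "int M dvd d" by simp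
    thus False using False assms(2) zdvd_imp_le[of "int M" "\<bar>d\<bar>"] by auto
  qed
  moreover have "?w ^ M = 1"
  proof -
    have "real M * (2 * pi * (of_int d / real M)) = 2 * pi * of_int d" using assms(1) by simp
    thus ?thesis unfolding Complex.DeMoivre by simp
  qed
  ultimately show ?thesis using False by (simp add: geometric_sum)
qed simp

lemma xpow_cis: "xpow N (\<lambda>k. cis (\<theta> k)) \<delta> = cis (\<Sum>k\<in>{1..N}. of_int (\<delta> k) * \<theta> k)"
proof -
  have "(\<Prod>k\<in>A. cis (f k)) = cis (\<Sum>k\<in>A. f k)" if "finite A" for A :: "nat set" and f
    using that by (induction A rule: finite_induct) (auto simp: cis_mult)
  thus ?thesis by (simp add: xpow_def cis_power_int)
qed

lemma xpow_cis_add: "xpow N (\<lambda>k. cis (\<theta> k)) (\<alpha> + \<beta>) = xpow N (\<lambda>k. cis (\<theta> k)) \<alpha> * xpow N (\<lambda>k. cis (\<theta> k)) \<beta>"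
  by (simp add: xpow_cis cis_mult distrib_right sum.distrib)

lemma xpow_cis_cnj: "cnj (xpow N (\<lambda>k. cis (\<theta> k)) \<alpha>) = xpow N (\<lambda>k. cis (\<theta> k)) (- \<alpha>)"
  by (simp add: xpow_cis cis_cnj sum_negf)

lemma xpow_measurable: "(\<lambda>x. xpow N x \<delta>) \<in> borel_measurable (torusM N)"
proof -
  have "(\<lambda>x. x k powi d) \<in> borel_measurable (torusM N)" if "k \<in> {1..N}" for k d
  proof -
    have "(\<lambda>x. x k) \<in> torusM N \<rightarrow>\<^sub>M restrict_space borel circle"
      unfolding torusM_def using that by (rule measurable_component_singleton)
    hence [measurable]: "(\<lambda>x. x k) \<in> borel_measurable (torusM N)" by (simp add: measurable_restrict_space2_iff)
    show ?thesis unfolding power_int_def by measurable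
  qed
  thus ?thesis unfolding xpow_def by (intro borel_measurable_prod)
qed

definition gpt :: "nat \<Rightarrow> (nat \<Rightarrow> nat) \<Rightarrow> nat \<Rightarrow> complex" where
  "gpt M j = (\<lambda>k. cis (2 * pi * (real (j k) / real M)))"

lemma sum_grid_xpow:
  assumes M: "0 < M" and d: "\<And>k. k \<in> {1..N} \<Longrightarrow> \<bar>\<delta> k\<bar> < int M"
  shows "(\<Sum>j\<in>PiE {1..N} (\<lambda>_. {..<M}). xpow N (gpt M j) \<delta>) = (if \<forall>k\<in>{1..N}. \<delta> k = 0 then of_nat M ^ N else 0)"
proof -
  have "(\<Sum>j\<in>PiE {1..N} (\<lambda>_. {..<M}). xpow N (gpt M j) \<delta>)
      = (\<Sum>j\<in>PiE {1..N} (\<lambda>_. {..<M}). \<Prod>k\<in>{1..N}. cis (of_int (\<delta> k) * (2 * pi * (real (j k) / real M))))"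
    by (simp add: xpow_def gpt_def cis_power_int)
  also have "\<dots> = (\<Prod>k\<in>{1..N}. \<Sum>i<M. cis (of_int (\<delta> k) * (2 * pi * (real i / real M))))"
    by (rule prod_sum_PiE[symmetric]) auto
  also have "\<dots> = (\<Prod>k\<in>{1..N}. if \<delta> k = 0 then of_nat M else 0)"
    using sum_cis_grid[OF M d] by (intro prod.cong) auto
  also have "\<dots> = (if \<forall>k\<in>{1..N}. \<delta> k = 0 then of_nat M ^ N else 0)"
    by auto
  finally show ?thesis .
qed

definition mi_box :: "nat \<Rightarrow> int \<Rightarrow> mi set" where "mi_box N L = PiE_dflt {1..N} 0 (\<lambda>_. {0..<L})"

lemma mi_box_iff: "\<alpha> \<in> mi_box N L \<longleftrightarrow> supp_ok N \<alpha> \<and> (\<forall>k\<in>{1..N}. 0 \<le> \<alpha> k \<and> \<alpha> k < L)"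
  by (auto simp: mi_box_def PiE_dflt_def supp_ok_def)

lemma finite_mi_box: "finite (mi_box N L)"
  unfolding mi_box_def by (rule finite_PiE_dflt) auto

text \<open>The number of pairs in the box with a given difference: these products are the
  unnormalized Fourier coefficients of the Fejer kernel.\<close>

lemma card_mi_box_shift:
  assumes "supp_ok N \<gamma>"
  shows "card {\<alpha>\<in>mi_box N L. \<alpha> - \<gamma> \<in> mi_box N L} = (\<Prod>k\<in>{1..N}. nat (L - \<bar>\<gamma> k\<bar>))"
proof -
  have "{\<alpha>\<in>mi_box N L. \<alpha> - \<gamma> \<in> mi_box N L} = PiE_dflt {1..N} 0 (\<lambda>k. {max 0 (\<gamma> k)..<min L (L + \<gamma> k)})"
    using assms by (auto simp: mi_box_def PiE_dflt_def supp_ok_def)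
  moreover have "nat (min L (L + c) - max 0 c) = nat (L - \<bar>c\<bar>)" for c :: int by linarith
  ultimately show ?thesis by (simp add: card_PiE_dflt)
qed

section \<open>Fejer means of a positive definite function\<close>

context
  fixes N :: nat and \<phi> :: "mi \<Rightarrow> complex"
  assumes N1: "1 \<le> N"
    and pos_def: "\<And>A c. finite A \<Longrightarrow> (\<And>\<alpha>. \<alpha> \<in> A \<Longrightarrow> supp_ok N \<alpha>) \<Longrightarrow>
      (\<Sum>\<alpha>\<in>A. \<Sum>\<beta>\<in>A. cnj (c \<alpha>) * c \<beta> * \<phi> (\<alpha> - \<beta>)) \<in> \<real> \<and>
      0 \<le> Re (\<Sum>\<alpha>\<in>A. \<Sum>\<beta>\<in>A. cnj (c \<alpha>) * c \<beta> * \<phi> (\<alpha> - \<beta>))"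
begin

text \<open>The mesh is twice the side of the exponent box. Exponents \<alpha> - \<beta> - \<gamma>
  with \<alpha>, \<beta> in the box and entries of \<gamma> at most \<open>2 ^ n\<close> in absolute
  value are then smaller than the mesh, so the grid produces no aliasing.\<close>

definition grid :: "nat \<Rightarrow> (nat \<Rightarrow> nat) set" where "grid n = PiE {1..N} (\<lambda>_. {..<2 ^ Suc n})"

definition fejer :: "nat \<Rightarrow> (nat \<Rightarrow> nat) \<Rightarrow> complex" where
  "fejer n j = (\<Sum>\<alpha>\<in>mi_box N (2 ^ n). \<Sum>\<beta>\<in>mi_box N (2 ^ n). xpow N (gpt (2 ^ Suc n) j) (\<alpha> - \<beta>) * \<phi> (\<alpha> - \<beta>))"

text \<open>The two factors in the denominator are the numbers of points in the box and in the grid;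
  with them the total mass is \<phi> 0 for every \<open>n\<close>.\<close>

definition weight :: "nat \<Rightarrow> (nat \<Rightarrow> nat) \<Rightarrow> real" where
  "weight n j = Re (fejer n j) / ((2 ^ n) ^ N * (2 ^ Suc n) ^ N)"

lemma finite_grid: "finite (grid n)"
  unfolding grid_def by (intro finite_PiE) auto

text \<open>Positive definiteness is applied to the test vector whose entry at \<alpha> is the
  character x^(-\<alpha>) at the grid point.\<close>

lemma fejer_pos: "fejer n j \<in> \<real> \<and> 0 \<le> Re (fejer n j)"
proof -
  let ?e = "xpow N (gpt (2 ^ Suc n) j)"
  have "?e (\<alpha> - \<beta>) = cnj (?e (- \<alpha>)) * ?e (- \<beta>)" for \<alpha> \<beta>
    using xpow_cis_add[of N _ \<alpha> "- \<beta>"] xpow_cis_cnj[of N _ "- \<alpha>"] by (simp add: gpt_def)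
  hence "fejer n j = (\<Sum>\<alpha>\<in>mi_box N (2 ^ n). \<Sum>\<beta>\<in>mi_box N (2 ^ n). cnj (?e (- \<alpha>)) * ?e (- \<beta>) * \<phi> (\<alpha> - \<beta>))"
    by (simp add: fejer_def)
  thus ?thesis using pos_def[of "mi_box N (2 ^ n)" "\<lambda>\<alpha>. ?e (- \<alpha>)"] by (simp add: finite_mi_box mi_box_iff)
qed

lemma weight_nonneg: "0 \<le> weight n j"
  using fejer_pos by (simp add: weight_def)

text \<open>Orthogonality on the grid leaves only the pairs with \<beta> = \<alpha> - \<gamma>.
  Counting them produces the damping factors, which are the only deviation from the desired
  moment.\<close>

lemma weight_moment:
  assumes \<gamma>: "supp_ok N \<gamma>" and small: "\<And>k. k \<in> {1..N} \<Longrightarrow> \<bar>\<gamma> k\<bar> \<le> 2 ^ n"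
  shows "(\<Sum>j\<in>grid n. of_real (weight n j) * xpow N (gpt (2 ^ Suc n) j) (- \<gamma>))
    = \<phi> \<gamma> * of_real (\<Prod>k\<in>{1..N}. 1 - real_of_int \<bar>\<gamma> k\<bar> / 2 ^ n)"
proof -
  let ?B = "mi_box N (2 ^ n)" and ?M = "2 ^ Suc n :: nat"
  let ?e = "\<lambda>j. xpow N (gpt ?M j)"
  have e: "?e j (\<alpha> - \<beta>) * ?e j (- \<gamma>) = ?e j (\<alpha> - \<beta> - \<gamma>)" for j \<alpha> \<beta>
    using xpow_cis_add[of N _ "\<alpha> - \<beta>" "- \<gamma>"] by (simp add: gpt_def)
  have inner: "(\<Sum>j\<in>grid n. ?e j (\<alpha> - \<beta> - \<gamma>)) = (if \<beta> = \<alpha> - \<gamma> then (2 ^ Suc n) ^ N else 0)"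
    if ab: "\<alpha> \<in> ?B" "\<beta> \<in> ?B" for \<alpha> \<beta>
  proof -
    have "\<bar>(\<alpha> - \<beta> - \<gamma>) k\<bar> < int ?M" if "k \<in> {1..N}" for k
    proof -
      have "0 \<le> \<alpha> k \<and> \<alpha> k < 2 ^ n \<and> 0 \<le> \<beta> k \<and> \<beta> k < 2 ^ n" using ab that by (auto simp: mi_box_iff)
      hence "\<bar>\<alpha> k - \<beta> k - \<gamma> k\<bar> < 2 * 2 ^ n" using small[OF that] by linarith
      thus ?thesis by simp
    qed
    moreover have "(\<forall>k\<in>{1..N}. (\<alpha> - \<beta> - \<gamma>) k = 0) \<longleftrightarrow> \<beta> = \<alpha> - \<gamma>"
    proof
      assume z: "\<forall>k\<in>{1..N}. (\<alpha> - \<beta> - \<gamma>) k = 0"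
      show "\<beta> = \<alpha> - \<gamma>"
      proof
        fix k show "\<beta> k = (\<alpha> - \<gamma>) k"
        proof (cases "k \<in> {1..N}")
          case True
          hence "(\<alpha> - \<beta> - \<gamma>) k = 0" using z by blast
          thus ?thesis by simp
        next
          case False
          hence "\<alpha> k = 0 \<and> \<beta> k = 0 \<and> \<gamma> k = 0" using ab \<gamma> unfolding mi_box_iff supp_ok_def by blast
          thus ?thesis by simp
        qed
      qed
    qed auto
    ultimately show ?thesis
      unfolding grid_def using sum_grid_xpow[of ?M N "\<alpha> - \<beta> - \<gamma>"] by simp
  qed
  have W: "complex_of_real (weight n j) = fejer n j / of_real ((2 ^ n) ^ N * (2 ^ Suc n) ^ N)" for j
    using fejer_pos[of n j] by (simp add: weight_def)
  have "(\<Sum>j\<in>grid n. fejer n j * ?e j (- \<gamma>))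
      = (\<Sum>j\<in>grid n. \<Sum>\<alpha>\<in>?B. \<Sum>\<beta>\<in>?B. \<phi> (\<alpha> - \<beta>) * ?e j (\<alpha> - \<beta> - \<gamma>))"
    unfolding fejer_def sum_distrib_right
    by (intro sum.cong refl) (simp only: e[symmetric] mult_ac)
  also have "\<dots> = (\<Sum>\<alpha>\<in>?B. \<Sum>j\<in>grid n. \<Sum>\<beta>\<in>?B. \<phi> (\<alpha> - \<beta>) * ?e j (\<alpha> - \<beta> - \<gamma>))"
    by (rule sum.swap)
  also have "\<dots> = (\<Sum>\<alpha>\<in>?B. \<Sum>\<beta>\<in>?B. \<phi> (\<alpha> - \<beta>) * (\<Sum>j\<in>grid n. ?e j (\<alpha> - \<beta> - \<gamma>)))"
    unfolding sum_distrib_left by (intro sum.cong refl sum.swap)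
  also have "\<dots> = (\<Sum>\<alpha>\<in>?B. \<Sum>\<beta>\<in>?B. if \<beta> = \<alpha> - \<gamma> then \<phi> \<gamma> * (2 ^ Suc n) ^ N else 0)"
    using inner by (intro sum.cong refl) auto
  also have "\<dots> = (\<Sum>\<alpha>\<in>?B. if \<alpha> - \<gamma> \<in> ?B then \<phi> \<gamma> * (2 ^ Suc n) ^ N else 0)"
    by (intro sum.cong refl) (simp add: finite_mi_box)
  also have "\<dots> = of_nat (card {\<alpha>\<in>?B. \<alpha> - \<gamma> \<in> ?B}) * (\<phi> \<gamma> * (2 ^ Suc n) ^ N)"
    by (simp add: finite_mi_box sum.inter_filter[symmetric])
  finally have S: "(\<Sum>j\<in>grid n. fejer n j * ?e j (- \<gamma>))
      = \<phi> \<gamma> * of_real (\<Prod>k\<in>{1..N}. real (nat (2 ^ n - \<bar>\<gamma> k\<bar>))) * (2 ^ Suc n) ^ N"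
    by (simp add: card_mi_box_shift[OF \<gamma>])
  have P: "(\<Prod>k\<in>{1..N}. 1 - real_of_int \<bar>\<gamma> k\<bar> / 2 ^ n) = (\<Prod>k\<in>{1..N}. real (nat (2 ^ n - \<bar>\<gamma> k\<bar>))) / (2 ^ n) ^ N"
  proof -
    have "(\<Prod>k\<in>{1..N}. 1 - real_of_int \<bar>\<gamma> k\<bar> / 2 ^ n) = (\<Prod>k\<in>{1..N}. real (nat (2 ^ n - \<bar>\<gamma> k\<bar>)) / 2 ^ n)"
      using small by (intro prod.cong refl) (simp add: diff_divide_distrib)
    thus ?thesis by (simp add: prod_dividef)
  qed
  have "(\<Sum>j\<in>grid n. of_real (weight n j) * ?e j (- \<gamma>)) = (\<Sum>j\<in>grid n. fejer n j * ?e j (- \<gamma>)) / of_real ((2 ^ n) ^ N * (2 ^ Suc n) ^ N)"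
    unfolding W sum_divide_distrib by (intro sum.cong refl) simp
  also have "\<dots> = \<phi> \<gamma> * of_real (\<Prod>k\<in>{1..N}. 1 - real_of_int \<bar>\<gamma> k\<bar> / 2 ^ n)"
    unfolding S P by simp
  finally show ?thesis .
qed

lemma weight_moment_limit:
  assumes \<gamma>: "supp_ok N \<gamma>"
  shows "(\<lambda>n. \<Sum>j\<in>grid n. of_real (weight n j) * xpow N (gpt (2 ^ Suc n) j) (- \<gamma>)) \<longlonglongrightarrow> \<phi> \<gamma>"
proof (rule Lim_transform_eventually)
  have lim: "(\<lambda>n. 1 - real_of_int \<bar>\<gamma> k\<bar> / 2 ^ n) \<longlonglongrightarrow> 1 - real_of_int \<bar>\<gamma> k\<bar> * 0" for k
    unfolding divide_inverse power_inverse[symmetric] by (intro tendsto_intros LIMSEQ_realpow_zero) auto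
  have pl: "(\<lambda>n. \<Prod>k\<in>{1..N}. 1 - real_of_int \<bar>\<gamma> k\<bar> / 2 ^ n) \<longlonglongrightarrow> (\<Prod>k\<in>{1..N}. 1)"
    using lim by (intro tendsto_prod) (simp only: mult_zero_right diff_zero)
  have "(\<lambda>n. \<phi> \<gamma> * of_real (\<Prod>k\<in>{1..N}. 1 - real_of_int \<bar>\<gamma> k\<bar> / 2 ^ n)) \<longlonglongrightarrow> \<phi> \<gamma> * of_real (\<Prod>k\<in>{1..N}. 1)"
    by (rule tendsto_mult[OF tendsto_const tendsto_of_real[OF pl]])
  thus "(\<lambda>n. \<phi> \<gamma> * of_real (\<Prod>k\<in>{1..N}. 1 - real_of_int \<bar>\<gamma> k\<bar> / 2 ^ n)) \<longlonglongrightarrow> \<phi> \<gamma>" by simp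
  show "\<forall>\<^sub>F n in sequentially. \<phi> \<gamma> * of_real (\<Prod>k\<in>{1..N}. 1 - real_of_int \<bar>\<gamma> k\<bar> / 2 ^ n)
    = (\<Sum>j\<in>grid n. of_real (weight n j) * xpow N (gpt (2 ^ Suc n) j) (- \<gamma>))"
  \<comment> \<open>Since m < 2^m, the sum of the absolute values of the entries is a sufficient
    threshold for the smallness condition of \<open>weight_moment\<close>.\<close>
  proof (rule eventually_sequentiallyI[of "\<Sum>k\<in>{1..N}. nat \<bar>\<gamma> k\<bar>"])
    fix n assume n: "(\<Sum>k\<in>{1..N}. nat \<bar>\<gamma> k\<bar>) \<le> n"
    have "\<bar>\<gamma> k\<bar> \<le> 2 ^ n" if "k \<in> {1..N}" for k
    proof -
      have "nat \<bar>\<gamma> k\<bar> \<le> (\<Sum>k\<in>{1..N}. nat \<bar>\<gamma> k\<bar>)" using that by (intro member_le_sum) auto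
      hence "nat \<bar>\<gamma> k\<bar> \<le> 2 ^ n" using n less_exp[of n] by linarith
      hence "int (nat \<bar>\<gamma> k\<bar>) \<le> int (2 ^ n)" by (simp only: of_nat_le_iff)
      thus ?thesis by simp
    qed
    from weight_moment[OF \<gamma> this] show "\<phi> \<gamma> * of_real (\<Prod>k\<in>{1..N}. 1 - real_of_int \<bar>\<gamma> k\<bar> / 2 ^ n)
      = (\<Sum>j\<in>grid n. of_real (weight n j) * xpow N (gpt (2 ^ Suc n) j) (- \<gamma>))" by simp
  qed
qed

lemma supp_ok_0: "supp_ok N 0"
  by (simp add: supp_ok_def)

lemma sum_weight: "complex_of_real (\<Sum>j\<in>grid n. weight n j) = \<phi> 0"
  using weight_moment[OF supp_ok_0, of n] by (simp add: xpow_def)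

section \<open>Transport of the weights along the curve and passage to the limit\<close>

definition param :: "nat \<Rightarrow> (nat \<Rightarrow> nat) \<Rightarrow> real" where
  "param n j = (if j \<in> grid n then SOME t. 0 \<le> t \<and> t \<le> 1 \<and> (\<forall>k\<in>{1..N}. curve N k t = real (j k) / 2 ^ Suc n) else 0)"

text \<open>The first claim holds for all \<open>j\<close>, thanks to the value 0 off the grid;
  tightness is then immediate, since the whole index type is mapped into [0, 1].\<close>

lemma param:
  shows "0 \<le> param n j \<and> param n j \<le> 1"
    and "j \<in> grid n \<Longrightarrow> k \<in> {1..N} \<Longrightarrow> curve N k (param n j) = real (j k) / 2 ^ Suc n"
proof -
  have *: "0 \<le> param n j \<and> param n j \<le> 1 \<and> (\<forall>k\<in>{1..N}. curve N k (param n j) = real (j k) / 2 ^ Suc n)"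
    if j: "j \<in> grid n" for j
  proof -
    have "j m < 2 ^ Suc n" if "m \<in> {1..N}" for m using j PiE_mem[OF _ that, of j "\<lambda>_. {..<2 ^ Suc n}"] by (simp add: grid_def)
    from someI_ex[OF curve_hits[OF N1 this]] show ?thesis using j by (simp add: param_def)
  qed
  show "0 \<le> param n j \<and> param n j \<le> 1" using *[of j] by (cases "j \<in> grid n") (auto simp: param_def)
  show "j \<in> grid n \<Longrightarrow> k \<in> {1..N} \<Longrightarrow> curve N k (param n j) = real (j k) / 2 ^ Suc n" using * by blast
qed

text \<open>Restricted to \<open>{1..N}\<close> because the points of a product space are
  extensional functions.\<close>

definition torus_pt :: "real \<Rightarrow> nat \<Rightarrow> complex" where
  "torus_pt t = (\<lambda>k\<in>{1..N}. cis (2 * pi * curve N k t))"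

lemma xpow_torus_pt: "xpow N (torus_pt t) \<delta> = xpow N (\<lambda>k. cis (2 * pi * curve N k t)) \<delta>"
  unfolding xpow_def by (intro prod.cong) (auto simp: torus_pt_def)

lemma isCont_xpow_torus_pt: "isCont (\<lambda>t. xpow N (torus_pt t) \<delta>) t"
  unfolding xpow_torus_pt xpow_cis unfolding cis_conv_exp by (intro continuous_intros isCont_curve)

lemma norm_xpow_torus_pt: "norm (xpow N (torus_pt t) \<delta>) = 1"
  by (simp add: xpow_torus_pt xpow_cis)

lemma torus_pt_measurable: "torus_pt \<in> borel \<rightarrow>\<^sub>M torusM N"
  unfolding torusM_def torus_pt_def[abs_def]
proof (rule measurable_restrict, rule measurable_restrict_space2)
  fix k
  have "continuous_on UNIV (\<lambda>t. cis (2 * pi * curve N k t))"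
    unfolding cis_conv_exp by (intro continuous_at_imp_continuous_on ballI continuous_intros isCont_curve)
  thus "(\<lambda>t. cis (2 * pi * curve N k t)) \<in> borel_measurable borel" by (rule borel_measurable_continuous_onI)
qed (auto simp: circle_def)

text \<open>Push the Fejer weights on the dyadic grid to \<open>[0, 1]\<close> along the space-filling curve, take a weak
  limit there by Helly's theorem, and push it forward to the torus.\<close>
theorem herglotz_torus:
  "\<exists>\<mu>. finite_measure \<mu> \<and> sets \<mu> = sets (torusM N) \<and> (\<forall>\<gamma>. supp_ok N \<gamma> \<longrightarrow> integral\<^sup>L \<mu> (\<lambda>x. xpow N x (- \<gamma>)) = \<phi> \<gamma>)"
proof (cases "\<phi> 0 = 0")
  \<comment> \<open>Without mass the weights cannot be normalized to probabilities. They then all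
    vanish, being nonnegative, and so do all moments.\<close>
  case True
  have "weight n j = 0" if "j \<in> grid n" for n j
  proof -
    have "(\<Sum>j\<in>grid n. weight n j) = 0" using sum_weight[of n] True by (metis of_real_eq_0_iff)
    thus ?thesis using sum_nonneg_eq_0_iff[OF finite_grid, of n "weight n"] weight_nonneg that by simp
  qed
  hence "(\<lambda>n. \<Sum>j\<in>grid n. of_real (weight n j) * xpow N (gpt (2 ^ Suc n) j) (- \<gamma>)) = (\<lambda>n. 0)" for \<gamma> by simp
  hence "\<phi> \<gamma> = 0" if "supp_ok N \<gamma>" for \<gamma> using weight_moment_limit[OF that] LIMSEQ_unique[OF _ tendsto_const] by simp
  thus ?thesis by (intro exI[of _ "null_measure (torusM N)"]) (auto intro!: finite_measureI)
next
  case False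
  define r where "r = (\<Sum>j\<in>grid 0. weight 0 j)"
  have \<phi>0: "\<phi> 0 = of_real r" using sum_weight[of 0] by (simp add: r_def)
  have rn: "(\<Sum>j\<in>grid n. weight n j) = r" for n using sum_weight[of n] unfolding \<phi>0 of_real_eq_iff .
  have "0 \<le> r" unfolding r_def by (intro sum_nonneg weight_nonneg)
  hence r: "0 < r" using False \<phi>0 by (cases "r = 0") auto
  define f where "f n j = (if j \<in> grid n then weight n j / r else 0)" for n j
  define p where "p n = embed_pmf (f n)" for n
  have pmf: "pmf (p n) j = f n j" for n j
    unfolding p_def
  proof (rule pmf_embed_pmf)
    show "0 \<le> f n j" for j using weight_nonneg r by (simp add: f_def)
    have "(\<integral>\<^sup>+ j. ennreal (f n j) \<partial>count_space UNIV) = (\<Sum>j\<in>grid n. ennreal (f n j))"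
      by (intro nn_integral_count_space' finite_grid) (auto simp: f_def)
    also have "\<dots> = ennreal (\<Sum>j\<in>grid n. f n j)"
      using weight_nonneg r by (intro sum_ennreal) (simp add: f_def)
    also have "(\<Sum>j\<in>grid n. f n j) = 1" using rn[of n] r by (simp add: f_def sum_divide_distrib[symmetric])
    finally show "(\<integral>\<^sup>+ j. ennreal (f n j) \<partial>count_space UNIV) = 1" by simp
  qed
  define \<nu> where "\<nu> n = distr (measure_pmf (p n)) borel (param n)" for n
  have mp [measurable]: "param n \<in> measure_pmf (p n) \<rightarrow>\<^sub>M borel" for n by simp
  have rd: "real_distribution (\<nu> n)" for n
    unfolding \<nu>_def by (intro prob_space.real_distribution_distr prob_space_measure_pmf) simp
  have "tight \<nu>"
    unfolding tight_def
  proof (intro conjI allI impI rd)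
    fix \<epsilon> :: real assume "0 < \<epsilon>"
    have "measure (\<nu> n) {-1<..2} = 1" for n
    proof -
      have "-1 < param n j \<and> param n j \<le> 2" for j using param(1)[of n j] by linarith
      hence "param n -` {-1<..2} \<inter> space (measure_pmf (p n)) = UNIV" by auto
      thus ?thesis unfolding \<nu>_def by (subst measure_distr) auto
    qed
    thus "\<exists>a b. a < b \<and> (\<forall>n. 1 - \<epsilon> < measure (\<nu> n) {a<..b})" using \<open>0 < \<epsilon>\<close> by (intro exI[of _ "-1"] exI[of _ 2]) simp
  qed
  from tight_imp_convergent_subsubsequence[OF this strict_mono_id]
  obtain s M where s: "strict_mono s" and M: "real_distribution M" and w: "weak_conv_m (\<nu> \<circ> s) M"
    by (auto simp: comp_def)
  interpret M: real_distribution M by (rule M)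
  define \<mu> where "\<mu> = density (distr M (torusM N) torus_pt) (\<lambda>_. ennreal r)"
  have tm: "torus_pt \<in> M \<rightarrow>\<^sub>M torusM N" using torus_pt_measurable by (simp cong: measurable_cong_sets)
  have "finite_measure \<mu>"
  proof (rule finite_measureI)
    interpret D: prob_space "distr M (torusM N) torus_pt" by (rule M.prob_space_distr[OF tm])
    have "emeasure \<mu> (space \<mu>) = ennreal r * emeasure (distr M (torusM N) torus_pt) (space (distr M (torusM N) torus_pt))"
      unfolding \<mu>_def by (subst emeasure_density) (auto simp: nn_integral_cmult)
    thus "emeasure \<mu> (space \<mu>) \<noteq> \<infinity>" using D.emeasure_space_1 by simp
  qed
  moreover have "sets \<mu> = sets (torusM N)" by (simp add: \<mu>_def)
  moreover have "integral\<^sup>L \<mu> (\<lambda>x. xpow N x (- \<gamma>)) = \<phi> \<gamma>" if \<gamma>: "supp_ok N \<gamma>" for \<gamma>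
  proof -
    let ?h = "\<lambda>t. xpow N (torus_pt t) (- \<gamma>)"
    have "integral\<^sup>L (\<nu> n) ?h = (\<Sum>j\<in>grid n. of_real (weight n j) * xpow N (gpt (2 ^ Suc n) j) (- \<gamma>)) / of_real r" for n
    proof -
      have hm: "?h \<in> borel_measurable borel"
        using isCont_xpow_torus_pt by (intro borel_measurable_continuous_onI continuous_at_imp_continuous_on) auto
      have "integral\<^sup>L (\<nu> n) ?h = integral\<^sup>L (measure_pmf (p n)) (\<lambda>j. ?h (param n j))"
        unfolding \<nu>_def by (rule integral_distr[OF mp hm])
      also have "\<dots> = (\<Sum>j\<in>grid n. pmf (p n) j *\<^sub>R ?h (param n j))"
        by (rule integral_measure_pmf[OF finite_grid]) (auto simp: set_pmf_eq pmf f_def split: if_splits)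
      also have "\<dots> = (\<Sum>j\<in>grid n. of_real (weight n j) * xpow N (gpt (2 ^ Suc n) j) (- \<gamma>) / of_real r)"
      proof (intro sum.cong refl)
        fix j assume j: "j \<in> grid n"
        have "?h (param n j) = xpow N (gpt (2 ^ Suc n) j) (- \<gamma>)"
          unfolding xpow_torus_pt unfolding xpow_def gpt_def using param(2)[OF j] by (intro prod.cong refl) simp
        thus "pmf (p n) j *\<^sub>R ?h (param n j) = of_real (weight n j) * xpow N (gpt (2 ^ Suc n) j) (- \<gamma>) / of_real r"
          using j by (simp add: pmf f_def scaleR_conv_of_real)
      qed
      finally show ?thesis by (simp add: sum_divide_distrib)
    qed
    hence "(\<lambda>n. integral\<^sup>L (\<nu> n) ?h) \<longlonglongrightarrow> \<phi> \<gamma> / of_real r"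
      using weight_moment_limit[OF \<gamma>] r by (simp add: tendsto_divide)
    hence "(\<lambda>n. integral\<^sup>L ((\<nu> \<circ> s) n) ?h) \<longlonglongrightarrow> \<phi> \<gamma> / of_real r"
      using LIMSEQ_subseq_LIMSEQ[OF _ s] by (auto simp: comp_def)
    \<comment> \<open>This is where continuity of the curve is used: the pulled back character is a
      bounded continuous function on the whole line, hence a legitimate test function for weak
      convergence.\<close>
    moreover have "(\<lambda>n. integral\<^sup>L ((\<nu> \<circ> s) n) ?h) \<longlonglongrightarrow> integral\<^sup>L M ?h"
      using rd by (intro weak_conv_imp_integral_bdd_continuous_conv[OF _ M w, where B = 1] isCont_xpow_torus_pt)
        (auto simp: norm_xpow_torus_pt)
    ultimately have lim: "integral\<^sup>L M ?h = \<phi> \<gamma> / of_real r" by (rule LIMSEQ_unique[symmetric])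
    have "integral\<^sup>L \<mu> (\<lambda>x. xpow N x (- \<gamma>)) = integral\<^sup>L (distr M (torusM N) torus_pt) (\<lambda>x. r *\<^sub>R xpow N x (- \<gamma>))"
      unfolding \<mu>_def using r xpow_measurable by (intro integral_density) auto
    also have "\<dots> = integral\<^sup>L M (\<lambda>t. r *\<^sub>R ?h t)"
      using xpow_measurable by (intro integral_distr[OF tm]) simp
    also have "\<dots> = \<phi> \<gamma>" using lim r by (simp add: scaleR_conv_of_real)
    finally show ?thesis .
  qed
  ultimately show ?thesis by blast
qed

end

section \<open>Young's seminormal form\<close>

lemma sw_sw [simp]: "sw i j (sw i j k) = k"
  by (auto simp: sw_def)

lemma sw_comp_sw [simp]: "sw i j \<circ> sw i j = id"
  by (auto simp: fun_eq_iff)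

lemma comp_sw_sw [simp]: "f \<circ> sw i j \<circ> sw i j = f"
  by (auto simp: fun_eq_iff)

lemma sw_simps [simp]: "sw i j i = j" "sw i j j = i" "k \<noteq> i \<Longrightarrow> k \<noteq> j \<Longrightarrow> sw i j k = k"
  by (auto simp: sw_def)

lemma sw_permutes: "i \<in> A \<Longrightarrow> j \<in> A \<Longrightarrow> sw i j permutes A"
  unfolding permutes_def by (metis sw_sw sw_def)

lemma bij_betw_comp_sw:
  assumes "i \<in> A" "j \<in> A" shows "bij_betw (f \<circ> sw i j) A B \<longleftrightarrow> bij_betw f A B"
  using bij_betw_comp_iff[OF permutes_imp_bij[OF sw_permutes[OF assms]], of f B] by simp

lemma eq_comp_sw_iff: "f \<circ> sw i j = g \<longleftrightarrow> f = g \<circ> sw i j"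
  by (metis comp_sw_sw)

lemma RSYT_cell:
  assumes "T \<in> RSYT N \<tau>" "i \<in> {1..N}"
  shows "(rw i T, cm i T) \<in> ferrers \<tau>"
  using assms bij_betwE[of T "{1..N}" "ferrers \<tau>"] by (simp add: RSYT_def rw_def cm_def)

lemma RSYT_inj:
  assumes "T \<in> RSYT N \<tau>" "i \<in> {1..N}" "j \<in> {1..N}" "rw i T = rw j T" "cm i T = cm j T"
  shows "i = j"
proof (rule inj_onD[of T "{1..N}"])
  show "inj_on T {1..N}" using assms(1) by (auto simp: RSYT_def bij_betw_def)
  show "T i = T j" using assms(4,5) by (simp add: rw_def cm_def prod_eq_iff)
qed (use assms in auto)

lemma RSYT_surj:
  assumes "T \<in> RSYT N \<tau>" "(r, c) \<in> ferrers \<tau>"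
  obtains e where "e \<in> {1..N}" "rw e T = r" "cm e T = c"
proof -
  have "(r, c) \<in> T ` {1..N}" using assms by (auto simp: RSYT_def bij_betw_def)
  then obtain e where "e \<in> {1..N}" "T e = (r, c)" by (metis imageE)
  thus ?thesis using that[of e] by (simp add: rw_def cm_def)
qed

lemma RSYT_row:
  assumes "T \<in> RSYT N \<tau>" "i \<in> {1..N}" "j \<in> {1..N}" "rw i T = rw j T" "cm i T < cm j T"
  shows "j < i"
  using assms unfolding RSYT_def by blast

lemma RSYT_col:
  assumes "T \<in> RSYT N \<tau>" "i \<in> {1..N}" "j \<in> {1..N}" "cm i T = cm j T" "rw i T < rw j T"
  shows "j < i"
  using assms unfolding RSYT_def by blast

lemma rw_comp_sw [simp]: "rw k (T \<circ> sw i j) = rw (sw i j k) T"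
  and cm_comp_sw [simp]: "cm k (T \<circ> sw i j) = cm (sw i j k) T"
  and cont_comp_sw [simp]: "cont k (T \<circ> sw i j) = cont (sw i j k) T"
  by (auto simp: rw_def cm_def cont_def)

section \<open>Contents of neighbouring entries\<close>

locale young =
  fixes N :: nat and \<tau> :: "nat list"
  assumes part_tau: "is_partition N \<tau>" and N_pos: "1 \<le> N"
begin

abbreviation "Y \<equiv> RSYT N \<tau>"

lemma finite_ferrers: "finite (ferrers \<tau>)"
proof (rule finite_subset)
  show "ferrers \<tau> \<subseteq> {1..length \<tau>} \<times> {1..sum_list \<tau>}"
    using member_le_sum_list[of _ \<tau>] by (force simp: ferrers_def part_def intro: order_trans)
qed auto

lemma finite_Y: "finite Y"
proof (rule finite_subset)
  show "Y \<subseteq> {T. T ` {1..N} \<subseteq> ferrers \<tau> \<and> {i. T i \<noteq> (0,0)} \<subseteq> {1..N}}"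
    by (auto simp: RSYT_def bij_betw_def)
  have "finite {T. \<forall>i. (i \<in> {1..N} \<longrightarrow> T i \<in> ferrers \<tau>) \<and> (i \<notin> {1..N} \<longrightarrow> T i = (0,0))}"
    by (rule finite_set_of_finite_funs) (auto simp: finite_ferrers)
  thus "finite {T. T ` {1..N} \<subseteq> ferrers \<tau> \<and> {i. T i \<noteq> (0,0)} \<subseteq> {1..N}}"
    by (rule rev_finite_subset) blast
qed

lemma part_mono: "1 \<le> i \<Longrightarrow> i \<le> j \<Longrightarrow> part \<tau> j \<le> part \<tau> i"
  using part_tau unfolding is_partition_def part_def
  by (auto intro!: sorted_rev_nth_mono)

lemma ferrers_down:
  assumes "(r, c) \<in> ferrers \<tau>" "1 \<le> r'" "r' \<le> r" "1 \<le> c'" "c' \<le> c"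
  shows "(r', c') \<in> ferrers \<tau>"
  using assms part_mono[of r' r] by (auto simp: ferrers_def)

lemma RSYT_pos:
  assumes "T \<in> Y" "i \<in> {1..N}" shows "1 \<le> rw i T" "1 \<le> cm i T"
  using RSYT_cell[OF assms] by (auto simp: ferrers_def)

text \<open>The two other corners of the rectangle spanned by the cells of \<open>i\<close> and
  \<open>j\<close> belong to the diagram. Their entries are distinct and lie strictly between
  \<open>j\<close> and \<open>i\<close>.\<close>

lemma RSYT_diag:
  assumes T: "T \<in> Y" and ij: "i \<in> {1..N}" "j \<in> {1..N}" and lt: "rw i T < rw j T" "cm i T < cm j T"
  shows "j + 3 \<le> i"
proof -
  note pos = RSYT_pos[OF T ij(1)] RSYT_pos[OF T ij(2)]
  have "(rw i T, cm j T) \<in> ferrers \<tau>" "(rw j T, cm i T) \<in> ferrers \<tau>"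
    using ferrers_down[OF RSYT_cell[OF T ij(2)]] pos lt by auto
  then obtain d e where d: "d \<in> {1..N}" "rw d T = rw i T" "cm d T = cm j T"
    and e: "e \<in> {1..N}" "rw e T = rw j T" "cm e T = cm i T"
    by (metis RSYT_surj[OF T])
  have "d < i" "j < d" "e < i" "j < e"
    using RSYT_row[OF T] RSYT_col[OF T] ij d e lt by metis+
  moreover have "d \<noteq> e" using d e lt by auto
  ultimately show ?thesis by linarith
qed

lemma RSYT_le:
  assumes T: "T \<in> Y" and ij: "i \<in> {1..N}" "j \<in> {1..N}" and le: "rw i T \<le> rw j T" "cm i T \<le> cm j T"
  shows "j \<le> i"
  using RSYT_diag[OF T ij] RSYT_row[OF T ij] RSYT_col[OF T ij] RSYT_inj[OF T ij] le
  by (metis le_eq_less_or_eq add_leD1)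

text \<open>Equal contents mean the same diagonal, where entries differ by at least 3. The range up
  to \<open>i + 2\<close> covers the three entries involved in a braid relation.\<close>

lemma cont_neq:
  assumes T: "T \<in> Y" and ij: "i \<in> {1..N}" "j \<in> {1..N}" "i < j" "j \<le> i + 2"
  shows "cont i T \<noteq> cont j T"
proof
  assume c: "cont i T = cont j T"
  consider "rw i T = rw j T" | "rw i T < rw j T" | "rw j T < rw i T" by linarith
  thus False
  proof cases
    case 1 thus False using c RSYT_inj[OF T ij(1,2)] ij by (auto simp: cont_def)
  next
    case 2 thus False using c RSYT_diag[OF T ij(1,2)] ij by (auto simp: cont_def)
  next
    case 3 thus False using c RSYT_diag[OF T ij(2,1)] ij by (auto simp: cont_def)
  qed
qed

text \<open>Consecutive entries of one row occupy adjacent cells, since a cell between them would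
  hold an entry strictly between \<open>i\<close> and \<open>Suc i\<close>.\<close>

lemma cont_row:
  assumes T: "T \<in> Y" and i: "i \<in> {1..<N}" and r: "rw i T = rw (Suc i) T"
  shows "cont i T - cont (Suc i) T = 1"
proof -
  have ij: "i \<in> {1..N}" "Suc i \<in> {1..N}" using i by auto
  have lt: "cm (Suc i) T < cm i T"
    using RSYT_row[OF T ij] RSYT_inj[OF T ij] r by (metis linorder_neqE_nat n_not_Suc_n not_less_eq less_imp_not_less)
  have "cm i T \<le> Suc (cm (Suc i) T)"
  proof (rule ccontr)
    assume far: "\<not> ?thesis"
    hence "(rw i T, Suc (cm (Suc i) T)) \<in> ferrers \<tau>"
      using ferrers_down[OF RSYT_cell[OF T ij(1)]] RSYT_pos[OF T ij(1)] by auto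
    then obtain e where "e \<in> {1..N}" "rw e T = rw i T" "cm e T = Suc (cm (Suc i) T)"
      by (metis RSYT_surj[OF T])
    hence "i < e \<and> e < Suc i"
      using RSYT_row[OF T] far r ij by (metis lessI not_le)
    thus False by linarith
  qed
  thus ?thesis using lt r by (simp add: cont_def)
qed

lemma cont_col:
  assumes T: "T \<in> Y" and i: "i \<in> {1..<N}" and r: "cm i T = cm (Suc i) T"
  shows "cont i T - cont (Suc i) T = -1"
proof -
  have ij: "i \<in> {1..N}" "Suc i \<in> {1..N}" using i by auto
  have lt: "rw (Suc i) T < rw i T"
    using RSYT_col[OF T ij] RSYT_inj[OF T ij] r by (metis linorder_neqE_nat n_not_Suc_n not_less_eq less_imp_not_less)
  have "rw i T \<le> Suc (rw (Suc i) T)"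
  proof (rule ccontr)
    assume far: "\<not> ?thesis"
    hence "(Suc (rw (Suc i) T), cm i T) \<in> ferrers \<tau>"
      using ferrers_down[OF RSYT_cell[OF T ij(1)]] RSYT_pos[OF T ij(1)] by auto
    then obtain e where "e \<in> {1..N}" "cm e T = cm i T" "rw e T = Suc (rw (Suc i) T)"
      by (metis RSYT_surj[OF T])
    hence "i < e \<and> e < Suc i"
      using RSYT_col[OF T] far r ij by (metis lessI not_le)
    thus False by linarith
  qed
  thus ?thesis using lt r by (simp add: cont_def)
qed

lemma cont_up:
  assumes T: "T \<in> Y" and i: "i \<in> {1..<N}" and r: "rw i T < rw (Suc i) T"
  shows "cont i T - cont (Suc i) T \<ge> 2"
proof -
  have ij: "i \<in> {1..N}" "Suc i \<in> {1..N}" using i by auto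
  have "\<not> cm i T \<le> cm (Suc i) T" using RSYT_le[OF T ij] r by auto
  thus ?thesis using r by (simp add: cont_def)
qed

lemma cont_down:
  assumes T: "T \<in> Y" and i: "i \<in> {1..<N}" and r: "rw (Suc i) T < rw i T" "cm i T \<noteq> cm (Suc i) T"
  shows "cont i T - cont (Suc i) T \<le> -2"
proof -
  have ij: "i \<in> {1..N}" "Suc i \<in> {1..N}" using i by auto
  have "\<not> cm (Suc i) T < cm i T" using RSYT_diag[OF T ij(2,1)] r by auto
  thus ?thesis using r by (simp add: cont_def)
qed

text \<open>The largest entry sits in the corner cell. This anchors the downward induction for the
  Jucys-Murphy eigenvalues.\<close>

lemma cont_N:
  assumes T: "T \<in> Y" shows "cont N T = 0"
proof -
  have N: "N \<in> {1..N}" using N_pos by simp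
  have "(1, 1) \<in> ferrers \<tau>" using ferrers_down[OF RSYT_cell[OF T N]] RSYT_pos[OF T N] by auto
  then obtain e where e: "e \<in> {1..N}" "rw e T = 1" "cm e T = 1" by (metis RSYT_surj[OF T])
  hence "N \<le> e" using RSYT_le[OF T e(1) N] RSYT_pos[OF T N] by auto
  hence "e = N" using e by auto
  thus ?thesis using e by (simp add: cont_def)
qed

text \<open>Contents range from 1 minus the number of rows to the first part minus 1. Two different
  tableaux are allowed, because eigenvectors will be compared whose tableaux are not known to
  agree.\<close>

lemma cont_diff_le:
  assumes T: "T \<in> Y" "T' \<in> Y" and i: "i \<in> {1..N}" "j \<in> {1..N}"
  shows "\<bar>cont i T - cont j T'\<bar> \<le> int (htau \<tau>) - 1"
proof -
  have *: "1 - int (length \<tau>) \<le> cont k S \<and> cont k S \<le> int (part \<tau> 1) - 1 \<and> 1 \<le> part \<tau> 1"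
    if "S \<in> Y" "k \<in> {1..N}" for S k
    using RSYT_cell[OF that] part_mono[of 1 "rw k S"] by (auto simp: ferrers_def cont_def)
  show ?thesis using *[OF T(1) i(1)] *[OF T(2) i(2)] by (auto simp: htau_def)
qed

text \<open>Within one row or column the content difference is determined by \<open>cont_row\<close>
  or \<open>cont_col\<close>, while the interchange reverses its sign. In the other direction, the
  interchange affects only the comparison of \<open>i\<close> with \<open>Suc i\<close>, and these
  two share no row or column.\<close>

lemma swap_in_Y_iff:
  assumes T: "T \<in> Y" and i: "i \<in> {1..<N}"
  shows "T \<circ> sw i (Suc i) \<in> Y \<longleftrightarrow> rw i T \<noteq> rw (Suc i) T \<and> cm i T \<noteq> cm (Suc i) T"
proof
  have ij: "i \<in> {1..N}" "Suc i \<in> {1..N}" using i by auto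
  let ?T = "T \<circ> sw i (Suc i)"
  show "rw i T \<noteq> rw (Suc i) T \<and> cm i T \<noteq> cm (Suc i) T" if T': "?T \<in> Y"
  proof (rule ccontr)
    assume "\<not> ?thesis"
    thus False using cont_row[OF T i] cont_row[OF T' i] cont_col[OF T i] cont_col[OF T' i]
      by fastforce
  qed
  assume neq: "rw i T \<noteq> rw (Suc i) T \<and> cm i T \<noteq> cm (Suc i) T"
  have bij: "bij_betw ?T {1..N} (ferrers \<tau>)"
    using T unfolding bij_betw_comp_sw[OF ij] by (simp add: RSYT_def)
  have out: "?T k = (0, 0)" if "k \<notin> {1..N}" for k
  proof -
    have "sw i (Suc i) k = k" using that ij by (auto simp: sw_def)
    thus ?thesis using that T by (simp add: RSYT_def)
  qed
  have lt: "k < j" if "sw i (Suc i) k < sw i (Suc i) j" "{j, k} \<noteq> {i, Suc i}" for j k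
    using that by (auto simp: sw_def doubleton_eq_iff split: if_splits)
  have mem: "sw i (Suc i) k \<in> {1..N}" if "k \<in> {1..N}" for k
    using that ij by (auto simp: sw_def)
  have row: "l < k" if "k \<in> {1..N}" "l \<in> {1..N}" "rw k ?T = rw l ?T" "cm k ?T < cm l ?T" for k l
  proof -
    have "{k, l} \<noteq> {i, Suc i}" using that neq by (auto simp: doubleton_eq_iff)
    thus ?thesis using lt[OF RSYT_row[OF T mem[OF that(1)] mem[OF that(2)]]] that by simp
  qed
  have col: "l < k" if "k \<in> {1..N}" "l \<in> {1..N}" "cm k ?T = cm l ?T" "rw k ?T < rw l ?T" for k l
  proof -
    have "{k, l} \<noteq> {i, Suc i}" using that neq by (auto simp: doubleton_eq_iff)
    thus ?thesis using lt[OF RSYT_col[OF T mem[OF that(1)] mem[OF that(2)]]] that by simp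
  qed
  show "?T \<in> Y" unfolding RSYT_def using bij out row col by blast
qed

section \<open>Young's generators on the span of the standard tableaux\<close>

definition V :: "vec set" where "V = {v. \<forall>T. v T \<noteq> 0 \<longrightarrow> T \<in> Y}"

lemma V_bv: "T \<in> Y \<Longrightarrow> bv T \<in> V" by (auto simp: V_def bv_def)
lemma V_0 [simp]: "(\<lambda>S. 0) \<in> V" "0 \<in> V" by (auto simp: V_def)
lemma V_add: "v \<in> V \<Longrightarrow> w \<in> V \<Longrightarrow> (\<lambda>S. v S + w S) \<in> V" by (force simp: V_def)
lemma V_scale: "v \<in> V \<Longrightarrow> (\<lambda>S. c * v S) \<in> V" by (auto simp: V_def)

lemma V_outside: "v \<in> V \<Longrightarrow> S \<notin> Y \<Longrightarrow> v S = 0" by (auto simp: V_def)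

definition bq :: "nat \<Rightarrow> tab \<Rightarrow> real" where
  "bq i T = 1 / real_of_int (cont i T - cont (Suc i) T)"

text \<open>The coefficient of the interchanged tableau. With the value 0 in a common row or column,
  where \<open>bq\<close> is 1 or -1, all cases of \<open>tau_sb\<close> merge into a single
  formula.\<close>

definition gq :: "nat \<Rightarrow> tab \<Rightarrow> real" where
  "gq i T = (if rw i T = rw (Suc i) T \<or> cm i T = cm (Suc i) T then 0
     else if rw i T < rw (Suc i) T then 1 else 1 - (bq i T)\<^sup>2)"

lemma bq_swap [simp]: "bq i (T \<circ> sw i (Suc i)) = - bq i T"
  by (simp add: bq_def divide_simps)

text \<open>On a two-dimensional block this is the statement that the generator squares to the
  identity.\<close>

lemma gq_mult:
  assumes T: "T \<in> Y" and i: "i \<in> {1..<N}"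
  shows "gq i (T \<circ> sw i (Suc i)) * gq i T = 1 - (bq i T)\<^sup>2"
  using cont_row[OF T i] cont_col[OF T i] by (auto simp: gq_def) (auto simp: bq_def)

lemma gq_eq_0_iff:
  assumes T: "T \<in> Y" and i: "i \<in> {1..<N}"
  shows "gq i T = 0 \<longleftrightarrow> T \<circ> sw i (Suc i) \<notin> Y"
proof -
  have "(bq i T)\<^sup>2 < 1" if "rw i T \<noteq> rw (Suc i) T" "cm i T \<noteq> cm (Suc i) T"
  proof -
    have "\<bar>cont i T - cont (Suc i) T\<bar> \<ge> 2"
      using cont_up[OF T i] cont_down[OF T i] that by linarith
    hence "\<bar>real_of_int (cont i T - cont (Suc i) T)\<bar> \<ge> 2" by linarith
    hence "\<bar>bq i T\<bar> < 1" by (simp add: bq_def divide_simps)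
    thus ?thesis by (simp add: abs_square_less_1)
  qed
  thus ?thesis unfolding swap_in_Y_iff[OF assms] by (auto simp: gq_def)
qed

lemma tau_sb_eq:
  assumes T: "T \<in> Y" and i: "i \<in> {1..<N}"
  shows "tau_sb i T S = of_real (bq i T) * bv T S + of_real (gq i T) * bv (T \<circ> sw i (Suc i)) S"
proof -
  have "bq i T = 1" if "rw i T = rw (Suc i) T" using cont_row[OF T i that] by (simp only: bq_def of_int_1 div_by_1)
  moreover have "bq i T = -1" if "cm i T = cm (Suc i) T"
    using cont_col[OF T i that] by (simp add: bq_def)
  ultimately show ?thesis
    unfolding tau_sb_def Let_def bq_def[symmetric] gq_def by auto
qed

text \<open>The matrix read by rows: the entry coming from the interchanged tableau carries the
  coefficient of that tableau, hence \<open>gq\<close> is evaluated there and not at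
  \<open>S\<close>.\<close>

lemma tau_s_in:
  assumes S: "S \<in> Y" and i: "i \<in> {1..<N}"
  shows "tau_s N \<tau> i v S = of_real (bq i S) * v S + of_real (gq i (S \<circ> sw i (Suc i))) * v (S \<circ> sw i (Suc i))"
proof -
  let ?S = "S \<circ> sw i (Suc i)"
  have "tau_s N \<tau> i v S = (\<Sum>T\<in>Y. v T * (of_real (bq i T) * bv T S + of_real (gq i T) * bv (T \<circ> sw i (Suc i)) S))"
    unfolding tau_s_def by (intro sum.cong refl) (simp only: tau_sb_eq[OF _ i])
  also have "\<dots> = (\<Sum>T\<in>Y. if T = S then v T * of_real (bq i T) else 0)
               + (\<Sum>T\<in>Y. if T = ?S then v T * of_real (gq i T) else 0)"
    unfolding sum.distrib[symmetric]
  proof (intro sum.cong refl)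
    fix T
    have "bv T S = (if T = S then 1 else 0)" "bv (T \<circ> sw i (Suc i)) S = (if T = ?S then 1 else 0)"
      using eq_comp_sw_iff[of T i "Suc i" S] by (auto simp: bv_def)
    thus "v T * (of_real (bq i T) * bv T S + of_real (gq i T) * bv (T \<circ> sw i (Suc i)) S) =
      (if T = S then v T * of_real (bq i T) else 0) + (if T = ?S then v T * of_real (gq i T) else 0)"
      by (simp add: algebra_simps del: bq_swap)
  qed
  also have "\<dots> = of_real (bq i S) * v S + of_real (gq i ?S) * v ?S"
  proof (cases "?S \<in> Y")
    case True
    thus ?thesis using S by (simp add: finite_Y algebra_simps)
  next
    case False
    have "gq i ?S = 0" using False S i by (auto simp: swap_in_Y_iff gq_def)
    thus ?thesis using S False by (simp add: finite_Y algebra_simps sum.delta)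
  qed
  finally show ?thesis .
qed

lemma tau_s_out:
  assumes S: "S \<notin> Y" and i: "i \<in> {1..<N}"
  shows "tau_s N \<tau> i v S = 0"
  unfolding tau_s_def
proof (intro sum.neutral ballI)
  fix T assume T: "T \<in> Y"
  have "gq i T = 0" if "T \<circ> sw i (Suc i) = S" using gq_eq_0_iff[OF T i] that S by auto
  thus "v T * tau_sb i T S = 0" using T S by (auto simp: tau_sb_eq[OF T i] bv_def)
qed

lemma tau_s_V: "i \<in> {1..<N} \<Longrightarrow> tau_s N \<tau> i v \<in> V"
  using tau_s_out by (auto simp: V_def)

lemma tau_s_bv:
  assumes T: "T \<in> Y" and i: "i \<in> {1..<N}"
  shows "tau_s N \<tau> i (bv T) = (\<lambda>S. of_real (bq i T) * bv T S + of_real (gq i T) * bv (T \<circ> sw i (Suc i)) S)"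
proof
  fix S
  have "tau_s N \<tau> i (bv T) S = (\<Sum>T'\<in>Y. if T' = T then tau_sb i T S else 0)"
    unfolding tau_s_def by (intro sum.cong) (auto simp: bv_def)
  thus "tau_s N \<tau> i (bv T) S = of_real (bq i T) * bv T S + of_real (gq i T) * bv (T \<circ> sw i (Suc i)) S"
    using T by (simp add: finite_Y tau_sb_eq[OF T i])
qed

lemma tau_s_tau_s:
  assumes v: "v \<in> V" and i: "i \<in> {1..<N}"
  shows "tau_s N \<tau> i (tau_s N \<tau> i v) = v"
proof
  fix S
  show "tau_s N \<tau> i (tau_s N \<tau> i v) S = v S"
  proof (cases "S \<in> Y")
    case False
    thus ?thesis using V_outside[OF v False] tau_s_out[OF False i] by simp
  next
    case S: True
    let ?S = "S \<circ> sw i (Suc i)"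
    have g: "gq i ?S * gq i S = 1 - (bq i S)\<^sup>2" by (rule gq_mult[OF S i])
    show ?thesis
    proof (cases "?S \<in> Y")
      case True
      have "tau_s N \<tau> i (tau_s N \<tau> i v) S =
         of_real ((bq i S)\<^sup>2 + gq i ?S * gq i S) * v S"
        using bq_swap[of i S] unfolding tau_s_in[OF S i] tau_s_in[OF True i]
        by (simp add: algebra_simps power2_eq_square)
      thus ?thesis using g by simp
    next
      case False
      have g0: "gq i ?S = 0" using False S i by (auto simp: swap_in_Y_iff gq_def)
      hence "(bq i S)\<^sup>2 = 1" using g by simp
      hence "of_real (bq i S) * (of_real (bq i S) * v S) = v S"
        by (metis mult.assoc mult_1 of_real_1 of_real_mult power2_eq_square)
      thus ?thesis by (simp add: tau_s_in[OF S i] g0)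
    qed
  qed
qed

end

section \<open>The representation of the symmetric group\<close>

lemma word_perm_Nil [simp]: "word_perm [] = id"
  and word_perm_Cons [simp]: "word_perm (i # ws) = sw i (Suc i) \<circ> word_perm ws"
  by (simp_all add: word_perm_def)

lemma word_perm_append [simp]: "word_perm (us @ ws) = word_perm us \<circ> word_perm ws"
  by (induction us) (simp_all add: comp_assoc)

lemma tau_word_Nil [simp]: "tau_word N \<tau> [] = id"
  and tau_word_Cons [simp]: "tau_word N \<tau> (i # ws) = tau_s N \<tau> i \<circ> tau_word N \<tau> ws"
  by (simp_all add: tau_word_def)

lemma tau_word_append [simp]: "tau_word N \<tau> (us @ ws) = tau_word N \<tau> us \<circ> tau_word N \<tau> ws"
  by (induction us) (simp_all add: comp_assoc)

lemma word_perm_rev: "word_perm (rev ws) \<circ> word_perm ws = id"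
proof (induction ws)
  case (Cons i ws)
  have "word_perm (rev (i # ws)) \<circ> word_perm (i # ws)
      = word_perm (rev ws) \<circ> (sw i (Suc i) \<circ> sw i (Suc i)) \<circ> word_perm ws"
    by (simp add: comp_assoc del: sw_comp_sw)
  thus ?case using Cons by simp
qed simp

lemma word_perm_permutes: "set ws \<subseteq> {1..<n} \<Longrightarrow> word_perm ws permutes {1..n}"
proof (induction ws)
  case (Cons i ws)
  hence "sw i (Suc i) permutes {1..n}" by (intro sw_permutes) auto
  thus ?case unfolding word_perm_Cons using Cons by (intro permutes_compose) auto
qed (simp add: permutes_id)

lemma word_perm_upt: "k \<le> n \<Longrightarrow> word_perm [k..<n] n = k"
  by (induction rule: inc_induct) (simp_all add: upt_conv_Cons)

text \<open>The word \<open>[k..<Suc n]\<close> is a cycle sending \<open>Suc n\<close> to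
  \<open>k\<close>. Taking \<open>k\<close> to be the image of \<open>Suc n\<close> and stripping
  this cycle off leaves a permutation fixing \<open>Suc n\<close>.\<close>

lemma word_perm_surj:
  "w permutes {1..n} \<Longrightarrow> \<exists>ws. set ws \<subseteq> {1..<n} \<and> word_perm ws = w"
proof (induction n arbitrary: w)
  case 0
  thus ?case by (intro exI[of _ "[]"]) auto
next
  case (Suc n)
  define k where "k = w (Suc n)"
  have k: "1 \<le> k" "k \<le> Suc n" using permutes_in_image[OF Suc.prems, of "Suc n"] by (auto simp: k_def)
  let ?u = "[k..<Suc n]"
  define w' where "w' = word_perm (rev ?u) \<circ> w"
  have u: "set ?u \<subseteq> {1..<Suc n}" using k by auto
  have "word_perm (rev ?u) k = Suc n"
    using fun_cong[OF word_perm_rev, of ?u "Suc n"] word_perm_upt[OF k(2)] by (simp del: upt_Suc)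
  hence fixed: "w' (Suc n) = Suc n" by (simp add: w'_def k_def)
  have "w' permutes {1..Suc n}"
    unfolding w'_def using u by (intro permutes_compose Suc.prems word_perm_permutes) auto
  hence "w' permutes {1..n}"
    by (rule permutes_superset) (use fixed in \<open>auto simp: le_Suc_eq\<close>)
  then obtain ws where ws: "set ws \<subseteq> {1..<n}" "word_perm ws = w'" using Suc.IH by blast
  have "word_perm ?u \<circ> word_perm (rev ?u) = id"
    using word_perm_rev[of "rev ?u"] by simp
  hence "word_perm (?u @ ws) = w"
    unfolding word_perm_append ws(2) w'_def by (simp add: comp_assoc[symmetric] del: upt_Suc)
  thus ?case using u ws(1) by (intro exI[of _ "?u @ ws"]) auto
qed

section \<open>The Coxeter relations for Young's generators\<close>

context young begin

text \<open>Written as functions of two cells, the coefficients make sense for arbitrary fillings,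
  so that the braid relation becomes an identity in three cells without a case distinction on
  standardness.\<close>

definition bc :: "nat \<times> nat \<Rightarrow> nat \<times> nat \<Rightarrow> real" where
  "bc p q = 1 / real_of_int ((int (snd p) - int (fst p)) - (int (snd q) - int (fst q)))"

definition gc :: "nat \<times> nat \<Rightarrow> nat \<times> nat \<Rightarrow> real" where
  "gc p q = (if fst p = fst q \<or> snd p = snd q then 0 else if fst p < fst q then 1 else 1 - (bc p q)\<^sup>2)"

lemma bq_eq: "bq i T = bc (T i) (T (Suc i))"
  and gq_eq: "gq i T = gc (T i) (T (Suc i))"
  by (simp_all add: bq_def bc_def gq_def gc_def cont_def rw_def cm_def)

text \<open>The action of \<^term>\<open>tau_s\<close> with the restriction to standard tableaux dropped: it agrees with
  \<^term>\<open>tau_s\<close> on \<^term>\<open>Y\<close> because the coefficient of a nonstandard tableau vanishes.\<close>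
definition sact :: "nat \<Rightarrow> vec \<Rightarrow> vec" where
  "sact i v X = of_real (bc (X i) (X (Suc i))) * v X
     + of_real (gc (X (Suc i)) (X i)) * v (X \<circ> sw i (Suc i))"

lemma tau_s_eq_sact:
  assumes "i \<in> {1..<N}" "\<And>X. X \<in> Y \<Longrightarrow> v X = u X" "X \<in> Y"
  shows "tau_s N \<tau> i v X = sact i u X"
proof -
  have "gq i (X \<circ> sw i (Suc i)) = 0" if "X \<circ> sw i (Suc i) \<notin> Y"
    using that assms by (auto simp: swap_in_Y_iff gq_def)
  thus ?thesis using assms(2) \<open>X \<in> Y\<close>
    unfolding tau_s_in[OF \<open>X \<in> Y\<close> \<open>i \<in> {1..<N}\<close>] sact_def bq_eq gq_eq
    by (cases "X \<circ> sw i (Suc i) \<in> Y") auto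
qed

lemma tau_s_commute:
  assumes i: "i \<in> {1..<N}" "j \<in> {1..<N}" and far: "Suc i < j \<or> Suc j < i"
  shows "tau_s N \<tau> i (tau_s N \<tau> j v) = tau_s N \<tau> j (tau_s N \<tau> i v)"
proof
  fix X :: tab
  have s: "X \<circ> sw i (Suc i) \<circ> sw j (Suc j) = X \<circ> sw j (Suc j) \<circ> sw i (Suc i)"
    using far by (auto simp: fun_eq_iff sw_def)
  have "sact i (sact j v) X = sact j (sact i v) X"
    using far unfolding sact_def s by (auto simp: algebra_simps)
  moreover have "tau_s N \<tau> i (tau_s N \<tau> j v) X = sact i (sact j v) X" if "X \<in> Y"
    by (intro tau_s_eq_sact i refl that)
  moreover have "tau_s N \<tau> j (tau_s N \<tau> i v) X = sact j (sact i v) X" if "X \<in> Y"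
    by (intro tau_s_eq_sact i refl that)
  ultimately show "tau_s N \<tau> i (tau_s N \<tau> j v) X = tau_s N \<tau> j (tau_s N \<tau> i v) X"
    using i by (cases "X \<in> Y") (simp_all add: tau_s_out)
qed

text \<open>Both sides involve only the six fillings obtained from \<open>X\<close> by permuting
  three consecutive entries. Besides the involution identities, the comparison needs only the
  relation between the three reciprocal content differences.\<close>

lemma sact_braid:
  assumes X: "X \<in> Y" and i: "i \<in> {1..<N}" "Suc i \<in> {1..<N}"
  shows "sact i (sact (Suc i) (sact i v)) X = sact (Suc i) (sact i (sact (Suc i) v)) X"
proof -
  define A B C where "A = X i" and "B = X (Suc i)" and "C = X (Suc (Suc i))"
  let ?s = "sw i (Suc i)" and ?t = "sw (Suc i) (Suc (Suc i))"
  define x y z where "x = complex_of_real (bc A B)" and "y = complex_of_real (bc B C)" and "z = complex_of_real (bc A C)"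
  have bcneg: "bc q p = - bc p q" for p q
    by (simp add: bc_def divide_simps)
  have neq: "cont i X \<noteq> cont (Suc i) X" "cont (Suc i) X \<noteq> cont (Suc (Suc i)) X"
    "cont i X \<noteq> cont (Suc (Suc i)) X"
    using cont_neq[OF X] i by auto
  \<comment> \<open>The rational solution of the Yang-Baxter equation: 1/((a - b)(b - c)) split by
    means of (a - b) + (b - c) = a - c.\<close>
  have "bc A B * bc B C = bc A C * bc A B + bc A C * bc B C"
  proof -
    define a b c where "a = real_of_int (cont i X)" and "b = real_of_int (cont (Suc i) X)"
      and "c = real_of_int (cont (Suc (Suc i)) X)"
    have "a - b \<noteq> 0" "b - c \<noteq> 0" "a - c \<noteq> 0" using neq by (auto simp: a_def b_def c_def)
    hence "1 / (a - b) * (1 / (b - c)) = 1 / (a - c) * (1 / (a - b)) + 1 / (a - c) * (1 / (b - c))"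
      by (simp add: divide_simps)
    thus ?thesis
      by (simp add: bc_def A_def B_def C_def a_def b_def c_def cont_def rw_def cm_def)
  qed
  hence rel: "x * y = z * x + z * y"
    unfolding x_def y_def z_def by (metis of_real_add of_real_mult)
  have g1: "complex_of_real (gc A B) * of_real (gc B A) = 1 - x * x"
    using gq_mult[OF X i(1)] by (simp add: x_def A_def B_def gq_eq bq_eq power2_eq_square mult.commute flip: of_real_mult)
  have g2: "complex_of_real (gc B C) * of_real (gc C B) = 1 - y * y"
    using gq_mult[OF X i(2)] by (simp add: y_def B_def C_def gq_eq bq_eq power2_eq_square mult.commute flip: of_real_mult)
  define v0 v1 v2 v3 v4 v5 where "v0 = v X" and "v1 = v (X \<circ> ?s)" and "v2 = v (X \<circ> ?t)"
    and "v3 = v (X \<circ> ?s \<circ> ?t)" and "v4 = v (X \<circ> ?t \<circ> ?s)" and "v5 = v (X \<circ> ?s \<circ> ?t \<circ> ?s)"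
  have braid: "X \<circ> ?t \<circ> ?s \<circ> ?t = X \<circ> ?s \<circ> ?t \<circ> ?s"
    by (auto simp: fun_eq_iff sw_def)
  define hAB hBA hBC hCB hCA where "hAB = complex_of_real (gc A B)" and "hBA = complex_of_real (gc B A)"
    and "hBC = complex_of_real (gc B C)" and "hCB = complex_of_real (gc C B)" and "hCA = complex_of_real (gc C A)"
  have L: "sact i (sact (Suc i) (sact i v)) X =
     x * (y * (x * v0 + hBA * v1) + hCB * (z * v2 + hCA * v4))
     + hBA * (z * (- x * v1 + hAB * v0) + hCA * (y * v3 + hCB * v5))"
    unfolding sact_def
    by (simp add: A_def[symmetric] B_def[symmetric] C_def[symmetric] v0_def v1_def v2_def v3_def v4_def v5_def
        x_def y_def z_def hAB_def hBA_def hBC_def hCB_def hCA_def bcneg[of B A])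
  have R: "sact (Suc i) (sact i (sact (Suc i) v)) X =
     y * (x * (y * v0 + hCB * v2) + hBA * (z * v1 + hCA * v3))
     + hCB * (z * (- y * v2 + hBC * v0) + hCA * (x * v4 + hBA * v5))"
    unfolding sact_def
    by (simp add: A_def[symmetric] B_def[symmetric] C_def[symmetric] v0_def v1_def v2_def v3_def v4_def
        v5_def[folded braid]
        x_def y_def z_def hAB_def hBA_def hBC_def hCB_def hCA_def bcneg[of C B])
  \<comment> \<open>The coefficients at \<open>v0\<close>, then those at \<open>v1\<close> and
    \<open>v2\<close>; the ones at \<open>v3\<close>, \<open>v4\<close> and \<open>v5\<close> agree
    on both sides as they stand.\<close>
  have "x * (y * x) + z * (1 - x * x) = y * (x * y) + z * (1 - y * y)"
    using rel by algebra
  moreover have "x * y - z * x = y * z" "x * z = y * x - z * y" using rel by algebra+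
  ultimately show ?thesis
    unfolding L R using g1 g2 unfolding hAB_def[symmetric] hBA_def[symmetric] hBC_def[symmetric] hCB_def[symmetric]
    by algebra
qed

lemma tau_s_braid:
  assumes i: "i \<in> {1..<N}" "Suc i \<in> {1..<N}"
  shows "tau_s N \<tau> i (tau_s N \<tau> (Suc i) (tau_s N \<tau> i v)) = tau_s N \<tau> (Suc i) (tau_s N \<tau> i (tau_s N \<tau> (Suc i) v))"
proof
  fix X
  show "tau_s N \<tau> i (tau_s N \<tau> (Suc i) (tau_s N \<tau> i v)) X = tau_s N \<tau> (Suc i) (tau_s N \<tau> i (tau_s N \<tau> (Suc i) v)) X"
  proof (cases "X \<in> Y")
    case True
    have "tau_s N \<tau> i (tau_s N \<tau> (Suc i) (tau_s N \<tau> i v)) X = sact i (sact (Suc i) (sact i v)) X"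
      by (intro tau_s_eq_sact i refl True)
    moreover have "tau_s N \<tau> (Suc i) (tau_s N \<tau> i (tau_s N \<tau> (Suc i) v)) X = sact (Suc i) (sact i (sact (Suc i) v)) X"
      by (intro tau_s_eq_sact i refl True)
    ultimately show ?thesis using sact_braid[OF True i] by simp
  qed (use i in \<open>simp add: tau_s_out\<close>)
qed

section \<open>Words modulo the Coxeter relations\<close>

definition weq :: "nat list \<Rightarrow> nat list \<Rightarrow> bool" (infix "\<simeq>" 50) where
  "ws \<simeq> us \<longleftrightarrow> word_perm ws = word_perm us \<and> (\<forall>v\<in>V. tau_word N \<tau> ws v = tau_word N \<tau> us v)"

lemma weq_trans [trans]: "a \<simeq> b \<Longrightarrow> b \<simeq> c \<Longrightarrow> a \<simeq> c"
  by (simp add: weq_def)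

lemma weq_refl [simp]: "a \<simeq> a" by (simp add: weq_def)
lemma weq_sym: "a \<simeq> b \<Longrightarrow> b \<simeq> a" by (simp add: weq_def)

lemma tau_word_V: "set ws \<subseteq> {1..<N} \<Longrightarrow> v \<in> V \<Longrightarrow> tau_word N \<tau> ws v \<in> V"
  by (induction ws) (auto intro: tau_s_V)

lemma weq_append:
  assumes "a \<simeq> b" "set d \<subseteq> {1..<N}" shows "c @ a @ d \<simeq> c @ b @ d"
  using assms tau_word_V by (auto simp: weq_def)

lemma weq_Cons: "a \<simeq> b \<Longrightarrow> i # a \<simeq> i # b"
  using weq_append[of a b "[]" "[i]"] by simp

text \<open>This is why operators are compared on \<open>V\<close> only: a generator maps every
  vector into \<open>V\<close>, so its square cannot be the identity elsewhere.\<close>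

lemma weq_square: "i \<in> {1..<N} \<Longrightarrow> [i, i] \<simeq> []"
  by (simp add: weq_def tau_s_tau_s)

lemma weq_commute: "i \<in> {1..<N} \<Longrightarrow> j \<in> {1..<N} \<Longrightarrow> Suc i < j \<or> Suc j < i \<Longrightarrow> [i, j] \<simeq> [j, i]"
  by (auto simp: weq_def tau_s_commute fun_eq_iff sw_def)

lemma weq_braid: "i \<in> {1..<N} \<Longrightarrow> Suc i \<in> {1..<N} \<Longrightarrow> [i, Suc i, i] \<simeq> [Suc i, i, Suc i]"
  by (auto simp: weq_def tau_s_braid fun_eq_iff sw_def)

lemma weq_commute_word:
  assumes "i \<in> {1..<N}" "set ws \<subseteq> {1..<N}" "\<And>j. j \<in> set ws \<Longrightarrow> Suc i < j \<or> Suc j < i"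
  shows "i # ws \<simeq> ws @ [i]"
  using assms(2,3)
proof (induction ws)
  case (Cons j ws)
  have "[i, j] @ ws \<simeq> [j, i] @ ws"
    using weq_append[OF weq_commute, of i j ws "[]"] assms(1) Cons.prems by auto
  moreover have "j # i # ws \<simeq> j # (ws @ [i])" using Cons by (intro weq_Cons) auto
  ultimately show ?case using weq_trans by auto
qed simp

text \<open>Since \<open>us\<close> fixes \<open>n\<close>, the number \<open>k\<close> is the image of \<open>n\<close> under the permutation, whence uniqueness.\<close>
lemma word_normal_form:
  assumes "set ws \<subseteq> {1..<n}" "1 \<le> n" "n \<le> N"
  shows "\<exists>k us. 1 \<le> k \<and> k \<le> n \<and> set us \<subseteq> {1..<n-1} \<and> ws \<simeq> [k..<n] @ us"
  using assms(1)
proof (induction ws)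
  case Nil
  show ?case using assms(2) by (intro exI[of _ n] exI[of _ "[]"]) auto
next
  case (Cons i ws)
  then obtain k us where k: "1 \<le> k" "k \<le> n" "set us \<subseteq> {1..<n-1}" and ws: "ws \<simeq> [k..<n] @ us" by auto
  have i: "i \<in> {1..<n}" "i \<in> {1..<N}" using Cons.prems assms by auto
  have us: "set us \<subseteq> {1..<N}" using k(3) assms(3) by fastforce
  have sub: "set [a..<b] \<subseteq> {1..<N}" if "1 \<le> a" "b \<le> n" for a b using that assms by auto
  have start: "i # ws \<simeq> i # [k..<n] @ us" using ws by (rule weq_Cons)
  consider "Suc i < k" | "Suc i = k" | "i = k" | "k < i" by linarith
  thus ?case
  proof cases
    case 1
    have "i # [k..<n] \<simeq> [k..<n] @ [i]" using 1 i k assms(3) by (intro weq_commute_word) auto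
    from weq_append[OF this us, of "[]"] have "i # [k..<n] @ us \<simeq> [k..<n] @ (i # us)" by simp
    thus ?thesis using weq_trans[OF start] k 1 i
      by (intro exI[of _ k] exI[of _ "i # us"]) auto
  next
    case 2
    hence "i # [k..<n] @ us = [i..<n] @ us" using i by (simp add: upt_conv_Cons)
    hence "i # ws \<simeq> [i..<n] @ us" using start by metis
    thus ?thesis using k i by (intro exI[of _ i] exI[of _ us]) auto
  next
    case 3
    hence "i # [k..<n] @ us = [] @ [i, i] @ [Suc i..<n] @ us" using i by (simp add: upt_conv_Cons)
    moreover have "[] @ [i, i] @ [Suc i..<n] @ us \<simeq> [] @ [] @ [Suc i..<n] @ us"
      using us sub i by (intro weq_append weq_square) auto
    ultimately have "i # [k..<n] @ us \<simeq> [Suc i..<n] @ us" by simp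
    thus ?thesis using weq_trans[OF start] k i by (intro exI[of _ "Suc i"] exI[of _ us]) auto
  next
    case 4
    \<comment> \<open>The letter \<open>i\<close> commutes to the right up to the factor
      \<open>j, i\<close>; the braid relation turns \<open>i, j, i\<close> into
      \<open>j, i, j\<close>, and the trailing \<open>j\<close> commutes past the remaining letters
      and joins \<open>us\<close>.\<close>
    define j where "j = i - 1"
    have ij: "i = Suc j" "k \<le> j" "1 \<le> j" using 4 k by (auto simp: j_def)
    have split: "[k..<n] = [k..<j] @ [j, i] @ [Suc i..<n]"
    proof -
      have "[k..<n] = [k..<j] @ [j..<n]" using ij i upt_add_eq_append[of k j "n - j"] by simp
      thus ?thesis using ij i by (simp add: upt_conv_Cons)
    qed
    have jN: "j \<in> {1..<N}" "Suc j \<in> {1..<N}" using ij i by auto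
    have "i # [k..<n] @ us \<simeq> [] @ (i # [k..<j]) @ ([j, i] @ [Suc i..<n] @ us)" by (simp add: split)
    also have "\<dots> \<simeq> [] @ ([k..<j] @ [i]) @ ([j, i] @ [Suc i..<n] @ us)"
      using us sub i ij k jN by (intro weq_append weq_commute_word) auto
    also have "[] @ ([k..<j] @ [i]) @ ([j, i] @ [Suc i..<n] @ us) = [k..<j] @ [Suc j, j, Suc j] @ [Suc i..<n] @ us"
      by (simp add: ij)
    also have "\<dots> \<simeq> [k..<j] @ [j, Suc j, j] @ [Suc i..<n] @ us"
      using us sub i by (intro weq_append weq_sym[OF weq_braid] jN) auto
    also have "\<dots> = ([k..<j] @ [j, i]) @ (j # [Suc i..<n]) @ us" by (simp add: ij)
    also have "\<dots> \<simeq> ([k..<j] @ [j, i]) @ ([Suc i..<n] @ [j]) @ us"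
      using us sub i ij jN by (intro weq_append weq_commute_word) auto
    also have "\<dots> = [k..<n] @ (j # us)" by (simp add: split)
    finally have "i # [k..<n] @ us \<simeq> [k..<n] @ (j # us)" .
    thus ?thesis using weq_trans[OF start] k ij i by (intro exI[of _ k] exI[of _ "j # us"]) auto
  qed
qed

text \<open>The Coxeter relations present the symmetric group, so the arbitrary choice of a word in
  \<open>tau_perm\<close> does not matter. In normal form the image of \<open>Suc n\<close>
  determines the cycle, which cancels and leaves words in fewer generators.\<close>

lemma weq_if_word_perm_eq:
  assumes "set ws \<subseteq> {1..<n}" "set us \<subseteq> {1..<n}" "n \<le> N" "word_perm ws = word_perm us"
  shows "ws \<simeq> us"
  using assms
proof (induction n arbitrary: ws us)
  case (Suc n)
  obtain k ws' where k: "1 \<le> k" "k \<le> Suc n" "set ws' \<subseteq> {1..<n}" "ws \<simeq> [k..<Suc n] @ ws'"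
    using word_normal_form[of ws "Suc n"] Suc.prems by auto
  obtain l us' where l: "1 \<le> l" "l \<le> Suc n" "set us' \<subseteq> {1..<n}" "us \<simeq> [l..<Suc n] @ us'"
    using word_normal_form[of us "Suc n"] Suc.prems by auto
  have fixed: "word_perm xs (Suc n) = Suc n" if "set xs \<subseteq> {1..<n}" for xs
    using word_perm_permutes[OF that] by (simp add: permutes_def)
  have p: "word_perm [k..<Suc n] \<circ> word_perm ws' = word_perm [l..<Suc n] \<circ> word_perm us'"
    using Suc.prems(4) k(4) l(4) unfolding weq_def word_perm_append by metis
  have "k = l"
    using fun_cong[OF p, of "Suc n"] fixed k l word_perm_upt by (simp del: upt_Suc)
  have "word_perm ws' = word_perm us'"
    using arg_cong[OF p, of "\<lambda>f. word_perm (rev [k..<Suc n]) \<circ> f"] word_perm_rev[of "[k..<Suc n]"]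
    unfolding \<open>k = l\<close> comp_assoc[symmetric] by (simp del: upt_Suc)
  hence "ws' \<simeq> us'" using Suc.IH k l Suc.prems by auto
  hence "[k..<Suc n] @ ws' \<simeq> [l..<Suc n] @ us'"
    using weq_append[of ws' us' "[]" "[k..<Suc n]"] \<open>k = l\<close> by simp
  thus ?case using k(4) l(4) weq_trans weq_sym by blast
qed simp

abbreviation "tp \<equiv> tau_perm N \<tau>"

lemma tau_perm_word_perm:
  assumes "set ws \<subseteq> {1..<N}" "v \<in> V"
  shows "tp (word_perm ws) v = tau_word N \<tau> ws v"
proof -
  let ?P = "\<lambda>us. set us \<subseteq> {1..<N} \<and> word_perm us = word_perm ws"
  have "?P (SOME us. ?P us)" by (rule someI[of ?P ws]) (use assms in auto)
  hence "(SOME us. ?P us) \<simeq> ws" using assms by (intro weq_if_word_perm_eq[of _ N]) auto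
  thus ?thesis using assms by (simp add: tau_perm_def weq_def)
qed

lemma tp_comp:
  assumes "w permutes {1..N}" "u permutes {1..N}" "v \<in> V"
  shows "tp (w \<circ> u) v = tp w (tp u v)"
proof -
  obtain ws us where w: "set ws \<subseteq> {1..<N}" "word_perm ws = w" "set us \<subseteq> {1..<N}" "word_perm us = u"
    using word_perm_surj assms(1,2) by metis
  have "tp (w \<circ> u) v = tp (word_perm (ws @ us)) v" by (simp add: w)
  also have "\<dots> = tau_word N \<tau> ws (tau_word N \<tau> us v)"
    using w by (subst tau_perm_word_perm) (auto simp: assms)
  finally show ?thesis
    using tau_perm_word_perm[OF w(1)] tau_perm_word_perm[OF w(3)] tau_word_V[OF w(3)] assms w by auto
qed

lemma tp_id: "v \<in> V \<Longrightarrow> tp id v = v"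
  using tau_perm_word_perm[of "[]" v] by simp

lemma tp_s: "i \<in> {1..<N} \<Longrightarrow> v \<in> V \<Longrightarrow> tp (sw i (Suc i)) v = tau_s N \<tau> i v"
  using tau_perm_word_perm[of "[i]" v] by simp

lemma tp_V: "w permutes {1..N} \<Longrightarrow> v \<in> V \<Longrightarrow> tp w v \<in> V"
  using word_perm_surj[of w N] tau_perm_word_perm[of _ v] tau_word_V by metis

lemma tau_word_add: "tau_word N \<tau> ws (\<lambda>S. u S + v S) = (\<lambda>S. tau_word N \<tau> ws u S + tau_word N \<tau> ws v S)"
  by (induction ws) (simp_all add: tau_s_def distrib_right sum.distrib)

lemma tau_word_scale: "tau_word N \<tau> ws (\<lambda>S. c * v S) = (\<lambda>S. c * tau_word N \<tau> ws v S)"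
  by (induction ws) (simp_all add: tau_s_def sum_distrib_left mult.assoc)

lemma tp_add: "tp w (\<lambda>S. u S + v S) = (\<lambda>S. tp w u S + tp w v S)"
  unfolding tau_perm_def by (rule tau_word_add)

lemma tp_scale: "tp w (\<lambda>S. c * v S) = (\<lambda>S. c * tp w v S)"
  unfolding tau_perm_def by (rule tau_word_scale)

lemma tp_0: "tp w (\<lambda>S. 0) = (\<lambda>S. 0)" "tp w 0 = 0"
  using tp_scale[of w 0 "\<lambda>S. 0"] by (simp_all add: zero_fun_def)

lemma tp_sum: "tp w (\<lambda>S. \<Sum>k\<in>K. c k * f k S) = (\<lambda>S. \<Sum>k\<in>K. c k * tp w (f k) S)"
  by (induction K rule: infinite_finite_induct) (simp_all add: tp_add tp_scale tp_0)

lemma tp_inv: "w permutes {1..N} \<Longrightarrow> v \<in> V \<Longrightarrow> tp (inv w) (tp w v) = v"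
  using tp_comp[of "inv w" w v] by (simp add: permutes_inv permutes_inv_o tp_id)

lemma tp_inv': "w permutes {1..N} \<Longrightarrow> v \<in> V \<Longrightarrow> tp w (tp (inv w) v) = v"
  using tp_comp[of w "inv w" v] by (simp add: permutes_inv permutes_inv_o tp_id)

section \<open>Jucys-Murphy elements\<close>

definition jm :: "nat \<Rightarrow> vec \<Rightarrow> vec" where
  "jm i v = (\<lambda>S. \<Sum>j\<in>{i<..N}. tp (sw i j) v S)"

lemma sw_conj_Suc:
  "Suc i < j \<Longrightarrow> sw i j = sw i (Suc i) \<circ> sw (Suc i) j \<circ> sw i (Suc i)"
  by (auto simp: fun_eq_iff sw_def)

text \<open>Sums over the larger indices suit tableaux with decreasing entries. The recursion
  \<open>jm i = s + s (jm (Suc i)) s\<close>, with \<open>s\<close> the simple transposition of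
  \<open>i\<close> and \<open>Suc i\<close>, gives the eigenvalues by downward induction from
  \<open>N\<close>, where the sum is empty.\<close>

lemma jm_bv:
  assumes "i \<le> N" "1 \<le> i" "T \<in> Y"
  shows "jm i (bv T) = (\<lambda>S. of_int (cont i T) * bv T S)"
  using assms
proof (induction arbitrary: T rule: inc_induct)
  case base
  thus ?case by (simp add: jm_def cont_N)
next
  case (step i)
  let ?s = "sw i (Suc i)"
  have i: "i \<in> {1..<N}" using step by auto
  have s: "?s permutes {1..N}" using i by (intro sw_permutes) auto
  let ?T = "T \<circ> ?s"
  let ?b = "complex_of_real (bq i T)" and ?g = "complex_of_real (gq i T)"
  note T = \<open>T \<in> Y\<close>
  define u where "u = tau_s N \<tau> i (bv T)"
  have u: "u = (\<lambda>S. ?b * bv T S + ?g * bv ?T S)" unfolding u_def by (rule tau_s_bv[OF T i])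
  have uV: "u \<in> V" unfolding u_def by (rule tau_s_V[OF i])
  have su: "tp ?s u = bv T" using tp_s[OF i] uV u_def tau_s_tau_s[OF V_bv[OF T] i] by simp
  have "tp (sw i j) (bv T) = tp ?s (tp (sw (Suc i) j) u)" if "j \<in> {Suc i<..N}" for j
  proof -
    have p: "sw (Suc i) j permutes {1..N}" using that i by (intro sw_permutes) auto
    have "sw i j = ?s \<circ> (sw (Suc i) j \<circ> ?s)" using sw_conj_Suc[of i j] that by (simp add: comp_assoc)
    thus ?thesis
      using tp_comp[OF s permutes_compose[OF s p] V_bv[OF T]] tp_comp[OF p s V_bv[OF T]] tp_s[OF i V_bv[OF T]]
      by (simp add: u_def)
  qed
  hence "jm i (bv T) = (\<lambda>S. tp ?s (bv T) S + (\<Sum>j\<in>{Suc i<..N}. 1 * tp ?s (tp (sw (Suc i) j) u) S))"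
  proof -
    have "{i<..N} = insert (Suc i) {Suc i<..N}" using i by auto
    thus ?thesis using \<open>\<And>j. j \<in> {Suc i<..N} \<Longrightarrow> _ j\<close> by (simp add: jm_def)
  qed
  also have "\<dots> = (\<lambda>S. u S + tp ?s (jm (Suc i) u) S)"
    using tp_s[OF i V_bv[OF T]]
      fun_cong[OF tp_sum[of ?s "\<lambda>_. 1" "\<lambda>j. tp (sw (Suc i) j) u" "{Suc i<..N}"], symmetric]
    by (simp only: jm_def u_def[symmetric] mult_1)
  also have "jm (Suc i) u = (\<lambda>S. of_int (cont i T) * u S + (- 1) * bv T S)"
  proof -
    have "jm (Suc i) u = (\<lambda>S. ?b * jm (Suc i) (bv T) S + ?g * jm (Suc i) (bv ?T) S)"
      unfolding u jm_def by (simp add: tp_add tp_scale sum.distrib sum_distrib_left)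
    also have "\<dots> = (\<lambda>S. ?b * (of_int (cont (Suc i) T) * bv T S) + ?g * (of_int (cont i T) * bv ?T S))"
    proof (cases "?T \<in> Y")
      case True
      thus ?thesis using step.IH[OF _ T] step.IH[OF _ True] by (simp del: o_apply)
    next
      case False
      hence "?g = 0" using gq_eq_0_iff[OF T i] by simp
      thus ?thesis using step.IH[OF _ T] by simp
    qed
    also have "\<dots> = (\<lambda>S. of_int (cont i T) * u S + (- 1) * bv T S)"
    proof
      fix S
      have "cont i T \<noteq> cont (Suc i) T" using cont_neq[OF T] i by auto
      \<comment> \<open>\<open>b\<close> is the reciprocal content difference, so replacing one
        content by the other costs exactly one \<open>bv T\<close>. This is the term that
        \<open>s\<close> maps back to \<open>u\<close>, cancelling the summand \<open>u\<close> of
        the recursion.\<close>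
      hence "?b * of_int (cont i T - cont (Suc i) T) = 1" by (simp add: bq_def flip: of_int_diff)
      hence b: "?b * of_int (cont (Suc i) T) = ?b * of_int (cont i T) - 1"
        by (simp add: algebra_simps)
      have "?b * (of_int (cont (Suc i) T) * bv T S) = ?b * of_int (cont i T) * bv T S - bv T S"
        by (simp add: mult.assoc[symmetric] b) (simp add: algebra_simps)
      thus "?b * (of_int (cont (Suc i) T) * bv T S) + ?g * (of_int (cont i T) * bv ?T S)
         = of_int (cont i T) * u S + (- 1) * bv T S"
        by (simp add: u algebra_simps)
    qed
    finally show ?thesis .
  qed
  also have "tp ?s (\<lambda>S. of_int (cont i T) * u S + (- 1) * bv T S)
      = (\<lambda>S. of_int (cont i T) * bv T S - u S)"
    unfolding tp_add tp_scale su using tp_s[OF i V_bv[OF T]] by (simp add: u_def)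
  finally show ?case by simp
qed

lemma V_expand: "v \<in> V \<Longrightarrow> v = (\<lambda>S. \<Sum>T\<in>Y. v T * bv T S)"
proof
  fix S assume v: "v \<in> V"
  have "(\<Sum>T\<in>Y. v T * bv T S) = (\<Sum>T\<in>Y. if T = S then v T else 0)"
    by (intro sum.cong) (auto simp: bv_def)
  thus "v S = (\<Sum>T\<in>Y. v T * bv T S)" using V_outside[OF v] by (auto simp: finite_Y)
qed

lemma jm_apply:
  assumes "i \<in> {1..N}" "v \<in> V"
  shows "jm i v S = of_int (cont i S) * v S"
proof -
  have "jm i v S = (\<Sum>j\<in>{i<..N}. \<Sum>T\<in>Y. v T * tp (sw i j) (bv T) S)"
    unfolding jm_def by (subst V_expand[OF assms(2)]) (simp add: tp_sum)
  also have "\<dots> = (\<Sum>T\<in>Y. v T * jm i (bv T) S)"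
    unfolding jm_def by (subst sum.swap) (simp add: sum_distrib_left)
  also have "\<dots> = (\<Sum>T\<in>Y. if T = S then of_int (cont i S) * v S else 0)"
  proof (intro sum.cong refl)
    fix T assume "T \<in> Y"
    thus "v T * jm i (bv T) S = (if T = S then of_int (cont i S) * v S else 0)"
      using assms(1) by (simp add: jm_bv) (simp add: bv_def)
  qed
  finally show ?thesis using V_outside[OF assms(2)] by (auto simp: finite_Y)
qed

end

section \<open>Cherednik--Dunkl operators on Laurent polynomials\<close>

lemma sw_commute: "sw i j = sw j i"
  by (auto simp: sw_def)

lemma sw_conj: "bij w \<Longrightarrow> sw (w i) (w j) \<circ> w = w \<circ> sw i j"
  by (auto simp: fun_eq_iff sw_def dest: bij_is_inj[THEN injD])

lemma supp_ok_comp: "w permutes {1..N} \<Longrightarrow> supp_ok N (\<gamma> \<circ> w) \<longleftrightarrow> supp_ok N \<gamma>"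
  unfolding supp_ok_def o_def by (metis permutes_in_image permutes_inverses(1) permutes_not_in)

abbreviation supp :: "lpoly \<Rightarrow> mi set" where "supp p \<equiv> {\<beta>. p \<beta> \<noteq> 0}"

definition sc :: "complex \<Rightarrow> lpoly \<Rightarrow> lpoly" where "sc c p = (\<lambda>\<beta> S. c * p \<beta> S)"

lemma sc_apply [simp]: "sc c p \<beta> S = c * p \<beta> S" by (simp add: sc_def)

text \<open>The coefficient of x_i^c x_j^d in (x_i^(a+1) x_j^b - x_i^b x_j^(a+1)) / (x_i - x_j),
  expanded as a geometric sum; it is valid for negative exponents as well. \<open>P\<close> says
  that the other exponents agree.\<close>

definition kf :: "bool \<Rightarrow> int \<Rightarrow> int \<Rightarrow> int \<Rightarrow> int \<Rightarrow> int" where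
  "kf P a b c d = (if P \<and> a + b = c + d
     then if b \<le> c \<and> c \<le> a then 1 else if a < c \<and> c < b then -1 else 0 else 0)"

text \<open>Commutation of the divided difference with multiplication by x_j, by x_i and by powers
  of x_i x_j. In the first two cases the defect is the single term x_j p(x(i,j)), with opposite
  signs.\<close>

lemma kf_shift:
  "kf P a (b + 1) c d = kf P a b c (d - 1) - (if P \<and> a = d - 1 \<and> b = c then 1 else 0)"
  "kf P (a + 1) b c d = kf P a b (c - 1) d + (if P \<and> a = d - 1 \<and> b = c then 1 else 0)"
  "kf P (a + m) (b + m) (c + m) (d + m) = kf P a b c d"
  by (cases P; simp add: kf_def; smt (verit))+

definition mker :: "nat \<Rightarrow> nat \<Rightarrow> mi \<Rightarrow> mi \<Rightarrow> int" where
  "mker i j \<beta> \<gamma> = kf (\<forall>k. k \<noteq> i \<longrightarrow> k \<noteq> j \<longrightarrow> \<beta> k = \<gamma> k) (\<beta> i) (\<beta> j) (\<gamma> i) (\<gamma> j)"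

text \<open>The operator taking \<open>p\<close> to \<open>(x\<^sub>i p(x) - x\<^sub>j p(x(i,j))) / (x\<^sub>i - x\<^sub>j)\<close>, on Laurent polynomials.\<close>
definition Mop :: "nat \<Rightarrow> nat \<Rightarrow> lpoly \<Rightarrow> lpoly" where
  "Mop i j p \<gamma> S = (\<Sum>\<beta>\<in>supp p. of_int (mker i j \<beta> \<gamma>) * p \<beta> S)"

lemma Mop_sup:
  assumes "finite B" "supp p \<subseteq> B"
  shows "Mop i j p \<gamma> = (\<lambda>S. \<Sum>\<beta>\<in>B. of_int (mker i j \<beta> \<gamma>) * p \<beta> S)"
  unfolding Mop_def using assms by (intro ext sum.mono_neutral_left) auto

lemma mker_comp:
  assumes "bij w"
  shows "mker (w i) (w j) (\<beta> \<circ> inv w) \<gamma> = mker i j \<beta> (\<gamma> \<circ> w)"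
proof -
  have inv: "inv w (w k) = k" for k using assms by (simp add: bij_is_inj)
  have "(\<forall>k. k \<noteq> w i \<longrightarrow> k \<noteq> w j \<longrightarrow> \<beta> (inv w k) = \<gamma> k) \<longleftrightarrow> (\<forall>k. k \<noteq> i \<longrightarrow> k \<noteq> j \<longrightarrow> \<beta> k = \<gamma> (w k))"
    by (metis assms bij_inv_eq_iff)
  thus ?thesis by (simp add: mker_def inv)
qed

context young begin

lemma tp_diff: "tp w (\<lambda>S. u S - v S) = (\<lambda>S. tp w u S - tp w v S)"
  using tp_add[of w u "\<lambda>S. (-1) * v S"] by (simp only: tp_scale) simp

abbreviation "lp \<equiv> is_lpoly N \<tau>"

lemma lp_finite: "lp p \<Longrightarrow> finite (supp p)"
  by (simp add: is_lpoly_def)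

lemma lp_V: "lp p \<Longrightarrow> p \<beta> \<in> V"
  by (auto simp: is_lpoly_def V_def)

lemma lp_supp: "lp p \<Longrightarrow> p \<beta> \<noteq> 0 \<Longrightarrow> supp_ok N \<beta>"
  by (simp add: is_lpoly_def)

lemma lpI:
  assumes "finite B" "\<And>\<beta>. p \<beta> \<noteq> 0 \<Longrightarrow> \<beta> \<in> B" "\<And>\<beta>. p \<beta> \<noteq> 0 \<Longrightarrow> supp_ok N \<beta>" "\<And>\<beta>. p \<beta> \<in> V"
  shows "lp p"
  using assms(3,4) finite_subset[OF _ assms(1), of "supp p"] assms(2) by (auto simp: is_lpoly_def V_def)

lemma lp_0: "lp 0"
  by (rule lpI[of "{}"]) auto

lemma lp_add: assumes "lp p" "lp q" shows "lp (p + q)"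
proof (rule lpI[of "supp p \<union> supp q"])
  show "(p + q) \<beta> \<in> V" for \<beta>
    using V_add[OF lp_V[OF assms(1)] lp_V[OF assms(2)], of \<beta> \<beta>] by (simp add: plus_fun_def)
  show "(p + q) \<beta> \<noteq> 0 \<Longrightarrow> supp_ok N \<beta>" for \<beta>
    using lp_supp[OF assms(1), of \<beta>] lp_supp[OF assms(2), of \<beta>] by (cases "p \<beta> = 0") auto
qed (use assms lp_finite in auto)

lemma lp_sc: assumes "lp p" shows "lp (sc c p)"
proof (rule lpI[of "supp p"])
  show "sc c p \<beta> \<in> V" for \<beta> using V_scale[OF lp_V[OF assms], of c \<beta>] by (simp add: sc_def)
  show "sc c p \<beta> \<noteq> 0 \<Longrightarrow> supp_ok N \<beta>" for \<beta>
    using lp_supp[OF assms, of \<beta>] by (force simp: sc_def zero_fun_def)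
  show "sc c p \<beta> \<noteq> 0 \<Longrightarrow> \<beta> \<in> supp p" for \<beta> by (force simp: sc_def zero_fun_def)
qed (use assms lp_finite in auto)

lemma diff_sc: "p - q = p + sc (-1) q"
  by (simp add: fun_eq_iff)

lemma lp_diff: "lp p \<Longrightarrow> lp q \<Longrightarrow> lp (p - q)"
  unfolding diff_sc by (intro lp_add lp_sc)

lemma lp_monov: assumes "supp_ok N \<beta>" "v \<in> V" shows "lp (monov \<beta> v)"
  by (rule lpI[of "{\<beta>}"]) (use assms in \<open>auto simp: monov_def\<close>)

lemma lp_sum: "(\<And>k. k \<in> K \<Longrightarrow> lp (f k)) \<Longrightarrow> lp (sum f K)"
  by (induction K rule: infinite_finite_induct) (auto intro: lp_0 lp_add)

text \<open>In (w p)(x) = \<tau>(w) p(x w) the monomial with exponent \<beta> moves to \<beta>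
  \<circ> inv w, so the coefficient at \<gamma> comes from \<gamma> \<circ> w.\<close>

definition act :: "(nat \<Rightarrow> nat) \<Rightarrow> lpoly \<Rightarrow> lpoly" where
  "act w p = (\<lambda>\<gamma>. tp w (p (\<gamma> \<circ> w)))"

lemma act_supp: assumes w: "w permutes {1..N}" shows "act w p \<beta> \<noteq> 0 \<Longrightarrow> \<beta> \<in> (\<lambda>\<beta>. \<beta> \<circ> inv w) ` supp p"
  by (rule image_eqI[of _ _ "\<beta> \<circ> w"])
    (use w in \<open>auto simp: act_def tp_0 comp_assoc permutes_inv_o\<close>)

lemma lp_act: assumes w: "w permutes {1..N}" and p: "lp p" shows "lp (act w p)"
proof (rule lpI[of "(\<lambda>\<beta>. \<beta> \<circ> inv w) ` supp p"])
  show "act w p \<beta> \<in> V" for \<beta> unfolding act_def by (intro tp_V w lp_V p)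
  show "supp_ok N \<beta>" if "act w p \<beta> \<noteq> 0" for \<beta>
  proof -
    have "p (\<beta> \<circ> w) \<noteq> 0" using that by (auto simp: act_def tp_0)
    thus ?thesis using lp_supp[OF p] supp_ok_comp[OF w] by blast
  qed
qed (use p act_supp[OF w] in \<open>auto simp: lp_finite\<close>)

lemma act_act:
  assumes "w permutes {1..N}" "u permutes {1..N}" "lp p"
  shows "act w (act u p) = act (w \<circ> u) p"
  unfolding act_def by (simp add: tp_comp[OF assms(1,2) lp_V[OF assms(3)]] comp_assoc)

lemma act_id: "lp p \<Longrightarrow> act id p = p"
  by (simp add: act_def tp_id lp_V)

lemma act_add: "act w (p + q) = act w p + act w q"
  and act_sc: "act w (sc c p) = sc c (act w p)"
  unfolding act_def sc_def by (simp_all add: fun_eq_iff plus_fun_def tp_add tp_scale)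

lemma inj_comp_inv: assumes "w permutes {1..N}" shows "inj (\<lambda>\<beta>. \<beta> \<circ> inv w)"
  using permutes_inv_o[OF assms] by (intro inj_on_inverseI[of _ "\<lambda>\<beta>. \<beta> \<circ> w"]) (simp add: comp_assoc)

lemma Mop_act:
  assumes w: "w permutes {1..N}" and p: "lp p"
  shows "Mop (w i) (w j) (act w p) \<gamma> = tp w (Mop i j p (\<gamma> \<circ> w))"
proof
  fix S
  let ?h = "\<lambda>\<beta>. \<beta> \<circ> inv w"
  have "Mop (w i) (w j) (act w p) \<gamma> S = (\<Sum>\<beta>\<in>?h ` supp p. of_int (mker (w i) (w j) \<beta> \<gamma>) * act w p \<beta> S)"
    using act_supp[OF w] lp_finite[OF p] by (subst Mop_sup[of "?h ` supp p"]) auto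
  also have "\<dots> = (\<Sum>\<beta>\<in>supp p. of_int (mker (w i) (w j) (?h \<beta>) \<gamma>) * act w p (?h \<beta>) S)"
    by (intro sum.reindex[unfolded o_def] inj_on_subset[OF inj_comp_inv[OF w]]) auto
  also have "\<dots> = (\<Sum>\<beta>\<in>supp p. of_int (mker i j \<beta> (\<gamma> \<circ> w)) * tp w (p \<beta>) S)"
    by (intro sum.cong) (simp_all add: mker_comp permutes_bij[OF w] act_def comp_assoc permutes_inv_o[OF w])
  also have "\<dots> = tp w (Mop i j p (\<gamma> \<circ> w)) S"
    unfolding Mop_sup[OF lp_finite[OF p] subset_refl] tp_sum ..
  finally show "Mop (w i) (w j) (act w p) \<gamma> S = tp w (Mop i j p (\<gamma> \<circ> w)) S" .
qed

lemma Mop_V: "lp p \<Longrightarrow> Mop i j p \<gamma> \<in> V"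
  using lp_V[of p] by (force simp: V_def Mop_def intro!: sum.neutral)

end

section \<open>Cherednik--Dunkl operators and simple transpositions\<close>

locale jack = young +
  fixes \<kappa> :: real
  assumes kappa: "\<bar>\<kappa>\<bar> * real (htau \<tau>) < 1"
begin

text \<open>The set \<open>A\<close> of subtracted transpositions is kept variable: conjugation by a
  permutation \<open>w\<close> turns it into \<open>w\<close> followed by its image, which need not
  be an initial segment again. The first term is the derivative of x_i p.\<close>

definition Uop :: "nat \<Rightarrow> nat set \<Rightarrow> lpoly \<Rightarrow> lpoly" where
  "Uop i A p = (\<lambda>\<gamma> S. of_int (\<gamma> i + 1) * p \<gamma> S
     + of_real \<kappa> * (\<Sum>j\<in>{1..N} - {i}. tp (sw i j) (Mop i j p \<gamma>) S)
     - of_real \<kappa> * (\<Sum>j\<in>A. tp (sw i j) (p (\<gamma> \<circ> sw i j)) S))"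

definition UL :: "nat \<Rightarrow> lpoly \<Rightarrow> lpoly" where
  "UL i = Uop i {1..<i}"

lemma Mop_add: "lp p \<Longrightarrow> lp q \<Longrightarrow> Mop i j (p + q) \<gamma> S = Mop i j p \<gamma> S + Mop i j q \<gamma> S"
  using lp_finite[of p] lp_finite[of q]
  by (subst (1 2 3) Mop_sup[of "supp p \<union> supp q"]) (auto simp: distrib_left sum.distrib)

lemma Mop_sc: assumes "lp p" shows "Mop i j (sc c p) \<gamma> S = c * Mop i j p \<gamma> S"
proof -
  have "supp (sc c p) \<subseteq> supp p" by (force simp: sc_def zero_fun_def)
  thus ?thesis using lp_finite[OF assms]
    by (subst (1 2) Mop_sup[of "supp p"]) (auto simp: sum_distrib_left mult_ac)
qed

lemma Uop_add: assumes "lp p" "lp q" shows "Uop i A (p + q) = Uop i A p + Uop i A q"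
proof (intro ext)
  fix \<gamma> S
  have m: "Mop i j (p + q) \<gamma> = (\<lambda>S. Mop i j p \<gamma> S + Mop i j q \<gamma> S)" for j
    using Mop_add[OF assms] by blast
  have c: "(p + q) \<beta> = (\<lambda>S. p \<beta> S + q \<beta> S)" for \<beta> by (simp add: plus_fun_def)
  have "Uop i A (p + q) \<gamma> S = Uop i A p \<gamma> S + Uop i A q \<gamma> S"
    unfolding Uop_def m c tp_add sum.distrib by (simp add: algebra_simps)
  thus "Uop i A (p + q) \<gamma> S = (Uop i A p + Uop i A q) \<gamma> S" by simp
qed

lemma Uop_sc: assumes "lp p" shows "Uop i A (sc c p) = sc c (Uop i A p)"
proof (intro ext)
  fix \<gamma> S
  have m: "Mop i j (sc c p) \<gamma> = (\<lambda>S. c * Mop i j p \<gamma> S)" for j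
    using Mop_sc[OF assms] by blast
  have c: "sc c p \<beta> = (\<lambda>S. c * p \<beta> S)" for \<beta> by (simp add: sc_def)
  show "Uop i A (sc c p) \<gamma> S = sc c (Uop i A p) \<gamma> S"
    unfolding Uop_def m c tp_scale by (simp add: sum_distrib_left algebra_simps)
qed

lemma UL_add: "lp p \<Longrightarrow> lp q \<Longrightarrow> UL i (p + q) = UL i p + UL i q"
  and UL_sc: "lp p \<Longrightarrow> UL i (sc c p) = sc c (UL i p)"
  by (simp_all add: UL_def Uop_add Uop_sc)

lemma act_Uop:
  assumes w: "w permutes {1..N}" and p: "lp p" and i: "i \<in> {1..N}" and A: "A \<subseteq> {1..N}"
  shows "act w (Uop i A p) = Uop (w i) (w ` A) (act w p)"
proof (intro ext)
  fix \<gamma> :: mi and S :: tab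
  note bij = permutes_bij[OF w] and inj = permutes_inj_on[OF w]
  have swp: "sw (w i) (w j) permutes {1..N}" "sw i j permutes {1..N}" if "j \<in> {1..N}" for j
    using permutes_in_image[OF w] that i by (simp_all only: sw_permutes)
  have tpw: "tp w (tp (sw i j) v) = tp (sw (w i) (w j)) (tp w v)" if "j \<in> {1..N}" "v \<in> V" for j v
    using tp_comp[OF w swp(2)[OF that(1)] that(2)] tp_comp[OF swp(1)[OF that(1)] w that(2)]
    by (simp add: sw_conj[OF bij])
  have M: "(\<Sum>j\<in>{1..N} - {w i}. tp (sw (w i) j) (Mop (w i) j (act w p) \<gamma>) S)
     = (\<Sum>j\<in>{1..N} - {i}. tp w (tp (sw i j) (Mop i j p (\<gamma> \<circ> w))) S)"
  proof -
    have "{1..N} - {w i} = w ` ({1..N} - {i})"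
      using permutes_image[OF w] by (simp add: image_set_diff permutes_inj[OF w])
    hence "(\<Sum>j\<in>{1..N} - {w i}. tp (sw (w i) j) (Mop (w i) j (act w p) \<gamma>) S)
       = (\<Sum>j\<in>{1..N} - {i}. tp (sw (w i) (w j)) (Mop (w i) (w j) (act w p) \<gamma>) S)"
      by (simp add: sum.reindex[OF inj])
    thus ?thesis by (simp add: Mop_act[OF w p] tpw Mop_V[OF p])
  qed
  have P: "(\<Sum>j\<in>w ` A. tp (sw (w i) j) (act w p (\<gamma> \<circ> sw (w i) j)) S)
     = (\<Sum>j\<in>A. tp w (tp (sw i j) (p ((\<gamma> \<circ> w) \<circ> sw i j))) S)"
  proof -
    have "(\<Sum>j\<in>w ` A. F j) = (\<Sum>j\<in>A. F (w j))" for F :: "nat \<Rightarrow> complex"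
      using sum.reindex[OF inj] by (simp add: o_def)
    moreover have "tp (sw (w i) (w j)) (act w p (\<gamma> \<circ> sw (w i) (w j))) S = tp w (tp (sw i j) (p (\<gamma> \<circ> w \<circ> sw i j))) S"
      if "j \<in> A" for j
    proof -
      have "j \<in> {1..N}" using A that by auto
      thus ?thesis using tpw[OF _ lp_V[OF p]] by (simp add: act_def comp_assoc sw_conj[OF bij])
    qed
    ultimately show ?thesis by simp
  qed
  have "Uop i A p (\<gamma> \<circ> w) = (\<lambda>S. (of_int (\<gamma> (w i) + 1) * p (\<gamma> \<circ> w) S
     + (\<Sum>j\<in>{1..N} - {i}. of_real \<kappa> * tp (sw i j) (Mop i j p (\<gamma> \<circ> w)) S))
     + (\<Sum>j\<in>A. (- of_real \<kappa>) * tp (sw i j) (p ((\<gamma> \<circ> w) \<circ> sw i j)) S))"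
    by (simp add: Uop_def sum_distrib_left sum_negf)
  hence "act w (Uop i A p) \<gamma> = (\<lambda>S. (of_int (\<gamma> (w i) + 1) * tp w (p (\<gamma> \<circ> w)) S
     + (\<Sum>j\<in>{1..N} - {i}. of_real \<kappa> * tp w (tp (sw i j) (Mop i j p (\<gamma> \<circ> w))) S))
     + (\<Sum>j\<in>A. (- of_real \<kappa>) * tp w (tp (sw i j) (p ((\<gamma> \<circ> w) \<circ> sw i j))) S))"
    by (simp only: act_def tp_add tp_scale tp_sum)
  thus "act w (Uop i A p) \<gamma> S = Uop (w i) (w ` A) (act w p) \<gamma> S"
    unfolding Uop_def M P by (simp add: act_def sum_distrib_left sum_negf)
qed

lemma Uop_insert:
  assumes "finite A" "k \<notin> A"
  shows "Uop i (insert k A) p \<gamma> S = Uop i A p \<gamma> S - of_real \<kappa> * tp (sw i k) (p (\<gamma> \<circ> sw i k)) S"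
  using assms by (simp add: Uop_def algebra_simps)

lemma act_s_UL:
  assumes p: "lp p" and i: "i \<in> {1..<N}" and k: "k \<in> {1..N}" "k \<noteq> i" "k \<noteq> Suc i"
  shows "UL k (act (sw i (Suc i)) p) = act (sw i (Suc i)) (UL k p)"
proof -
  let ?s = "sw i (Suc i)"
  have s: "?s permutes {1..N}" using i by (intro sw_permutes) auto
  have "?s ` {1..<k} = {1..<k}"
  proof -
    have "?s permutes {1..<k} \<or> (\<forall>x\<in>{1..<k}. ?s x = x)"
    proof (cases "Suc i < k")
      case True
      thus ?thesis using i by (auto intro!: sw_permutes)
    qed (use k in \<open>auto simp: sw_def\<close>)
    thus ?thesis using permutes_image by force
  qed
  moreover have "?s k = k" "{1..<k} \<subseteq> {1..N}" using k by auto
  ultimately show ?thesis using act_Uop[OF s p k(1), of "{1..<k}"] k(1) by (simp add: UL_def)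
qed

lemma act_s_s:
  assumes "lp p" "i \<in> {1..<N}" shows "act (sw i (Suc i)) (act (sw i (Suc i)) p) = p"
proof -
  have "sw i (Suc i) permutes {1..N}" using assms by (intro sw_permutes) auto
  thus ?thesis using assms by (simp add: act_act act_id)
qed

text \<open>The cross relations of the degenerate affine Hecke algebra. After conjugation the set of
  subtracted transpositions differs from the required one by the single simple transposition, and
  applying it to the transformed polynomial returns \<kappa> p.\<close>

lemma UL_act_s:
  assumes p: "lp p" and i: "i \<in> {1..<N}"
  shows "UL i (act (sw i (Suc i)) p) = act (sw i (Suc i)) (UL (Suc i) p) + sc \<kappa> p" (is ?A)
    and "UL (Suc i) (act (sw i (Suc i)) p) = act (sw i (Suc i)) (UL i p) - sc \<kappa> p" (is ?B)
proof -
  let ?s = "sw i (Suc i)"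
  have s: "?s permutes {1..N}" using i by (intro sw_permutes) auto
  have fixl: "?s ` {1..<i} = {1..<i}" by (force simp: sw_def)
  have pp: "tp ?s (act ?s p (\<gamma> \<circ> ?s)) = p \<gamma>" for \<gamma>
    using fun_cong[OF act_s_s[OF p i], of \<gamma>] by (simp add: act_def)
  have "{1..<Suc i} = insert i {1..<i}" using i by auto
  hence im: "?s ` {1..<Suc i} = insert (Suc i) {1..<i}" using fixl by (metis image_insert sw_simps(1))
  have "{1..<Suc i} \<subseteq> {1..N}" "{1..<i} \<subseteq> {1..N}" using i by auto
  note subs = this
  have "act ?s (UL (Suc i) p) = Uop i (insert (Suc i) {1..<i}) (act ?s p)"
    using subs act_Uop[OF s p, of "Suc i" "{1..<Suc i}"] i im by (simp add: UL_def)
  thus ?A by (intro ext) (simp add: Uop_insert UL_def pp)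
  have "act ?s (UL i p) = Uop (Suc i) {1..<i} (act ?s p)"
    using act_Uop[OF s p, of i "{1..<i}"] i fixl subs by (simp add: UL_def)
  moreover have "UL (Suc i) (act ?s p) \<gamma> S = Uop (Suc i) {1..<i} (act ?s p) \<gamma> S - \<kappa> * p \<gamma> S" for \<gamma> S
    unfolding UL_def \<open>{1..<Suc i} = insert i {1..<i}\<close>
    using pp[of \<gamma>] by (subst Uop_insert) (simp_all add: sw_commute[of "Suc i" i])
  ultimately show ?B by (simp add: fun_eq_iff)
qed

section \<open>Multiplication by a variable and the affine step\<close>

lemma supp_ok_upd: "i \<in> {1..N} \<Longrightarrow> supp_ok N (\<beta>(i := c)) \<longleftrightarrow> supp_ok N \<beta>"
  by (auto simp: supp_ok_def)

lemma xmul_supp: "xmul i p \<beta> \<noteq> 0 \<Longrightarrow> \<beta> \<in> (\<lambda>\<beta>. \<beta>(i := \<beta> i + 1)) ` supp p"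
  by (rule image_eqI[of _ _ "\<beta>(i := \<beta> i - 1)"]) (auto simp: xmul_def)

lemma lp_xmul: assumes "lp p" "i \<in> {1..N}" shows "lp (xmul i p)"
proof (rule lpI[of "(\<lambda>\<beta>. \<beta>(i := \<beta> i + 1)) ` supp p"])
  show "supp_ok N \<beta>" if "xmul i p \<beta> \<noteq> 0" for \<beta>
    using lp_supp[OF assms(1)] that supp_ok_upd[OF assms(2)] by (metis xmul_def)
  show "xmul i p \<beta> \<in> V" for \<beta> using lp_V[OF assms(1)] by (simp add: xmul_def)
qed (use assms xmul_supp in \<open>auto simp: lp_finite\<close>)

lemma Mop_xmul:
  assumes p: "lp p"
  shows "Mop i j (xmul k p) \<gamma> S = (\<Sum>\<beta>\<in>supp p. of_int (mker i j (\<beta>(k := \<beta> k + 1)) \<gamma>) * p \<beta> S)"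
proof -
  let ?h = "\<lambda>\<beta>::mi. \<beta>(k := \<beta> k + 1)"
  have inj: "inj ?h" by (rule inj_on_inverseI[of _ "\<lambda>\<beta>. \<beta>(k := \<beta> k - 1)"]) auto
  have "Mop i j (xmul k p) \<gamma> S = (\<Sum>\<beta>\<in>?h ` supp p. of_int (mker i j \<beta> \<gamma>) * xmul k p \<beta> S)"
    using xmul_supp[of k p] lp_finite[OF p] by (subst Mop_sup[of "?h ` supp p"]) auto
  also have "\<dots> = (\<Sum>\<beta>\<in>supp p. of_int (mker i j (?h \<beta>) \<gamma>) * xmul k p (?h \<beta>) S)"
    by (intro sum.reindex[unfolded o_def] inj_on_subset[OF inj]) auto
  finally show ?thesis by (simp add: xmul_def)
qed

lemma mker_upd_other:
  assumes "k \<noteq> i" "k \<noteq> j"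
  shows "mker i j (\<beta>(k := \<beta> k + 1)) \<gamma> = mker i j \<beta> (\<gamma>(k := \<gamma> k - 1))"
proof -
  have "(\<forall>l. l \<noteq> i \<longrightarrow> l \<noteq> j \<longrightarrow> (\<beta>(k := \<beta> k + 1)) l = \<gamma> l) \<longleftrightarrow>
        (\<forall>l. l \<noteq> i \<longrightarrow> l \<noteq> j \<longrightarrow> \<beta> l = (\<gamma>(k := \<gamma> k - 1)) l)"
    using assms by (metis add_diff_cancel diff_add_cancel fun_upd_apply)
  thus ?thesis using assms unfolding mker_def by simp
qed

lemma mker_upd_right:
  assumes "i \<noteq> j"
  shows "mker i j (\<beta>(j := \<beta> j + 1)) \<gamma> = mker i j \<beta> (\<gamma>(j := \<gamma> j - 1))
     - (if \<beta> = \<gamma>(j := \<gamma> j - 1) \<circ> sw i j then 1 else 0)"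
proof -
  have e: "\<beta> = \<gamma>(j := \<gamma> j - 1) \<circ> sw i j \<longleftrightarrow>
      (\<forall>l. l \<noteq> i \<longrightarrow> l \<noteq> j \<longrightarrow> \<beta> l = \<gamma> l) \<and> \<beta> i = \<gamma> j - 1 \<and> \<beta> j = \<gamma> i"
    using assms by (auto simp: fun_eq_iff sw_def)
  have q: "(\<forall>l. l \<noteq> i \<longrightarrow> l \<noteq> j \<longrightarrow> (\<beta>(j := \<beta> j + 1)) l = \<gamma> l) \<longleftrightarrow> (\<forall>l. l \<noteq> i \<longrightarrow> l \<noteq> j \<longrightarrow> \<beta> l = \<gamma> l)"
    "(\<forall>l. l \<noteq> i \<longrightarrow> l \<noteq> j \<longrightarrow> \<beta> l = (\<gamma>(j := \<gamma> j - 1)) l) \<longleftrightarrow> (\<forall>l. l \<noteq> i \<longrightarrow> l \<noteq> j \<longrightarrow> \<beta> l = \<gamma> l)"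
    by auto
  show ?thesis unfolding e mker_def q using assms by (simp only: fun_upd_same fun_upd_other kf_shift(1) not_False_eq_True)
qed

lemma mker_upd_left:
  assumes "i \<noteq> j"
  shows "mker i j (\<beta>(i := \<beta> i + 1)) \<gamma> = mker i j \<beta> (\<gamma>(i := \<gamma> i - 1))
     + (if \<beta> = (\<gamma> \<circ> sw i j)(i := \<gamma> j - 1) then 1 else 0)"
proof -
  have e: "\<beta> = (\<gamma> \<circ> sw i j)(i := \<gamma> j - 1) \<longleftrightarrow>
      (\<forall>l. l \<noteq> i \<longrightarrow> l \<noteq> j \<longrightarrow> \<beta> l = \<gamma> l) \<and> \<beta> i = \<gamma> j - 1 \<and> \<beta> j = \<gamma> i"
    using assms by (auto simp: fun_eq_iff sw_def)
  have q: "(\<forall>l. l \<noteq> i \<longrightarrow> l \<noteq> j \<longrightarrow> (\<beta>(i := \<beta> i + 1)) l = \<gamma> l) \<longleftrightarrow> (\<forall>l. l \<noteq> i \<longrightarrow> l \<noteq> j \<longrightarrow> \<beta> l = \<gamma> l)"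
    "(\<forall>l. l \<noteq> i \<longrightarrow> l \<noteq> j \<longrightarrow> \<beta> l = (\<gamma>(i := \<gamma> i - 1)) l) \<longleftrightarrow> (\<forall>l. l \<noteq> i \<longrightarrow> l \<noteq> j \<longrightarrow> \<beta> l = \<gamma> l)"
    by auto
  show ?thesis unfolding e mker_def q using assms
    by (simp only: fun_upd_same fun_upd_other kf_shift(2) not_False_eq_True assms[symmetric])
qed

lemma sum_supp_delta: "lp p \<Longrightarrow> (\<Sum>\<beta>\<in>supp p. of_int (if \<beta> = \<delta> then 1 else 0) * p \<beta> S) = p \<delta> S"
  using lp_finite[of p] by (auto simp: if_distrib if_distribR sum.delta zero_fun_def cong: if_cong)

lemma Mop_xmul_other: "lp p \<Longrightarrow> k \<noteq> i \<Longrightarrow> k \<noteq> j \<Longrightarrow> Mop i j (xmul k p) \<gamma> = Mop i j p (\<gamma>(k := \<gamma> k - 1))"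
  using mker_upd_other[of k i j _ \<gamma>] by (intro ext, subst Mop_xmul) (auto simp: Mop_def simp del: fun_upd_apply intro!: sum.cong)

lemma Mop_xmul_right:
  assumes "lp p" "i \<noteq> j"
  shows "Mop i j (xmul j p) \<gamma> = (\<lambda>S. Mop i j p (\<gamma>(j := \<gamma> j - 1)) S - p (\<gamma>(j := \<gamma> j - 1) \<circ> sw i j) S)"
proof
  fix S
  have "Mop i j (xmul j p) \<gamma> S = (\<Sum>\<beta>\<in>supp p. of_int (mker i j \<beta> (\<gamma>(j := \<gamma> j - 1))) * p \<beta> S
      - of_int (if \<beta> = \<gamma>(j := \<gamma> j - 1) \<circ> sw i j then 1 else 0) * p \<beta> S)"
    unfolding Mop_xmul[OF assms(1)]
    by (intro sum.cong refl) (simp only: mker_upd_right[OF assms(2), of _ \<gamma>] of_int_diff left_diff_distrib)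
  thus "Mop i j (xmul j p) \<gamma> S = Mop i j p (\<gamma>(j := \<gamma> j - 1)) S - p (\<gamma>(j := \<gamma> j - 1) \<circ> sw i j) S"
    by (simp only: sum_subtractf sum_supp_delta[OF assms(1)] Mop_def)
qed

lemma Mop_xmul_left:
  assumes "lp p" "i \<noteq> j"
  shows "Mop i j (xmul i p) \<gamma> = (\<lambda>S. Mop i j p (\<gamma>(i := \<gamma> i - 1)) S + p ((\<gamma> \<circ> sw i j)(i := \<gamma> j - 1)) S)"
proof
  fix S
  have "Mop i j (xmul i p) \<gamma> S = (\<Sum>\<beta>\<in>supp p. of_int (mker i j \<beta> (\<gamma>(i := \<gamma> i - 1))) * p \<beta> S
      + of_int (if \<beta> = (\<gamma> \<circ> sw i j)(i := \<gamma> j - 1) then 1 else 0) * p \<beta> S)"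
    unfolding Mop_xmul[OF assms(1)]
    by (intro sum.cong refl) (simp only: mker_upd_left[OF assms(2), of _ \<gamma>] of_int_add distrib_right)
  thus "Mop i j (xmul i p) \<gamma> S = Mop i j p (\<gamma>(i := \<gamma> i - 1)) S + p ((\<gamma> \<circ> sw i j)(i := \<gamma> j - 1)) S"
    by (simp only: sum.distrib sum_supp_delta[OF assms(1)] Mop_def)
qed

text \<open>For \<open>i < N\<close> the defect of the divided difference in x_i and x_N is one more
  subtracted transposition, so multiplication by x_N puts \<open>N\<close> into the set
  \<open>A\<close>.\<close>

lemma UL_xmul_N:
  assumes p: "lp p" and i: "i \<in> {1..<N}"
  shows "UL i (xmul N p) = xmul N (Uop i (insert N {1..<i}) p)"
proof (intro ext)
  fix \<gamma> :: mi and S :: tab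
  let ?\<gamma> = "\<gamma>(N := \<gamma> N - 1)"
  have split: "{1..N} - {i} = insert N ({1..<N} - {i})" using i by auto
  have m1: "(\<Sum>j\<in>{1..N} - {i}. tp (sw i j) (Mop i j (xmul N p) \<gamma>) S)
      = (\<Sum>j\<in>{1..N} - {i}. tp (sw i j) (Mop i j p ?\<gamma>) S) - tp (sw i N) (p (?\<gamma> \<circ> sw i N)) S"
    using i unfolding split by (simp add: Mop_xmul_other[OF p] Mop_xmul_right[OF p] tp_diff)
  have m2: "(\<Sum>j\<in>{1..<i}. tp (sw i j) (xmul N p (\<gamma> \<circ> sw i j)) S) = (\<Sum>j\<in>{1..<i}. tp (sw i j) (p (?\<gamma> \<circ> sw i j)) S)"
  proof (intro sum.cong refl)
    fix j assume "j \<in> {1..<i}"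
    hence "(\<gamma> \<circ> sw i j)(N := (\<gamma> \<circ> sw i j) N - 1) = ?\<gamma> \<circ> sw i j" using i by (auto simp: fun_eq_iff sw_def)
    thus "tp (sw i j) (xmul N p (\<gamma> \<circ> sw i j)) S = tp (sw i j) (p (?\<gamma> \<circ> sw i j)) S"
      by (simp only: xmul_def)
  qed
  show "UL i (xmul N p) \<gamma> S = xmul N (Uop i (insert N {1..<i}) p) \<gamma> S"
    unfolding UL_def Uop_def m1 m2 using i by (simp add: xmul_def algebra_simps)
qed

text \<open>Here the defects enter with the opposite sign, one for each \<open>j < N\<close>, and
  cancel all subtracted transpositions. The extra summand comes from differentiating one more factor
  x_N.\<close>

lemma UL_N_xmul_N:
  assumes p: "lp p"
  shows "UL N (xmul N p) = xmul N (Uop N {} p) + xmul N p"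
proof (intro ext)
  fix \<gamma> :: mi and S :: tab
  let ?\<gamma> = "\<gamma>(N := \<gamma> N - 1)"
  have "{1..N} - {N} = {1..<N}" by auto
  moreover have "(\<Sum>j\<in>{1..<N}. tp (sw N j) (Mop N j (xmul N p) \<gamma>) S)
      = (\<Sum>j\<in>{1..<N}. tp (sw N j) (Mop N j p ?\<gamma>) S) + (\<Sum>j\<in>{1..<N}. tp (sw N j) (xmul N p (\<gamma> \<circ> sw N j)) S)"
    by (simp add: Mop_xmul_left[OF p] tp_add sum.distrib) (simp add: xmul_def)
  ultimately show "UL N (xmul N p) \<gamma> S = (xmul N (Uop N {} p) + xmul N p) \<gamma> S"
    by (simp add: UL_def Uop_def xmul_def algebra_simps)
qed

definition cyc :: "nat \<Rightarrow> nat" where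
  "cyc i = (if i \<in> {1..N} then if i = 1 then N else i - 1 else i)"

lemma cyc_permutes: "cyc permutes {1..N}"
proof (rule bij_imp_permutes)
  have "inj_on cyc {1..N}" by (auto simp: cyc_def inj_on_def split: if_splits)
  moreover have "cyc ` {1..N} \<subseteq> {1..N}" by (auto simp: cyc_def)
  ultimately show "bij_betw cyc {1..N} {1..N}"
    by (simp add: bij_betw_def endo_inj_surj)
qed (auto simp: cyc_def)

definition Theta :: "lpoly \<Rightarrow> lpoly" where "Theta p = xmul N (act cyc p)"

lemma lp_Theta: "lp p \<Longrightarrow> lp (Theta p)"
  unfolding Theta_def using N_pos by (intro lp_xmul lp_act cyc_permutes) auto

text \<open>The shift maps 1, ..., \<open>i\<close> to \<open>N\<close>, 1, ...,
  \<open>i - 1\<close>, which is precisely the set that multiplication by x_N creates. Hence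
  \<Theta> moves the index of the operator by one.\<close>

lemma UL_Theta:
  assumes p: "lp p" and i: "i \<in> {1..<N}"
  shows "UL i (Theta p) = Theta (UL (Suc i) p)"
proof -
  have "{1..<Suc i} = insert 1 {2..<Suc i}" using i by auto
  moreover have "cyc ` {2..<Suc i} = {1..<i}"
  proof -
    have "cyc ` {2..<Suc i} = (\<lambda>j. j - 1) ` {2..<Suc i}" using i by (intro image_cong) (auto simp: cyc_def)
    also have "\<dots> = {1..<i}" by (auto simp: image_iff intro!: bexI[of _ "Suc _"])
    finally show ?thesis .
  qed
  moreover have "cyc 1 = N" "cyc (Suc i) = i" using i by (auto simp: cyc_def)
  moreover have "{1..<Suc i} \<subseteq> {1..N}" using i by auto
  ultimately have "act cyc (UL (Suc i) p) = Uop i (insert N {1..<i}) (act cyc p)"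
    using act_Uop[OF cyc_permutes p, of "Suc i" "{1..<Suc i}"] i by (simp add: UL_def)
  thus ?thesis using UL_xmul_N[OF lp_act[OF cyc_permutes p] i] by (simp add: Theta_def)
qed

lemma UL_N_Theta:
  assumes p: "lp p"
  shows "UL N (Theta p) = Theta (UL 1 p) + Theta p"
proof -
  have "cyc 1 = N" using N_pos by (auto simp: cyc_def)
  hence "act cyc (UL 1 p) = Uop N {} (act cyc p)"
    using act_Uop[OF cyc_permutes p, of 1 "{}"] N_pos by (simp add: UL_def)
  thus ?thesis using UL_N_xmul_N[OF lp_act[OF cyc_permutes p]] by (simp add: Theta_def)
qed

lemma Theta_sc: "Theta (sc c p) = sc c (Theta p)"
  by (simp add: Theta_def act_sc) (simp add: xmul_def sc_def)

section \<open>Shifting all exponents, comparison with the polynomial operators\<close>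

definition upm :: "int \<Rightarrow> mi \<Rightarrow> mi" where
  "upm m \<beta> = (\<lambda>k. if k \<in> {1..N} then \<beta> k + m else \<beta> k)"

lemma upm_upm [simp]: "upm m (upm n \<beta>) = upm (m + n) \<beta>" "upm 0 \<beta> = \<beta>"
  by (auto simp: upm_def)

lemma supp_ok_upm [simp]: "supp_ok N (upm m \<beta>) \<longleftrightarrow> supp_ok N \<beta>"
  by (auto simp: supp_ok_def upm_def)

lemma shiftm_upm: "shiftm N m p = (\<lambda>\<beta>. p (upm m \<beta>))"
  by (simp add: shiftm_def upm_def)

lemma upm_comp: "w permutes {1..N} \<Longrightarrow> upm m (\<gamma> \<circ> w) = upm m \<gamma> \<circ> w"
  using permutes_in_image[of w "{1..N}"] by (auto simp: upm_def fun_eq_iff)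

lemma lp_shiftm: assumes "lp p" shows "lp (shiftm N m p)"
proof (rule lpI[of "upm (-m) ` supp p"])
  show "shiftm N m p \<beta> \<noteq> 0 \<Longrightarrow> \<beta> \<in> upm (- m) ` supp p" for \<beta>
    by (rule image_eqI[of _ _ "upm m \<beta>"]) (auto simp: shiftm_upm)
  show "shiftm N m p \<beta> \<noteq> 0 \<Longrightarrow> supp_ok N \<beta>" for \<beta>
    using lp_supp[OF assms, of "upm m \<beta>"] by (simp add: shiftm_upm)
qed (use assms in \<open>auto simp: shiftm_upm lp_V lp_finite\<close>)

lemma mker_upm:
  assumes "i \<in> {1..N}" "j \<in> {1..N}" "supp_ok N \<beta>"
  shows "mker i j (upm m \<beta>) (upm m \<gamma>) = mker i j \<beta> \<gamma>"
proof -
  have "upm m \<beta> k = upm m \<gamma> k \<longleftrightarrow> \<beta> k = \<gamma> k" for k by (simp add: upm_def)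
  thus ?thesis using assms(1,2) unfolding mker_def by (simp add: upm_def kf_shift)
qed

lemma Mop_shiftm:
  assumes p: "lp p" and ij: "i \<in> {1..N}" "j \<in> {1..N}"
  shows "Mop i j (shiftm N m p) \<gamma> = Mop i j p (upm m \<gamma>)"
proof
  fix S
  have inj: "inj (upm (-m))" by (rule inj_on_inverseI[of _ "upm m"]) auto
  have sub: "supp (shiftm N m p) \<subseteq> upm (-m) ` supp p"
    by (auto simp: shiftm_upm intro!: image_eqI[of _ _ "upm m _"])
  have "Mop i j (shiftm N m p) \<gamma> S = (\<Sum>\<beta>\<in>upm (-m) ` supp p. of_int (mker i j \<beta> \<gamma>) * shiftm N m p \<beta> S)"
    using sub lp_finite[OF p] by (subst Mop_sup[of "upm (-m) ` supp p"]) auto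
  also have "\<dots> = (\<Sum>\<beta>\<in>supp p. of_int (mker i j (upm (-m) \<beta>) \<gamma>) * shiftm N m p (upm (-m) \<beta>) S)"
    by (intro sum.reindex[unfolded o_def] inj_on_subset[OF inj]) auto
  also have "\<dots> = Mop i j p (upm m \<gamma>) S"
    unfolding Mop_def using mker_upm[OF ij, of _ "-m" "upm m \<gamma>"] lp_supp[OF p]
    by (intro sum.cong) (auto simp: shiftm_upm)
  finally show "Mop i j (shiftm N m p) \<gamma> S = Mop i j p (upm m \<gamma>) S" .
qed

text \<open>\<open>shiftm N m\<close> divides by the \<open>m\<close>-th power of x_1 ... x_N. This
  factor is symmetric, so only the derivative notices it.\<close>

lemma UL_shiftm:
  assumes p: "lp p" and i: "i \<in> {1..N}"
  shows "UL i (shiftm N m p) = shiftm N m (UL i p) - sc (of_int m) (shiftm N m p)"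
proof (intro ext)
  fix \<gamma> :: mi and S :: tab
  have "p (upm m (\<gamma> \<circ> sw i j)) = p (upm m \<gamma> \<circ> sw i j)" if "j \<in> {1..<i}" for j
    using that i by (subst upm_comp[OF sw_permutes]) auto
  moreover have "upm m \<gamma> i = \<gamma> i + m" using i by (simp add: upm_def)
  ultimately show "UL i (shiftm N m p) \<gamma> S = (shiftm N m (UL i p) - sc (of_int m) (shiftm N m p)) \<gamma> S"
    using i by (simp add: UL_def Uop_def Mop_shiftm[OF p]) (simp add: shiftm_upm algebra_simps)
qed

text \<open>For polynomials the sums in \<^term>\<open>ddiff\<close> run over \<open>a = \<gamma> i + \<gamma> j - b\<close> (first term) and \<open>a = b - 1\<close>
  (second term), where \<open>(a, \<gamma> i + \<gamma> j - a)\<close> are the exponents at \<open>i, j\<close> of the contributing monomial.\<close>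
lemma ddiff_xmul:
  assumes p: "is_poly N \<tau> p" and ij: "i \<noteq> j"
  shows "ddiff i j (xmul i p) \<gamma> = Mop i j p \<gamma>"
proof
  fix S
  have lp: "lp p" and nn: "p \<beta> \<noteq> 0 \<Longrightarrow> 0 \<le> \<beta> k" for \<beta> k using p by (auto simp: is_poly_def)
  define s where "s = \<gamma> i + \<gamma> j"
  define g where "g a = \<gamma>(i := a, j := s - a)" for a
  have inj: "inj g" by (rule injI) (metis g_def fun_upd_same fun_upd_twist ij)
  have gk: "g a i = a" "g a j = s - a" for a using ij by (auto simp: g_def)
  have mk: "mker i j \<beta> \<gamma> \<noteq> 0 \<Longrightarrow> \<beta> = g (\<beta> i)" for \<beta>
    using ij by (auto simp: mker_def kf_def g_def s_def fun_eq_iff split: if_splits)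
  have mg: "mker i j (g a) \<gamma> = (if s - a \<le> \<gamma> i \<and> \<gamma> i \<le> a then 1 else if a < \<gamma> i \<and> \<gamma> i < s - a then -1 else 0)" for a
    unfolding mker_def gk kf_def by (auto simp: g_def s_def)
  have big: "Mop i j p \<gamma> S = (\<Sum>a\<in>A. of_int (mker i j (g a) \<gamma>) * p (g a) S)"
    if "finite A" and cov: "\<And>a. mker i j (g a) \<gamma> \<noteq> 0 \<Longrightarrow> p (g a) \<noteq> 0 \<Longrightarrow> a \<in> A" for A
  proof -
    have "Mop i j p \<gamma> S = (\<Sum>\<beta>\<in>supp p \<union> g ` A. of_int (mker i j \<beta> \<gamma>) * p \<beta> S)"
      using lp_finite[OF lp] that by (subst Mop_sup[of "supp p \<union> g ` A"]) auto
    also have "\<dots> = (\<Sum>\<beta>\<in>g ` A. of_int (mker i j \<beta> \<gamma>) * p \<beta> S)"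
    proof (intro sum.mono_neutral_right ballI)
      fix \<beta> assume b: "\<beta> \<in> supp p \<union> g ` A - g ` A"
      hence "p \<beta> \<noteq> 0" by auto
      show "of_int (mker i j \<beta> \<gamma>) * p \<beta> S = 0"
      proof (cases "mker i j \<beta> \<gamma> = 0")
        case False
        hence "\<beta> \<in> g ` A" using mk[OF False] cov[of "\<beta> i"] \<open>p \<beta> \<noteq> 0\<close> by (metis imageI)
        thus ?thesis using b by auto
      qed simp
    qed (use lp_finite[OF lp] that in auto)
    also have "\<dots> = (\<Sum>a\<in>A. of_int (mker i j (g a) \<gamma>) * p (g a) S)"
      by (intro sum.reindex[unfolded o_def] inj_on_subset[OF inj]) auto
    finally show ?thesis .
  qed
  show "ddiff i j (xmul i p) \<gamma> S = Mop i j p \<gamma> S"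
  proof (cases "0 \<le> \<gamma> i \<and> 0 \<le> \<gamma> j")
    case False
    have "Mop i j p \<gamma> S = (\<Sum>a\<in>{}. of_int (mker i j (g a) \<gamma>) * p (g a) S)"
    proof (rule big)
      fix a assume "mker i j (g a) \<gamma> \<noteq> 0" "p (g a) \<noteq> 0"
      thus "a \<in> {}" using nn[of "g a" i] nn[of "g a" j] False gk mg[of a]
        by (auto split: if_splits simp: s_def)
    qed simp
    thus ?thesis using False by (auto simp: ddiff_def)
  next
    case True
    let ?m = "min (\<gamma> i) (\<gamma> j)"
    have g1: "xmul i p (\<gamma>(i := \<gamma> i + \<gamma> j + 1 - b, j := b)) = p (g (s - b))" for b
      using ij by (simp add: xmul_def g_def s_def fun_upd_twist algebra_simps)
    have g2: "xmul i p (\<gamma>(i := b, j := \<gamma> i + \<gamma> j + 1 - b)) = p (g (b - 1))" for b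
    proof -
      have "(\<gamma>(i := b, j := \<gamma> i + \<gamma> j + 1 - b))(i := b - 1) = g (b - 1)"
        using ij by (auto simp: g_def s_def)
      thus ?thesis using ij by (simp add: xmul_def)
    qed
    have p1: "(\<Sum>b\<in>{0..?m}. p (g (s - b)) S) = (\<Sum>a\<in>{s - ?m..s}. p (g a) S)"
      by (rule sum.reindex_bij_witness[of _ "\<lambda>a. s - a" "\<lambda>b. s - b"]) auto
    \<comment> \<open>The term \<open>b = 0\<close> yields \<open>a = -1\<close>, which no monomial
      of \<open>p\<close> has; keeping it in the range lets the two sums match term by term.\<close>
    have p2: "(\<Sum>b\<in>{0..?m}. p (g (b - 1)) S) = (\<Sum>a\<in>{-1..?m - 1}. p (g a) S)"
      by (rule sum.reindex_bij_witness[of _ "\<lambda>a. a + 1" "\<lambda>b. b - 1"]) auto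
    have dis: "{s - ?m..s} \<inter> {-1..?m - 1} = {}" by (auto simp: s_def)
    have "Mop i j p \<gamma> S = (\<Sum>a\<in>{s - ?m..s} \<union> {-1..?m - 1}. of_int (mker i j (g a) \<gamma>) * p (g a) S)"
    proof (rule big)
      fix a assume "mker i j (g a) \<gamma> \<noteq> 0" "p (g a) \<noteq> 0"
      thus "a \<in> {s - ?m..s} \<union> {-1..?m - 1}" using nn[of "g a" i] nn[of "g a" j] gk mg[of a]
        by (auto split: if_splits simp: s_def)
    qed simp
    also have "\<dots> = (\<Sum>a\<in>{s - ?m..s}. p (g a) S) + (\<Sum>a\<in>{-1..?m - 1}. - p (g a) S)"
      using dis
      by (subst sum.union_disjoint) (auto simp: mg s_def intro!: arg_cong2[of _ _ _ _ "(+)"] sum.cong)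
    finally show ?thesis using True by (simp add: ddiff_def g1 g2 sum_subtractf p1 p2 sum_negf)
  qed
qed

lemma cherednik_eq_UL:
  assumes p: "is_poly N \<tau> p"
  shows "cherednik N \<tau> \<kappa> i p = UL i p"
proof (intro ext)
  fix \<gamma> :: mi and S :: tab
  have "pder i (xmul i p) \<gamma> S = of_int (\<gamma> i + 1) * p \<gamma> S"
    by (simp add: pder_def xmul_def)
  moreover have "(\<Sum>j\<in>{1..N} - {i}. tau_tr N \<tau> i j (ddiff i j (xmul i p) \<gamma>) S)
      = (\<Sum>j\<in>{1..N} - {i}. tp (sw i j) (Mop i j p \<gamma>) S)"
    by (intro sum.cong refl) (auto simp: tau_tr_def ddiff_xmul[OF p])
  ultimately show "cherednik N \<tau> \<kappa> i p \<gamma> S = UL i p \<gamma> S"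
    by (simp add: cherednik_def dunkl_def UL_def Uop_def swv_def tau_tr_def)
qed

end

section \<open>Dominance order and triangularity\<close>

text \<open>The total preorder whose initial segments \<open>rank\<close> counts: larger exponents
  come first, ties go to the smaller position. Any map of positions respecting it transports
  ranks.\<close>

definition before :: "mi \<Rightarrow> nat \<Rightarrow> nat \<Rightarrow> bool" where
  "before \<alpha> j i \<longleftrightarrow> \<alpha> i < \<alpha> j \<or> \<alpha> j = \<alpha> i \<and> j \<le> i"

lemma rank_card:
  assumes "i \<in> {1..N}"
  shows "rank N \<alpha> i = card {j\<in>{1..N}. before \<alpha> j i}"
proof -
  have "{j\<in>{1..N}. before \<alpha> j i} = {j\<in>{1..N}. \<alpha> j > \<alpha> i} \<union> {j\<in>{1..i}. \<alpha> j = \<alpha> i}"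
    using assms by (auto simp: before_def)
  moreover have "{j\<in>{1..N}. \<alpha> j > \<alpha> i} \<inter> {j\<in>{1..i}. \<alpha> j = \<alpha> i} = {}" by auto
  ultimately show ?thesis by (simp add: rank_def card_Un_disjoint)
qed

lemma rank_less:
  assumes "i \<in> {1..N}" "j \<in> {1..N}" "before \<alpha> i j" "i \<noteq> j"
  shows "rank N \<alpha> i < rank N \<alpha> j"
proof -
  have "{k\<in>{1..N}. before \<alpha> k i} \<subset> {k\<in>{1..N}. before \<alpha> k j}"
  proof
    show "{k\<in>{1..N}. before \<alpha> k i} \<subseteq> {k\<in>{1..N}. before \<alpha> k j}"
      using assms(3) by (auto simp: before_def)
    have "j \<in> {k\<in>{1..N}. before \<alpha> k j}" "j \<notin> {k\<in>{1..N}. before \<alpha> k i}"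
      using assms by (auto simp: before_def)
    thus "{k\<in>{1..N}. before \<alpha> k i} \<noteq> {k\<in>{1..N}. before \<alpha> k j}" by blast
  qed
  thus ?thesis using assms by (simp add: rank_card psubset_card_mono)
qed

lemma before_total: "before \<alpha> i j \<or> before \<alpha> j i"
  by (auto simp: before_def)

lemma rank_less_iff:
  assumes "i \<in> {1..N}" "j \<in> {1..N}"
  shows "rank N \<alpha> i < rank N \<alpha> j \<longleftrightarrow> before \<alpha> i j \<and> i \<noteq> j"
  using rank_less[of i N j \<alpha>] rank_less[of j N i \<alpha>] assms before_total[of \<alpha> i j] by fastforce

lemma rank_bij: "bij_betw (rank N \<alpha>) {1..N} {1..N}"
proof -
  have "inj_on (rank N \<alpha>) {1..N}"
    using rank_less_iff[of _ N _ \<alpha>] before_total[of \<alpha>] by (intro inj_onI) (metis less_irrefl)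
  moreover have "rank N \<alpha> ` {1..N} \<subseteq> {1..N}"
  proof
    fix r assume "r \<in> rank N \<alpha> ` {1..N}"
    then obtain i where i: "i \<in> {1..N}" "r = rank N \<alpha> i" by auto
    have "card {j\<in>{1..N}. before \<alpha> j i} \<le> card {1..N}" by (intro card_mono) auto
    moreover have "0 < card {j\<in>{1..N}. before \<alpha> j i}"
      using i by (auto simp: card_gt_0_iff before_def)
    ultimately show "r \<in> {1..N}" using i by (simp add: rank_card)
  qed
  ultimately show ?thesis by (simp add: bij_betw_def endo_inj_surj)
qed

lemma rank_in: "i \<in> {1..N} \<Longrightarrow> rank N \<alpha> i \<in> {1..N}"
  using rank_bij bij_betwE by blast

lemma rank_inv_rank: "i \<in> {1..N} \<Longrightarrow> rank_inv N \<alpha> (rank N \<alpha> i) = i"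
  using rank_in[of i N \<alpha>] rank_bij[of N \<alpha>] by (simp add: rank_inv_def bij_betw_def)

lemma rank_rank_inv: "k \<in> {1..N} \<Longrightarrow> rank N \<alpha> (rank_inv N \<alpha> k) = k"
  using rank_bij[of N \<alpha>] f_inv_into_f[of k "rank N \<alpha>" "{1..N}"] by (simp add: rank_inv_def bij_betw_def)

lemma rank_inv_permutes: "rank_inv N \<alpha> permutes {1..N}"
proof (rule bij_imp_permutes)
  have "bij_betw (inv_into {1..N} (rank N \<alpha>)) {1..N} {1..N}"
    by (rule bij_betw_inv_into[OF rank_bij])
  thus "bij_betw (rank_inv N \<alpha>) {1..N} {1..N}"
    by (rule bij_betw_cong[THEN iffD1, rotated]) (auto simp: rank_inv_def)
qed (auto simp: rank_inv_def)

lemma rank_inv_in: "k \<in> {1..N} \<Longrightarrow> rank_inv N \<alpha> k \<in> {1..N}"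
  using permutes_in_image[OF rank_inv_permutes] by blast

text \<open>The rank function continued by the identity outside \<open>{1..N}\<close>, as the
  representation expects a permutation of all of \<open>nat\<close>.\<close>

definition rk :: "nat \<Rightarrow> mi \<Rightarrow> nat \<Rightarrow> nat" where "rk N \<alpha> = inv (rank_inv N \<alpha>)"

lemma rk_permutes: "rk N \<alpha> permutes {1..N}"
  unfolding rk_def by (intro permutes_inv rank_inv_permutes)

lemma rk_eq: "i \<in> {1..N} \<Longrightarrow> rk N \<alpha> i = rank N \<alpha> i"
  unfolding rk_def using rank_inv_rank permutes_inj[OF rank_inv_permutes] by (metis inv_f_eq)

lemma rank_transfer:
  assumes w: "w permutes {1..N}" and b: "\<And>i j. i \<in> {1..N} \<Longrightarrow> j \<in> {1..N} \<Longrightarrow> before \<alpha>' (w j) (w i) \<longleftrightarrow> before \<alpha> j i"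
    and i: "i \<in> {1..N}"
  shows "rank N \<alpha>' (w i) = rank N \<alpha> i"
proof -
  have wi: "w i \<in> {1..N}" using permutes_in_image[OF w] i by simp
  have "{j\<in>{1..N}. before \<alpha>' j (w i)} = w ` {j\<in>{1..N}. before \<alpha> j i}"
  proof (intro set_eqI iffI)
    fix j assume j: "j \<in> {j\<in>{1..N}. before \<alpha>' j (w i)}"
    then obtain j' where "j' \<in> {1..N}" "j = w j'" using permutes_image[OF w] by (metis (no_types, lifting) imageE mem_Collect_eq)
    thus "j \<in> w ` {j\<in>{1..N}. before \<alpha> j i}" using b[OF i] j by auto
  next
    fix j assume "j \<in> w ` {j\<in>{1..N}. before \<alpha> j i}"
    thus "j \<in> {j\<in>{1..N}. before \<alpha>' j (w i)}" using b[OF i] permutes_in_image[OF w] by auto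
  qed
  thus ?thesis by (simp only: rank_card[OF i] rank_card[OF wi] card_image[OF permutes_inj_on[OF w]])
qed

lemma rank_inv_transfer:
  assumes w: "w permutes {1..N}" and b: "\<And>i j. i \<in> {1..N} \<Longrightarrow> j \<in> {1..N} \<Longrightarrow> before \<alpha>' (w j) (w i) \<longleftrightarrow> before \<alpha> j i"
  shows "rank_inv N \<alpha>' = w \<circ> rank_inv N \<alpha>"
proof
  fix k
  show "rank_inv N \<alpha>' k = (w \<circ> rank_inv N \<alpha>) k"
  proof (cases "k \<in> {1..N}")
    case True
    have "rank N \<alpha>' (w (rank_inv N \<alpha> k)) = k"
      using rank_transfer[OF w b rank_inv_in[OF True]] rank_rank_inv[OF True] by simp
    thus ?thesis using rank_inv_rank[of "w (rank_inv N \<alpha> k)" N \<alpha>'] permutes_in_image[OF w] rank_inv_in[OF True]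
      by (metis comp_apply)
  next
    case False
    thus ?thesis using permutes_not_in[OF rank_inv_permutes False] permutes_not_in[OF w False]
      by (simp add: rank_inv_def)
  qed
qed

section \<open>Nonincreasing rearrangements and their partial sums\<close>

definition nonincr :: "nat \<Rightarrow> mi \<Rightarrow> bool" where
  "nonincr N f \<longleftrightarrow> (\<forall>i j. 1 \<le> i \<longrightarrow> i \<le> j \<longrightarrow> j \<le> N \<longrightarrow> f j \<le> f i)"

lemma nonincr_rank_inv: "nonincr N (\<alpha> \<circ> rank_inv N \<alpha>)"
  unfolding nonincr_def
proof (intro allI impI)
  fix i j assume ij: "1 \<le> i" "i \<le> j" "j \<le> N"
  hence "i \<in> {1..N}" "j \<in> {1..N}" by auto
  note m = rank_inv_in[OF this(1), of \<alpha>] rank_inv_in[OF this(2), of \<alpha>]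
    rank_rank_inv[OF this(1), of \<alpha>] rank_rank_inv[OF this(2), of \<alpha>]
  have "\<not> rank N \<alpha> (rank_inv N \<alpha> j) < rank N \<alpha> (rank_inv N \<alpha> i)" using m ij by simp
  thus "(\<alpha> \<circ> rank_inv N \<alpha>) j \<le> (\<alpha> \<circ> rank_inv N \<alpha>) i"
    unfolding rank_less_iff[OF m(2,1)] by (auto simp: before_def)
qed

text \<open>If \<open>f k < g k\<close>, then at least \<open>k\<close> values of \<open>g\<close>
  reach the level \<open>g k\<close>, but at most \<open>k - 1\<close> values of \<open>f\<close>
  do, although both take the same values equally often.\<close>

lemma nonincr_perm_le:
  assumes f: "nonincr N f" and g: "nonincr N g" and u: "u permutes {1..N}" "g = f \<circ> u" and k: "k \<in> {1..N}"
  shows "g k \<le> f k"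
proof (rule ccontr)
  assume lt: "\<not> g k \<le> f k"
  have "{j\<in>{1..N}. g k \<le> f j} = u ` {j\<in>{1..N}. g k \<le> g j}"
  proof (intro set_eqI iffI)
    fix j assume j: "j \<in> {j\<in>{1..N}. g k \<le> f j}"
    then obtain j' where "j' \<in> {1..N}" "j = u j'" using permutes_image[OF u(1)] by (metis (no_types, lifting) imageE mem_Collect_eq)
    thus "j \<in> u ` {j\<in>{1..N}. g k \<le> g j}" using j u(2) by auto
  qed (use permutes_in_image[OF u(1)] u(2) in auto)
  hence "card {j\<in>{1..N}. g k \<le> f j} = card {j\<in>{1..N}. g k \<le> g j}"
    by (simp only: card_image[OF permutes_inj_on[OF u(1)]])
  moreover have "card {1..k} \<le> card {j\<in>{1..N}. g k \<le> g j}"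
    using g k by (intro card_mono) (auto simp: nonincr_def)
  moreover have "card {j\<in>{1..N}. g k \<le> f j} \<le> card {1..<k}"
  proof (intro card_mono subsetI)
    fix j assume j: "j \<in> {j\<in>{1..N}. g k \<le> f j}"
    have "\<not> k \<le> j" using f k j lt by (force simp: nonincr_def)
    thus "j \<in> {1..<k}" using j by auto
  qed simp
  ultimately have "k \<le> k - 1" by simp
  thus False using k by auto
qed

lemma nonincr_perm_eq:
  assumes f: "nonincr N f" and g: "nonincr N g" and u: "u permutes {1..N}" "g = f \<circ> u"
  shows "f = g"
proof
  fix k
  have "f = g \<circ> inv u" using u by (simp add: comp_assoc permutes_inv_o)
  thus "f k = g k"
    using nonincr_perm_le[OF f g u, of k] nonincr_perm_le[OF g f permutes_inv[OF u(1)], of k]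
      permutes_not_in[OF u(1), of k] fun_cong[OF u(2), of k] by (cases "k \<in> {1..N}") (auto intro: antisym)
qed

lemma mplus_unique:
  assumes "w permutes {1..N}" "nonincr N (\<alpha> \<circ> w)"
  shows "mplus N \<alpha> = \<alpha> \<circ> w"
  unfolding mplus_def nonincr_def[symmetric]
proof (rule the_equality)
  fix lam assume "(\<exists>w. w permutes {1..N} \<and> lam = \<alpha> \<circ> w) \<and> nonincr N lam"
  then obtain u where u: "u permutes {1..N}" "lam = \<alpha> \<circ> u" "nonincr N lam" by blast
  have "lam = (\<alpha> \<circ> w) \<circ> (inv w \<circ> u)"
    using u permutes_inv_o(1)[OF assms(1)] by (metis comp_assoc comp_id)
  thus "lam = \<alpha> \<circ> w"
    using nonincr_perm_eq[OF assms(2) u(3)] permutes_compose[OF u(1) permutes_inv[OF assms(1)]] by metis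
qed (use assms in blast)

lemma mplus_eq: "mplus N \<alpha> = \<alpha> \<circ> rank_inv N \<alpha>"
  by (intro mplus_unique rank_inv_permutes nonincr_rank_inv)

lemma mplus_comp:
  assumes "w permutes {1..N}" shows "mplus N (\<alpha> \<circ> w) = mplus N \<alpha>"
proof -
  have "\<alpha> \<circ> rank_inv N \<alpha> = (\<alpha> \<circ> w) \<circ> (inv w \<circ> rank_inv N \<alpha>)"
    using permutes_inv_o(1)[OF assms] by (metis comp_assoc comp_id)
  thus ?thesis unfolding mplus_eq[of N \<alpha>]
    using nonincr_rank_inv[of N \<alpha>]
    by (metis assms mplus_unique permutes_compose permutes_inv rank_inv_permutes)
qed

lemma nonincr_sum_le:
  assumes f: "nonincr N f" and K: "K \<subseteq> {1..N}" "card K = m"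
  shows "sum f K \<le> sum f {1..m}"
proof (cases "m = 0")
  case True
  thus ?thesis using K finite_subset[OF K(1)] by simp
next
  case False
  have fin: "finite K" using K finite_subset by blast
  have m: "m \<le> N" using card_mono[OF _ K(1)] K by simp
  have "card (K - {1..m}) = card ({1..m} - K)"
    using card_Diff_subset_Int[of K "{1..m}"] card_Diff_subset_Int[of "{1..m}" K] K fin
    by (simp add: Int_commute)
  moreover have "sum f (K - {1..m}) \<le> of_nat (card (K - {1..m})) * f m"
    using f K False by (intro sum_bounded_above) (auto simp: nonincr_def)
  moreover have "of_nat (card ({1..m} - K)) * f m \<le> sum f ({1..m} - K)"
    using f False m by (intro sum_bounded_below) (auto simp: nonincr_def)
  moreover have "sum f K = sum f (K \<inter> {1..m}) + sum f (K - {1..m})"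
    "sum f {1..m} = sum f ({1..m} \<inter> K) + sum f ({1..m} - K)"
    using fin by (simp_all add: sum.Int_Diff[symmetric])
  ultimately show ?thesis by (simp add: Int_commute)
qed

text \<open>Together with \<open>mplus_sum_attained\<close>: a partial sum of the rearrangement is a
  maximum over subsets of that size. Dominance can thus be checked on subsets, without
  sorting.\<close>

lemma mplus_sum_ge:
  assumes "K \<subseteq> {1..N}" "card K = m"
  shows "sum \<alpha> K \<le> sum (mplus N \<alpha>) {1..m}"
proof -
  have "K = rank_inv N \<alpha> ` (rk N \<alpha> ` K)"
    using permutes_inv_o(1)[OF rank_inv_permutes[of N \<alpha>]] unfolding rk_def image_comp by simp
  hence "sum \<alpha> K = sum (mplus N \<alpha>) (rk N \<alpha> ` K)"
    unfolding mplus_eq by (metis sum.reindex permutes_inj_on rank_inv_permutes)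
  moreover have "rk N \<alpha> ` K \<subseteq> {1..N}" "card (rk N \<alpha> ` K) = m"
    using assms permutes_image[OF rk_permutes] by (blast, simp add: card_image permutes_inj_on[OF rk_permutes])
  ultimately show ?thesis
    using nonincr_sum_le[of N "mplus N \<alpha>"] nonincr_rank_inv[of N \<alpha>] by (simp add: mplus_eq)
qed

lemma mplus_sum_attained:
  assumes "m \<le> N"
  obtains K where "K \<subseteq> {1..N}" "card K = m" "sum (mplus N \<alpha>) {1..m} = sum \<alpha> K"
proof (rule that)
  show "rank_inv N \<alpha> ` {1..m} \<subseteq> {1..N}"
    using assms rank_inv_in[of _ N \<alpha>] by auto
  show "card (rank_inv N \<alpha> ` {1..m}) = m"
    by (simp add: card_image permutes_inj_on[OF rank_inv_permutes])
  show "sum (mplus N \<alpha>) {1..m} = sum \<alpha> (rank_inv N \<alpha> ` {1..m})"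
    by (simp add: mplus_eq sum.reindex permutes_inj_on[OF rank_inv_permutes])
qed

lemma sum_mplus: fixes g :: "int \<Rightarrow> int" shows "(\<Sum>k\<in>{1..N}. g (mplus N \<alpha> k)) = (\<Sum>k\<in>{1..N}. g (\<alpha> k))"
  unfolding mplus_eq using sum.permute[OF rank_inv_permutes[of N \<alpha>], of "\<lambda>k. g (\<alpha> k)"] by (simp add: o_def)

lemma msum_comp: "w permutes {1..N} \<Longrightarrow> msum N (\<beta> \<circ> w) = msum N \<beta>"
  unfolding msum_def by (rule sum.permute[symmetric])

section \<open>The triangular order on exponents\<close>

lemma sum_two:
  fixes f :: "nat \<Rightarrow> int"
  assumes "i \<in> A" "j \<in> A" "i \<noteq> j" "finite A"
  shows "sum f A = f i + f j + sum f (A - {i, j})"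
  using assms by (simp add: sum.remove[of A i] sum.remove[of "A - {i}" j] Diff_insert2[symmetric] insert_commute)

text \<open>Moving two entries strictly closer at constant sum lowers the rearrangement. It changes
  because the sum of squares does; its partial sums do not increase because a subset containing just
  one of the two positions may exchange it for the other.\<close>

lemma tri_lt_line:
  assumes ij: "i \<in> {1..N}" "j \<in> {1..N}" "i \<noteq> j"
    and eq: "\<And>k. k \<noteq> i \<Longrightarrow> k \<noteq> j \<Longrightarrow> \<gamma> k = \<beta> k" and s: "\<gamma> i + \<gamma> j = \<beta> i + \<beta> j"
    and lt: "min (\<beta> i) (\<beta> j) < \<gamma> i" "\<gamma> i < max (\<beta> i) (\<beta> j)"
  shows "tri_lt N \<gamma> \<beta>"
proof -
  have rest: "sum \<gamma> (A - {i, j}) = sum \<beta> (A - {i, j})" for A by (intro sum.cong) (auto simp: eq)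
  have "msum N \<gamma> = msum N \<beta>"
    unfolding msum_def using ij s by (simp add: sum_two[of i _ j] rest)
  moreover have "mplus N \<gamma> \<noteq> mplus N \<beta>"
  proof
    assume "mplus N \<gamma> = mplus N \<beta>"
    hence "(\<Sum>k\<in>{1..N}. (\<gamma> k)\<^sup>2) = (\<Sum>k\<in>{1..N}. (\<beta> k)\<^sup>2)"
      using sum_mplus[of "\<lambda>x. x\<^sup>2" N \<gamma>] sum_mplus[of "\<lambda>x. x\<^sup>2" N \<beta>] by simp
    moreover have "(\<Sum>k\<in>{1..N} - {i, j}. (\<gamma> k)\<^sup>2) = (\<Sum>k\<in>{1..N} - {i, j}. (\<beta> k)\<^sup>2)"
      by (intro sum.cong) (auto simp: eq)
    ultimately have "(\<gamma> i)\<^sup>2 + (\<gamma> j)\<^sup>2 = (\<beta> i)\<^sup>2 + (\<beta> j)\<^sup>2"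
      using sum_two[OF ij, of "\<lambda>k. (\<gamma> k)\<^sup>2"] sum_two[OF ij, of "\<lambda>k. (\<beta> k)\<^sup>2"] by simp
    moreover have "\<gamma> j = \<beta> i + \<beta> j - \<gamma> i" using s by simp
    ultimately have "(\<beta> i - \<gamma> i) * (\<gamma> i - \<beta> j) = 0" by algebra
    thus False using lt by auto
  qed
  moreover have "sum (mplus N \<gamma>) {1..m} \<le> sum (mplus N \<beta>) {1..m}" if "m \<in> {1..N}" for m
  proof -
    obtain K where K: "K \<subseteq> {1..N}" "card K = m" "sum (mplus N \<gamma>) {1..m} = sum \<gamma> K"
      using mplus_sum_attained[of m N \<gamma>] \<open>m \<in> {1..N}\<close> by auto
    have fin: "finite K" using K finite_subset by blast
    have one: "\<exists>K'\<subseteq>{1..N}. card K' = m \<and> sum \<gamma> K \<le> sum \<beta> K'"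
      if x: "x \<in> K" "y \<notin> K" "{x, y} = {i, j}" for x y
    proof (cases "\<gamma> x \<le> \<beta> x")
      case True
      have "sum \<gamma> K \<le> sum \<beta> K"
      proof (rule sum_mono)
        fix k assume "k \<in> K"
        hence "k = x \<or> k \<noteq> i \<and> k \<noteq> j" using x by (auto simp: doubleton_eq_iff)
        thus "\<gamma> k \<le> \<beta> k" using True eq[of k] by auto
      qed
      thus ?thesis using K by blast
    next
      case False
      have le: "\<gamma> x \<le> \<beta> y" using False lt s x by (auto simp: doubleton_eq_iff)
      let ?K = "insert y (K - {x})"
      have "card ?K = m" using x K fin card_Suc_Diff1[OF fin x(1)] by simp
      moreover have "sum \<gamma> K \<le> sum \<beta> ?K"
      proof -
        have "sum \<gamma> K = \<gamma> x + sum \<gamma> (K - {x})" using x fin by (simp add: sum.remove)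
        also have "sum \<gamma> (K - {x}) = sum \<beta> (K - {x})"
          using x by (intro sum.cong refl eq) (auto simp: doubleton_eq_iff)
        finally show ?thesis using le x fin by simp
      qed
      moreover have "?K \<subseteq> {1..N}" using K x ij by (auto simp: doubleton_eq_iff)
      ultimately show ?thesis by blast
    qed
    have "\<exists>K'\<subseteq>{1..N}. card K' = m \<and> sum \<gamma> K \<le> sum \<beta> K'"
    proof (cases "i \<in> K")
      case i: True
      show ?thesis
      proof (cases "j \<in> K")
        case True
        have "sum \<gamma> K = sum \<beta> K" using sum_two[OF i True ij(3) fin] rest s by simp
        thus ?thesis using K by auto
      qed (rule one[OF i], auto)
    next
      case i: False
      show ?thesis
      proof (cases "j \<in> K")
        case False
        have "sum \<gamma> K = sum \<beta> K" using False i by (intro sum.cong refl eq) auto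
        thus ?thesis using K by auto
      qed (rule one[OF _ i], auto)
    qed
    thus ?thesis using mplus_sum_ge K by (metis order_trans)
  qed
  ultimately show ?thesis by (auto simp: tri_lt_def dom_lt_def)
qed

lemma tri_lt_swap:
  assumes ij: "i \<in> {1..N}" "j \<in> {1..N}" "i < j" and lt: "\<beta> j < \<beta> i"
  shows "tri_lt N (\<beta> \<circ> sw i j) \<beta>"
proof -
  have sw: "sw i j permutes {1..N}" using ij by (intro sw_permutes) auto
  have "\<beta> \<circ> sw i j \<noteq> \<beta>" using lt by (auto simp: fun_eq_iff intro!: exI[of _ i])
  moreover have "sum (\<beta> \<circ> sw i j) {1..m} \<le> sum \<beta> {1..m}" for m
  proof (cases "j \<le> m")
    case True
    hence "sw i j permutes {1..m}" using ij by (intro sw_permutes) auto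
    from sum.permute[OF this, of \<beta>] show ?thesis by simp
  next
    case False
    show ?thesis
    proof (rule sum_mono)
      fix k assume "k \<in> {1..m}"
      hence "k \<noteq> j" using False by auto
      thus "(\<beta> \<circ> sw i j) k \<le> \<beta> k" using lt by (cases "k = i") auto
    qed
  qed
  ultimately show ?thesis
    by (simp add: tri_lt_def dom_lt_def msum_comp[OF sw] mplus_comp[OF sw])
qed

text \<open>The point is \<open>a \<noteq> c\<close>: partial sums see only the positions
  \<open>{1..N}\<close>, and the support conditions turn their equality into equality of
  functions.\<close>

lemma dom_lt_trans:
  assumes "dom_lt N a b" "dom_lt N b c" and s: "supp_ok N a" "supp_ok N b" "supp_ok N c"
  shows "dom_lt N a c"
proof -
  have le: "sum a {1..i} \<le> sum b {1..i}" "sum b {1..i} \<le> sum c {1..i}" if "i \<in> {1..N}" for i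
    using assms(1,2) that by (auto simp: dom_lt_def)
  have "a \<noteq> c"
  proof
    assume "a = c"
    hence eq: "sum a {1..i} = sum b {1..i}" if "i \<le> N" for i using le[of i] that by (cases "i = 0") auto
    have "a k = b k" for k
    proof (cases "k \<in> {1..N}")
      case True
      then obtain k' where "k = Suc k'" by (cases k) auto
      thus ?thesis using eq[of k] eq[of k'] True by simp
    qed (use s in \<open>auto simp: supp_ok_def\<close>)
    thus False using assms(1) by (auto simp: dom_lt_def)
  qed
  thus ?thesis unfolding dom_lt_def using le order_trans by blast
qed

lemma supp_ok_mplus: "supp_ok N a \<Longrightarrow> supp_ok N (mplus N a)"
  by (simp add: mplus_eq supp_ok_comp[OF rank_inv_permutes])

lemma tri_lt_trans:
  assumes "tri_lt N a b" "tri_lt N b c" "supp_ok N a" "supp_ok N b" "supp_ok N c"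
  shows "tri_lt N a c"
  using assms dom_lt_trans[of N a b c] dom_lt_trans[of N "mplus N a" "mplus N b" "mplus N c"]
    supp_ok_mplus by (auto simp: tri_lt_def)

lemma tri_lt_irrefl: "\<not> tri_lt N a a"
  by (simp add: tri_lt_def dom_lt_def)

lemma tri_lt_maximal:
  assumes "finite A" "\<And>a. a \<in> A \<Longrightarrow> supp_ok N a" "b \<in> A"
  shows "\<exists>c\<in>A. (c = b \<or> tri_lt N b c) \<and> (\<forall>d\<in>A. \<not> tri_lt N c d)"
  using assms(3)
proof (induction "card {d\<in>A. tri_lt N b d}" arbitrary: b rule: less_induct)
  case less
  show ?case
  proof (cases "\<exists>d\<in>A. tri_lt N b d")
    case False
    thus ?thesis using less.prems by blast
  next
    case True
    then obtain d where d: "d \<in> A" "tri_lt N b d" by blast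
    have sub: "tri_lt N d e \<Longrightarrow> e \<in> A \<Longrightarrow> tri_lt N b e" for e
      using tri_lt_trans[OF d(2), of e] assms(2) less.prems d by blast
    hence "{e\<in>A. tri_lt N d e} \<subset> {e\<in>A. tri_lt N b e}" using d tri_lt_irrefl[of N d] by blast
    hence "card {e\<in>A. tri_lt N d e} < card {e\<in>A. tri_lt N b e}" using assms(1) by (intro psubset_card_mono) auto
    from less.hyps[OF this d(1)] obtain c where c: "c \<in> A" "c = d \<or> tri_lt N d c" "\<forall>d\<in>A. \<not> tri_lt N c d" by blast
    moreover have "tri_lt N b c" using c sub d by blast
    ultimately show ?thesis by blast
  qed
qed

section \<open>Leading terms of joint eigenvectors\<close>

context jack begin

text \<open>At a maximal exponent \<open>\<gamma>\<close> of \<open>p\<close>, all other monomials contributing to \<open>x^\<gamma>\<close> in \<open>U\<^sub>i p\<close> cancel.\<close>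
lemma UL_maximal:
  assumes p: "lp p" and i: "i \<in> {1..N}" and max: "\<And>\<beta>. p \<beta> \<noteq> 0 \<Longrightarrow> \<not> tri_lt N \<gamma> \<beta>"
  shows "UL i p \<gamma> S = of_int (\<gamma> i + 1) * p \<gamma> S
    + of_real \<kappa> * (\<Sum>j\<in>{j\<in>{1..N}. rank N \<gamma> i < rank N \<gamma> j}. tp (sw i j) (p \<gamma>) S)"
proof -
  have contrib: "tp (sw i j) (Mop i j p \<gamma>) S - (if j < i then tp (sw i j) (p (\<gamma> \<circ> sw i j)) S else 0)
      = (if rank N \<gamma> i < rank N \<gamma> j then tp (sw i j) (p \<gamma>) S else 0)" if j: "j \<in> {1..N} - {i}" for j
  proof -
    let ?\<delta> = "\<gamma> \<circ> sw i j"
    have ij: "j \<in> {1..N}" "i \<noteq> j" using j by auto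
    \<comment> \<open>In these cases the transposed exponent lies above \<gamma>, which maximality
      forbids.\<close>
    have vanish: "p ?\<delta> = 0" if "(i < j \<and> \<gamma> i < \<gamma> j) \<or> (j < i \<and> \<gamma> j < \<gamma> i)"
    proof (rule ccontr)
      assume "p ?\<delta> \<noteq> 0"
      from max[OF this] have "\<not> tri_lt N (?\<delta> \<circ> sw i j) ?\<delta>" by simp
      thus False using tri_lt_swap[of i N j ?\<delta>] tri_lt_swap[of j N i ?\<delta>] that i ij
        by (auto simp: sw_commute[of j i])
    qed
    \<comment> \<open>Any further contributing exponent has \<gamma> strictly between its two
      entries, so it lies above \<gamma> by \<open>tri_lt_line\<close>.\<close>
    have zero: "p \<beta> = 0" if "\<beta> \<noteq> \<gamma>" "\<beta> \<noteq> ?\<delta>" "mker i j \<beta> \<gamma> \<noteq> 0" for \<beta>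
    proof (rule ccontr)
      assume nz: "p \<beta> \<noteq> 0"
      have k: "\<And>k. k \<noteq> i \<Longrightarrow> k \<noteq> j \<Longrightarrow> \<gamma> k = \<beta> k" "\<gamma> i + \<gamma> j = \<beta> i + \<beta> j"
        "\<beta> j \<le> \<gamma> i \<and> \<gamma> i \<le> \<beta> i \<or> \<beta> i < \<gamma> i \<and> \<gamma> i < \<beta> j"
        using that(3) by (auto simp: mker_def kf_def split: if_splits)
      have "\<gamma> i \<noteq> \<beta> i"
      proof
        assume "\<gamma> i = \<beta> i"
        hence "\<gamma> x = \<beta> x" for x using k(1)[of x] k(2) by (cases "x = i"; cases "x = j") auto
        thus False using that(1) by auto
      qed
      moreover have "\<gamma> i \<noteq> \<beta> j"
      proof
        assume "\<gamma> i = \<beta> j"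
        hence "?\<delta> x = \<beta> x" for x using k(1)[of x] k(2) by (cases "x = i"; cases "x = j") auto
        thus False using that(2) by auto
      qed
      ultimately have "tri_lt N \<gamma> \<beta>" using k i ij by (intro tri_lt_line[of i N j]) auto
      thus False using max[OF nz] by simp
    qed
    have mg: "mker i j \<gamma> \<gamma> = (if \<gamma> j \<le> \<gamma> i then 1 else 0)" by (auto simp: mker_def kf_def)
    have md: "mker i j ?\<delta> \<gamma> = (if \<gamma> i \<le> \<gamma> j then 1 else 0)"
      using ij by (auto simp: mker_def kf_def)
    have "Mop i j p \<gamma> = (\<lambda>S. \<Sum>\<beta>\<in>{\<gamma>, ?\<delta>}. of_int (mker i j \<beta> \<gamma>) * p \<beta> S)"
    proof
      fix S
      have "Mop i j p \<gamma> S = (\<Sum>\<beta>\<in>supp p \<union> {\<gamma>, ?\<delta>}. of_int (mker i j \<beta> \<gamma>) * p \<beta> S)"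
        using lp_finite[OF p] by (subst Mop_sup[of "supp p \<union> {\<gamma>, ?\<delta>}"]) auto
      also have "\<dots> = (\<Sum>\<beta>\<in>{\<gamma>, ?\<delta>}. of_int (mker i j \<beta> \<gamma>) * p \<beta> S)"
      proof (intro sum.mono_neutral_right ballI)
        fix \<beta> assume "\<beta> \<in> supp p \<union> {\<gamma>, ?\<delta>} - {\<gamma>, ?\<delta>}"
        thus "of_int (mker i j \<beta> \<gamma>) * p \<beta> S = 0" using zero[of \<beta>] by (cases "mker i j \<beta> \<gamma> = 0") auto
      qed (use lp_finite[OF p] in auto)
      finally show "Mop i j p \<gamma> S = (\<Sum>\<beta>\<in>{\<gamma>, ?\<delta>}. of_int (mker i j \<beta> \<gamma>) * p \<beta> S)" .
    qed
    hence M: "Mop i j p \<gamma> = (if \<gamma> j \<le> \<gamma> i then p \<gamma> else p ?\<delta>)"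
    proof (cases "\<gamma> i = \<gamma> j")
      case True
      hence "?\<delta> = \<gamma>" by (auto simp: fun_eq_iff sw_def)
      thus ?thesis using \<open>Mop i j p \<gamma> = _\<close> True mg by simp
    next
      case False
      hence "?\<delta> i \<noteq> \<gamma> i" by simp
      hence "?\<delta> \<noteq> \<gamma>" by metis
      thus ?thesis using \<open>Mop i j p \<gamma> = _\<close> False mg md by auto
    qed
    have r: "rank N \<gamma> i < rank N \<gamma> j \<longleftrightarrow> \<gamma> j < \<gamma> i \<or> \<gamma> i = \<gamma> j \<and> i < j"
      unfolding rank_less_iff[OF i ij(1)] before_def using ij(2) by (cases "i < j") auto
    consider "\<gamma> i < \<gamma> j" | "\<gamma> j < \<gamma> i" | "\<gamma> i = \<gamma> j" by linarith
    thus ?thesis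
    proof cases
      case 3
      hence "?\<delta> = \<gamma>" by (auto simp: fun_eq_iff sw_def)
      thus ?thesis using 3 ij unfolding M r by auto
    qed (use vanish ij in \<open>auto simp: M r tp_0\<close>)
  qed
  have "(\<Sum>j\<in>{1..<i}. tp (sw i j) (p (\<gamma> \<circ> sw i j)) S)
      = (\<Sum>j\<in>{1..N} - {i}. if j < i then tp (sw i j) (p (\<gamma> \<circ> sw i j)) S else 0)"
    using i by (intro sum.mono_neutral_cong_left) auto
  hence "UL i p \<gamma> S = of_int (\<gamma> i + 1) * p \<gamma> S + of_real \<kappa> *
     (\<Sum>j\<in>{1..N} - {i}. tp (sw i j) (Mop i j p \<gamma>) S - (if j < i then tp (sw i j) (p (\<gamma> \<circ> sw i j)) S else 0))"
    by (simp add: UL_def Uop_def sum_subtractf algebra_simps)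
  also have "(\<Sum>j\<in>{1..N} - {i}. tp (sw i j) (Mop i j p \<gamma>) S - (if j < i then tp (sw i j) (p (\<gamma> \<circ> sw i j)) S else 0))
     = (\<Sum>j\<in>{1..N} - {i}. if rank N \<gamma> i < rank N \<gamma> j then tp (sw i j) (p \<gamma>) S else 0)"
    by (intro sum.cong refl contrib)
  also have "\<dots> = (\<Sum>j\<in>{j\<in>{1..N}. rank N \<gamma> i < rank N \<gamma> j}. tp (sw i j) (p \<gamma>) S)"
    by (intro sum.mono_neutral_cong_right) auto
  finally show ?thesis .
qed

text \<open>Conjugation by the rank permutation turns the positions ranked after \<open>i\<close>
  into the numbers above \<open>rank N \<gamma> i\<close>, and the sum into a Jucys-Murphy
  element.\<close>

lemma tp_rk_jm:
  assumes i: "i \<in> {1..N}" and v: "v \<in> V"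
  shows "(\<Sum>j\<in>{j\<in>{1..N}. rank N \<gamma> i < rank N \<gamma> j}. tp (rk N \<gamma>) (tp (sw i j) v) S)
    = jm (rank N \<gamma> i) (tp (rk N \<gamma>) v) S"
proof -
  let ?r = "rk N \<gamma>"
  have r: "?r permutes {1..N}" by (rule rk_permutes)
  have "tp ?r (tp (sw i j) v) = tp (sw (?r i) (?r j)) (tp ?r v)" if "j \<in> {1..N}" for j
  proof -
    have "sw i j permutes {1..N}" "sw (?r i) (?r j) permutes {1..N}"
      using i that permutes_in_image[OF r] by (simp_all only: sw_permutes)
    thus ?thesis using tp_comp[OF r _ v] tp_comp[OF _ r v] sw_conj[OF permutes_bij[OF r]] by metis
  qed
  hence "(\<Sum>j\<in>{j\<in>{1..N}. rank N \<gamma> i < rank N \<gamma> j}. tp ?r (tp (sw i j) v) S)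
    = (\<Sum>j\<in>{j\<in>{1..N}. rank N \<gamma> i < rank N \<gamma> j}. tp (sw (rank N \<gamma> i) (?r j)) (tp ?r v) S)"
    using i by (intro sum.cong) (auto simp: rk_eq)
  also have "\<dots> = (\<Sum>l\<in>?r ` {j\<in>{1..N}. rank N \<gamma> i < rank N \<gamma> j}. tp (sw (rank N \<gamma> i) l) (tp ?r v) S)"
    by (simp add: sum.reindex permutes_inj_on[OF r])
  also have "?r ` {j\<in>{1..N}. rank N \<gamma> i < rank N \<gamma> j} = {rank N \<gamma> i<..N}"
  proof -
    have "?r ` {j\<in>{1..N}. rank N \<gamma> i < rank N \<gamma> j} = {l \<in> ?r ` {1..N}. rank N \<gamma> i < l}"
      using rk_eq[of _ N \<gamma>] by (auto simp: image_iff)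
    thus ?thesis unfolding permutes_image[OF r] by auto
  qed
  finally show ?thesis by (simp add: jm_def)
qed

text \<open>The positions \<open>m i\<close> at which contents are taken need not be the ranks of
  \<alpha>: in \<open>J_same\<close> the lemma is applied to ranks composed with a
  transposition.\<close>

lemma joint_eigenvector_support:
  assumes p: "lp p" "p \<noteq> 0" and eig: "\<And>i. i \<in> {1..N} \<Longrightarrow> UL i p = sc (of_real (e i)) p"
    and e: "\<And>i. i \<in> {1..N} \<Longrightarrow> e i = real_of_int (\<alpha> i) + 1 + \<kappa> * real_of_int (cont (m i) T)"
    and T: "T \<in> Y" "\<And>i. i \<in> {1..N} \<Longrightarrow> m i \<in> {1..N}" and \<alpha>: "supp_ok N \<alpha>"
  shows "p \<alpha> \<noteq> 0 \<and> (\<forall>\<beta>. \<beta> \<noteq> \<alpha> \<and> p \<beta> \<noteq> 0 \<longrightarrow> tri_lt N \<beta> \<alpha>)"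
proof -
  have max: "\<gamma> = \<alpha>" if g: "p \<gamma> \<noteq> 0" and mx: "\<And>\<beta>. p \<beta> \<noteq> 0 \<Longrightarrow> \<not> tri_lt N \<gamma> \<beta>" for \<gamma>
  proof -
    let ?r = "rk N \<gamma>"
    define u where "u = tp ?r (p \<gamma>)"
    have r: "?r permutes {1..N}" by (rule rk_permutes)
    have uV: "u \<in> V" unfolding u_def by (intro tp_V r lp_V p)
    have "u \<noteq> 0" using tp_inv[OF r lp_V[OF p(1), of \<gamma>]] g by (auto simp: u_def tp_0)
    \<comment> \<open>Jucys-Murphy elements are diagonal on tableaux, so one nonzero coordinate of
      the transported leading coefficient reveals all eigenvalues simultaneously.\<close>
    then obtain S where S: "u S \<noteq> 0" by (auto simp: fun_eq_iff)
    hence SY: "S \<in> Y" using V_outside[OF uV] by blast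
    have "\<gamma> i = \<alpha> i" if i: "i \<in> {1..N}" for i
    proof -
      have "UL i p \<gamma> = (\<lambda>S. of_real (e i) * p \<gamma> S)" using eig[OF i] by (simp add: sc_def)
      moreover have "UL i p \<gamma> = (\<lambda>S. of_int (\<gamma> i + 1) * p \<gamma> S
        + (\<Sum>j\<in>{j\<in>{1..N}. rank N \<gamma> i < rank N \<gamma> j}. of_real \<kappa> * tp (sw i j) (p \<gamma>) S))"
      proof
        fix S
        show "UL i p \<gamma> S = of_int (\<gamma> i + 1) * p \<gamma> S
          + (\<Sum>j\<in>{j\<in>{1..N}. rank N \<gamma> i < rank N \<gamma> j}. of_real \<kappa> * tp (sw i j) (p \<gamma>) S)"
          using UL_maximal[OF p(1) i, of \<gamma> S] mx unfolding sum_distrib_left by blast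
      qed
      ultimately have "tp ?r (\<lambda>S. of_real (e i) * p \<gamma> S) = tp ?r (\<lambda>S. of_int (\<gamma> i + 1) * p \<gamma> S
        + (\<Sum>j\<in>{j\<in>{1..N}. rank N \<gamma> i < rank N \<gamma> j}. of_real \<kappa> * tp (sw i j) (p \<gamma>) S))" by simp
      hence "of_real (e i) * u S = of_int (\<gamma> i + 1) * u S
        + of_real \<kappa> * (\<Sum>j\<in>{j\<in>{1..N}. rank N \<gamma> i < rank N \<gamma> j}. tp ?r (tp (sw i j) (p \<gamma>)) S)"
        unfolding tp_add tp_scale tp_sum u_def sum_distrib_left by (rule fun_cong)
      also have "\<dots> = (of_int (\<gamma> i + 1) + of_real \<kappa> * of_int (cont (rank N \<gamma> i) S)) * u S"
        unfolding tp_rk_jm[OF i lp_V[OF p(1)]] u_def[symmetric] jm_apply[OF rank_in[OF i] uV]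
        by (simp add: algebra_simps)
      finally have "complex_of_real (e i) = of_int (\<gamma> i + 1) + of_real \<kappa> * of_int (cont (rank N \<gamma> i) S)"
        using S by simp
      hence "complex_of_real (e i) = of_real (real_of_int (\<gamma> i + 1) + \<kappa> * real_of_int (cont (rank N \<gamma> i) S))"
        by simp
      hence "e i = real_of_int (\<gamma> i + 1) + \<kappa> * real_of_int (cont (rank N \<gamma> i) S)"
        unfolding of_real_eq_iff .
      hence d: "real_of_int (\<gamma> i - \<alpha> i) = \<kappa> * real_of_int (cont (m i) T - cont (rank N \<gamma> i) S)"
        using e[OF i] by (simp add: algebra_simps)
      have "\<bar>cont (m i) T - cont (rank N \<gamma> i) S\<bar> \<le> int (htau \<tau>) - 1"
        by (intro cont_diff_le T SY i rank_in)
      hence "\<bar>real_of_int (cont (m i) T - cont (rank N \<gamma> i) S)\<bar> \<le> real (htau \<tau>)" by linarith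
      hence "\<bar>\<kappa>\<bar> * \<bar>real_of_int (cont (m i) T - cont (rank N \<gamma> i) S)\<bar> \<le> \<bar>\<kappa>\<bar> * real (htau \<tau>)"
        by (intro mult_left_mono) auto
      hence "\<bar>real_of_int (\<gamma> i - \<alpha> i)\<bar> < 1" unfolding d abs_mult using kappa by linarith
      thus ?thesis by linarith
    qed
    moreover have "\<gamma> i = \<alpha> i" if "i \<notin> {1..N}" for i
      using that lp_supp[OF p(1) g] \<alpha> unfolding supp_ok_def by metis
    ultimately show "\<gamma> = \<alpha>" by blast
  qed
  have top: "p \<alpha> \<noteq> 0 \<and> (\<beta> = \<alpha> \<or> tri_lt N \<beta> \<alpha>)" if "p \<beta> \<noteq> 0" for \<beta>
  proof -
    obtain c where c: "p c \<noteq> 0" "c = \<beta> \<or> tri_lt N \<beta> c" "\<And>d. p d \<noteq> 0 \<Longrightarrow> \<not> tri_lt N c d"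
      using tri_lt_maximal[of "supp p" N \<beta>] lp_finite[OF p(1)] lp_supp[OF p(1)] \<open>p \<beta> \<noteq> 0\<close> by auto
    have "c = \<alpha>" using max[OF c(1,3)] by blast
    thus ?thesis using c by blast
  qed
  obtain \<beta> where "p \<beta> \<noteq> 0" using p(2) by (auto simp: fun_eq_iff)
  thus ?thesis using top by blast
qed

end

section \<open>Nonsymmetric Jack polynomials\<close>

text \<open>The totals agree and the sum of the first \<open>N - 1\<close> parts does not grow, so
  the smallest part cannot decrease. Therefore triangularity over a nonnegative exponent stays
  within polynomials.\<close>

lemma tri_lt_lower_bound:
  assumes lt: "tri_lt N \<beta> \<alpha>" and \<alpha>: "\<And>k. k \<in> {1..N} \<Longrightarrow> c \<le> \<alpha> k" and k: "k \<in> {1..N}"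
  shows "c \<le> \<beta> k"
proof -
  obtain n where N: "N = Suc n" using k by (cases N) auto
  have sum_eq: "sum (mplus N \<gamma>) {1..N} = msum N \<gamma>" for \<gamma>
    using sum_mplus[of "\<lambda>x. x" N \<gamma>] by (simp add: msum_def)
  have eq: "sum (mplus N \<beta>) {1..N} = sum (mplus N \<alpha>) {1..N}"
    using lt unfolding sum_eq by (simp add: tri_lt_def)
  have "sum (mplus N \<beta>) {1..n} \<le> sum (mplus N \<alpha>) {1..n}"
  proof (cases "n = 0")
    case False
    thus ?thesis using lt N by (auto simp: tri_lt_def dom_lt_def)
  qed simp
  hence "mplus N \<alpha> N \<le> mplus N \<beta> N" using eq by (simp add: N)
  moreover have "c \<le> mplus N \<alpha> N" using \<alpha> rank_inv_in[of N N \<alpha>] N by (simp add: mplus_eq)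
  moreover have "mplus N \<beta> N \<le> mplus N \<beta> (rank N \<beta> k)"
    using nonincr_rank_inv[of N \<beta>] rank_in[OF k, of \<beta>] unfolding mplus_eq nonincr_def by auto
  ultimately show ?thesis using rank_inv_rank[OF k, of \<beta>] by (simp add: mplus_eq)
qed

section \<open>Characterization of Jack polynomials and steps between them\<close>

context jack begin

lemma sc_simps: "sc c (p + q) = sc c p + sc c q" "sc c (p - q) = sc c p - sc c q" "sc c (sc d p) = sc (c * d) p"
  "sc (c + d) p = sc c p + sc d p" "sc 1 p = p" "sc 0 p = 0"
  by (simp_all add: fun_eq_iff algebra_simps)

lemma UL_diff: "lp p \<Longrightarrow> lp q \<Longrightarrow> UL i (p - q) = UL i p - UL i q"
  unfolding diff_sc by (simp add: UL_add UL_sc lp_sc)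

lemma joint_eigenvector_zero:
  assumes "lp p" "\<And>i. i \<in> {1..N} \<Longrightarrow> UL i p = sc (of_real (e i)) p"
    and "\<And>i. i \<in> {1..N} \<Longrightarrow> e i = real_of_int (\<alpha> i) + 1 + \<kappa> * real_of_int (cont (m i) T)"
    and "T \<in> Y" "\<And>i. i \<in> {1..N} \<Longrightarrow> m i \<in> {1..N}" "supp_ok N \<alpha>" "p \<alpha> = 0"
  shows "p = 0"
  using joint_eigenvector_support[of p e \<alpha> m T] assms by blast

text \<open>The description of \<zeta> with the Laurent version of the operators, so that exponents
  with negative entries are included.\<close>

definition isJ :: "mi \<Rightarrow> tab \<Rightarrow> lpoly \<Rightarrow> bool" where
  "isJ \<alpha> T p \<longleftrightarrow> lp p \<and> p \<alpha> = tp (rank_inv N \<alpha>) (bv T)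
     \<and> (\<forall>\<beta>. \<beta> \<noteq> \<alpha> \<and> p \<beta> \<noteq> 0 \<longrightarrow> tri_lt N \<beta> \<alpha>)
     \<and> (\<forall>i\<in>{1..N}. UL i p = sc (of_real (xi N \<kappa> \<alpha> T i)) p)"

lemma isJ_D:
  assumes "isJ \<alpha> T p"
  shows "lp p" "p \<alpha> = tp (rank_inv N \<alpha>) (bv T)" "\<And>\<beta>. \<beta> \<noteq> \<alpha> \<Longrightarrow> p \<beta> \<noteq> 0 \<Longrightarrow> tri_lt N \<beta> \<alpha>"
    "\<And>i. i \<in> {1..N} \<Longrightarrow> UL i p = sc (of_real (xi N \<kappa> \<alpha> T i)) p"
  using assms by (auto simp: isJ_def)

lemma tp_bv_neq_0: assumes "w permutes {1..N}" "T \<in> Y" shows "tp w (bv T) \<noteq> 0"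
proof
  assume "tp w (bv T) = 0"
  hence "bv T = 0" using tp_inv[OF assms(1) V_bv[OF assms(2)]] by (simp add: tp_0)
  hence "bv T T = 0" by simp
  thus False by (simp add: bv_def)
qed

lemma isJ_I:
  assumes "lp p" "supp_ok N \<alpha>" "T \<in> Y" "p \<alpha> = tp (rank_inv N \<alpha>) (bv T)"
    "\<And>i. i \<in> {1..N} \<Longrightarrow> UL i p = sc (of_real (xi N \<kappa> \<alpha> T i)) p"
  shows "isJ \<alpha> T p"
proof -
  have "p \<noteq> 0" using tp_bv_neq_0[OF rank_inv_permutes[of N \<alpha>] assms(3)] assms(4) by auto
  from joint_eigenvector_support[OF assms(1) this assms(5), of \<alpha> "rank N \<alpha>" T]
  show ?thesis using assms rank_in by (auto simp: isJ_def xi_def)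
qed

lemma isJ_unique:
  assumes "isJ \<alpha> T p" "isJ \<alpha> T q" "supp_ok N \<alpha>" "T \<in> Y"
  shows "p = q"
proof -
  have "p - q = 0"
  proof (rule joint_eigenvector_zero[where m = "rank N \<alpha>"])
    show "UL i (p - q) = sc (of_real (xi N \<kappa> \<alpha> T i)) (p - q)" if "i \<in> {1..N}" for i
      using assms that by (simp add: isJ_D UL_diff sc_simps)
    show "lp (p - q)" using assms isJ_D(1) by (blast intro: lp_diff)
    show "(p - q) \<alpha> = 0" using isJ_D(2)[OF assms(1)] isJ_D(2)[OF assms(2)] by simp
    show "rank N \<alpha> i \<in> {1..N}" if "i \<in> {1..N}" for i using rank_in[OF that] .
  qed (use assms in \<open>auto simp: xi_def\<close>)
  thus ?thesis by simp
qed

lemma rank_zero: "rank N (\<lambda>_. 0) i = i"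
proof -
  have "{j\<in>{1..i}. (0::int) = 0} = {1..i}" by auto
  thus ?thesis by (simp add: rank_def del: atLeastAtMost_iff)
qed

text \<open>For a constant the exponent 0 is the only one, hence maximal, and \<open>UL i\<close>
  reduces to a Jucys-Murphy element acting on a tableau.\<close>

lemma isJ_zero:
  assumes T: "T \<in> Y" shows "isJ (\<lambda>_. 0) T (monov (\<lambda>_. 0) (bv T))"
proof (rule isJ_I)
  let ?p = "monov (\<lambda>_. 0) (bv T)"
  show ok: "supp_ok N (\<lambda>_. 0)" by (simp add: supp_ok_def)
  show p: "lp ?p" by (intro lp_monov ok V_bv T)
  have "rank_inv N (\<lambda>_. 0) = id"
  proof
    fix k show "rank_inv N (\<lambda>_. 0) k = id k"
      using rank_inv_rank[of k N "\<lambda>_. 0"] by (cases "k \<in> {1..N}") (auto simp: rank_zero rank_inv_def)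
  qed
  thus "?p (\<lambda>_. 0) = tp (rank_inv N (\<lambda>_. 0)) (bv T)" by (simp add: monov_def tp_id V_bv T)
  fix i assume i: "i \<in> {1..N}"
  have supp0: "?p \<beta> \<noteq> 0 \<Longrightarrow> \<beta> = (\<lambda>_. 0)" for \<beta> by (auto simp: monov_def split: if_splits)
  show "UL i ?p = sc (of_real (xi N \<kappa> (\<lambda>_. 0) T i)) ?p"
  proof (intro ext)
    fix \<gamma> S
    show "UL i ?p \<gamma> S = sc (of_real (xi N \<kappa> (\<lambda>_. 0) T i)) ?p \<gamma> S"
    proof (cases "\<gamma> = (\<lambda>_. 0)")
      case True
      have "UL i ?p \<gamma> S = of_int (\<gamma> i + 1) * ?p \<gamma> S
        + of_real \<kappa> * (\<Sum>j\<in>{j\<in>{1..N}. rank N \<gamma> i < rank N \<gamma> j}. tp (sw i j) (?p \<gamma>) S)"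
      proof (rule UL_maximal[OF p i])
        fix \<beta> assume "?p \<beta> \<noteq> 0"
        thus "\<not> tri_lt N \<gamma> \<beta>" using supp0[of \<beta>] True tri_lt_irrefl by simp
      qed
      also have "{j\<in>{1..N}. rank N \<gamma> i < rank N \<gamma> j} = {i<..N}" using True i by (auto simp: rank_zero)
      also have "(\<Sum>j\<in>{i<..N}. tp (sw i j) (?p \<gamma>) S) = jm i (bv T) S"
        using True by (simp add: jm_def monov_def)
      also have "\<dots> = of_int (cont i T) * bv T S" using i T by (subst jm_bv) auto
      finally show ?thesis using True by (simp add: monov_def xi_def rank_zero algebra_simps)
    next
      case False
      have "mker i j (\<lambda>_. 0) \<gamma> = 0" if "j \<noteq> i" for j
      proof (rule ccontr)
        assume "mker i j (\<lambda>_. 0) \<gamma> \<noteq> 0"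
        hence "\<forall>k. k \<noteq> i \<longrightarrow> k \<noteq> j \<longrightarrow> 0 = \<gamma> k" "\<gamma> i = 0" "\<gamma> j = 0"
          unfolding mker_def kf_def by (auto split: if_splits)
        hence "\<gamma> = (\<lambda>_. 0)" by metis
        thus False using False by simp
      qed
      moreover have "Mop i j ?p \<gamma> = (\<lambda>S. \<Sum>\<beta>\<in>{\<lambda>_. 0}. of_int (mker i j \<beta> \<gamma>) * ?p \<beta> S)" for j
        using supp0 by (intro Mop_sup) auto
      ultimately have "Mop i j ?p \<gamma> = (\<lambda>S. 0)" if "j \<noteq> i" for j using that by simp
      moreover have "?p (\<gamma> \<circ> sw i j) = 0" for j
      proof (rule ccontr)
        assume "?p (\<gamma> \<circ> sw i j) \<noteq> 0"
        hence "\<gamma> \<circ> sw i j \<circ> sw i j = (\<lambda>_. 0)" using supp0 by fastforce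
        thus False using False by simp
      qed
      moreover have "?p \<gamma> = 0" using False by (simp add: monov_def)
      ultimately show ?thesis by (simp add: UL_def Uop_def tp_0)
    qed
  qed
qed (use T in auto)

lemma rank_inv_upm: "rank_inv N (upm m \<alpha>) = rank_inv N \<alpha>"
  using rank_inv_transfer[of id N "upm m \<alpha>" \<alpha>] by (auto simp: before_def upm_def permutes_id)

lemma rank_upm: "i \<in> {1..N} \<Longrightarrow> rank N (upm m \<alpha>) i = rank N \<alpha> i"
  using rank_transfer[of id N "upm m \<alpha>" \<alpha>] by (auto simp: before_def upm_def permutes_id)

lemma isJ_shiftm:
  assumes p: "isJ \<alpha> T p" and \<alpha>: "supp_ok N \<alpha>" and T: "T \<in> Y"
  shows "isJ (upm m \<alpha>) T (shiftm N (- m) p)"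
proof (rule isJ_I)
  show "shiftm N (- m) p (upm m \<alpha>) = tp (rank_inv N (upm m \<alpha>)) (bv T)"
    using isJ_D(2)[OF p] by (simp add: shiftm_upm rank_inv_upm)
  fix i assume i: "i \<in> {1..N}"
  have x: "xi N \<kappa> (upm m \<alpha>) T i = xi N \<kappa> \<alpha> T i + of_int m"
    using i rank_upm[OF i] by (simp add: xi_def) (simp add: upm_def)
  show "UL i (shiftm N (- m) p) = sc (of_real (xi N \<kappa> (upm m \<alpha>) T i)) (shiftm N (- m) p)"
    unfolding UL_shiftm[OF isJ_D(1)[OF p] i] isJ_D(4)[OF p i] x
    by (simp add: fun_eq_iff shiftm_upm algebra_simps)
qed (use p \<alpha> T in \<open>auto intro: lp_shiftm isJ_D\<close>)

text \<open>The intertwiner of the degenerate affine Hecke algebra; \<open>b\<close> is chosen to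
  absorb the term \<kappa> p. It is given by an equation and not as a quotient because the two
  eigenvalues may coincide when \<kappa> = 0, a case that \<open>J_same\<close> includes.\<close>

lemma eigen_swap:
  assumes p: "lp p" and i: "i \<in> {1..<N}" and eig: "\<And>k. k \<in> {1..N} \<Longrightarrow> UL k p = sc (of_real (e k)) p"
    and b: "b * (e i - e (Suc i)) = \<kappa>" and k: "k \<in> {1..N}"
  defines "q \<equiv> act (sw i (Suc i)) p - sc (of_real b) p"
  shows "UL k q = sc (of_real (e (sw i (Suc i) k))) q"
proof -
  let ?s = "sw i (Suc i)"
  have s: "?s permutes {1..N}" using i by (intro sw_permutes) auto
  have ii: "i \<in> {1..N}" "Suc i \<in> {1..N}" using i by auto
  have ULq: "UL k q = UL k (act ?s p) - sc (of_real (b * e k)) p"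
    using p k by (simp add: q_def UL_diff lp_act[OF s] lp_sc UL_sc eig sc_simps)
  have b': "complex_of_real b * of_real (e i) = of_real \<kappa> + of_real b * of_real (e (Suc i))"
    using b by (simp add: algebra_simps flip: of_real_mult of_real_add)
  consider "k = i" | "k = Suc i" | "k \<noteq> i" "k \<noteq> Suc i" by blast
  thus ?thesis
  proof cases
    case 1
    have "UL i (act ?s p) = sc (of_real (e (Suc i))) (act ?s p) + sc \<kappa> p"
      using UL_act_s(1)[OF p i] eig[OF ii(2)] by (simp add: act_sc)
    thus ?thesis unfolding ULq unfolding 1 by (simp add: q_def fun_eq_iff algebra_simps b')
  next
    case 2
    have "UL (Suc i) (act ?s p) = sc (of_real (e i)) (act ?s p) - sc \<kappa> p"
      using UL_act_s(2)[OF p i] eig[OF ii(1)] by (simp add: act_sc)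
    moreover have "of_real (e i) * y - of_real \<kappa> * x - of_real b * (of_real (e (Suc i)) * x)
        = of_real (e i) * (y - of_real b * x)" for x y :: complex
      using b' by algebra
    ultimately show ?thesis unfolding ULq unfolding 2 by (simp add: q_def fun_eq_iff mult.assoc)
  next
    case 3
    have "UL k (act ?s p) = sc (of_real (e k)) (act ?s p)"
      using act_s_UL[OF p i k 3] eig[OF k] by (simp add: act_sc)
    thus ?thesis unfolding ULq using 3 by (simp add: q_def fun_eq_iff algebra_simps)
  qed
qed

lemma kappa_cont:
  assumes "T \<in> Y" "T' \<in> Y" "i \<in> {1..N}" "j \<in> {1..N}"
  shows "\<bar>\<kappa> * real_of_int (cont i T - cont j T')\<bar> < 1"
proof -
  have "\<bar>cont i T - cont j T'\<bar> \<le> int (htau \<tau>) - 1" by (intro cont_diff_le assms)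
  hence "\<bar>real_of_int (cont i T - cont j T')\<bar> \<le> real (htau \<tau>)" by linarith
  hence "\<bar>\<kappa>\<bar> * \<bar>real_of_int (cont i T - cont j T')\<bar> \<le> \<bar>\<kappa>\<bar> * real (htau \<tau>)"
    by (intro mult_left_mono) auto
  thus ?thesis using kappa by (simp only: abs_mult)
qed

lemma xi_neq:
  assumes "T \<in> Y" "i \<in> {1..N}" "j \<in> {1..N}" "\<alpha> i \<noteq> \<alpha> j"
  shows "xi N \<kappa> \<alpha> T i \<noteq> xi N \<kappa> \<alpha> T j"
proof
  assume "xi N \<kappa> \<alpha> T i = xi N \<kappa> \<alpha> T j"
  hence "real_of_int (\<alpha> i - \<alpha> j) = \<kappa> * real_of_int (cont (rank N \<alpha> j) T - cont (rank N \<alpha> i) T)"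
    by (simp add: xi_def algebra_simps)
  hence "\<bar>real_of_int (\<alpha> i - \<alpha> j)\<bar> < 1"
    using kappa_cont[OF assms(1,1) rank_in[OF assms(3)] rank_in[OF assms(2)]] by simp
  thus False using assms(4) by linarith
qed

lemma before_swap:
  assumes "\<alpha> i \<noteq> \<alpha> (Suc i)"
  shows "before (\<alpha> \<circ> sw i (Suc i)) (sw i (Suc i) j) (sw i (Suc i) k) \<longleftrightarrow> before \<alpha> j k"
proof -
  have "sw i (Suc i) j \<le> sw i (Suc i) k \<longleftrightarrow> j \<le> k" if "\<alpha> j = \<alpha> k"
    using that assms by (auto simp: sw_def)
  thus ?thesis by (auto simp: before_def)
qed

lemma rank_inv_swap:
  assumes "i \<in> {1..<N}" "\<alpha> i \<noteq> \<alpha> (Suc i)"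
  shows "rank_inv N (\<alpha> \<circ> sw i (Suc i)) = sw i (Suc i) \<circ> rank_inv N \<alpha>"
  using assms by (intro rank_inv_transfer sw_permutes before_swap) auto

lemma rank_swap:
  assumes "i \<in> {1..<N}" "\<alpha> i \<noteq> \<alpha> (Suc i)" "k \<in> {1..N}"
  shows "rank N (\<alpha> \<circ> sw i (Suc i)) (sw i (Suc i) k) = rank N \<alpha> k"
  using assms by (intro rank_transfer sw_permutes before_swap) auto

lemma xi_swap:
  assumes "i \<in> {1..<N}" "\<alpha> i \<noteq> \<alpha> (Suc i)" "k \<in> {1..N}"
  shows "xi N \<kappa> (\<alpha> \<circ> sw i (Suc i)) T k = xi N \<kappa> \<alpha> T (sw i (Suc i) k)"
proof -
  have "sw i (Suc i) k \<in> {1..N}" using assms by (auto simp: sw_def)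
  from rank_swap[OF assms(1,2) this] show ?thesis by (simp add: xi_def)
qed

definition bJ :: "nat \<Rightarrow> mi \<Rightarrow> tab \<Rightarrow> real" where
  "bJ i \<alpha> T = \<kappa> / (xi N \<kappa> \<alpha> T i - xi N \<kappa> \<alpha> T (Suc i))"

text \<open>The new exponent lies above \<alpha>, so it is absent from \<open>p\<close>. The leading
  coefficient is produced by the transposition alone and needs no normalization.\<close>

lemma isJ_up:
  assumes p: "isJ \<alpha> T p" and \<alpha>: "supp_ok N \<alpha>" and T: "T \<in> Y" and i: "i \<in> {1..<N}" and lt: "\<alpha> i < \<alpha> (Suc i)"
  shows "isJ (\<alpha> \<circ> sw i (Suc i)) T (act (sw i (Suc i)) p - sc (of_real (bJ i \<alpha> T)) p)"
proof (rule isJ_I)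
  let ?s = "sw i (Suc i)"
  have s: "?s permutes {1..N}" using i by (intro sw_permutes) auto
  have ii: "i \<in> {1..N}" "Suc i \<in> {1..N}" using i by auto
  note lp = isJ_D(1)[OF p]
  show "lp (act ?s p - sc (of_real (bJ i \<alpha> T)) p)" using lp s by (intro lp_diff lp_act lp_sc)
  show ok: "supp_ok N (\<alpha> \<circ> ?s)" using \<alpha> supp_ok_comp[OF s] by simp
  have "xi N \<kappa> \<alpha> T i \<noteq> xi N \<kappa> \<alpha> T (Suc i)" using xi_neq[OF T ii] lt by simp
  hence b: "bJ i \<alpha> T * (xi N \<kappa> \<alpha> T i - xi N \<kappa> \<alpha> T (Suc i)) = \<kappa>" by (simp add: bJ_def)
  show "UL k (act ?s p - sc (of_real (bJ i \<alpha> T)) p) = sc (of_real (xi N \<kappa> (\<alpha> \<circ> ?s) T k)) (act ?s p - sc (of_real (bJ i \<alpha> T)) p)"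
    if k: "k \<in> {1..N}" for k
    using eigen_swap[OF lp i isJ_D(4)[OF p] b k] xi_swap[OF i _ k, of \<alpha> T] lt by simp
  have "tri_lt N \<alpha> (\<alpha> \<circ> ?s)"
    using tri_lt_swap[OF ii, of "\<alpha> \<circ> ?s"] lt by simp
  hence "\<not> tri_lt N (\<alpha> \<circ> ?s) \<alpha>" using tri_lt_trans[of N \<alpha> "\<alpha> \<circ> ?s" \<alpha>] tri_lt_irrefl \<alpha> ok by blast
  moreover have "(\<alpha> \<circ> ?s) i \<noteq> \<alpha> i" using lt by simp
  hence "\<alpha> \<circ> ?s \<noteq> \<alpha>" by metis
  ultimately have "p (\<alpha> \<circ> ?s) = 0" using isJ_D(3)[OF p] by blast
  thus "(act ?s p - sc (of_real (bJ i \<alpha> T)) p) (\<alpha> \<circ> ?s) = tp (rank_inv N (\<alpha> \<circ> ?s)) (bv T)"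
  proof -
    assume z: "p (\<alpha> \<circ> ?s) = 0"
    have "rank_inv N (\<alpha> \<circ> ?s) = ?s \<circ> rank_inv N \<alpha>" using rank_inv_swap[OF i] lt by simp
    hence "tp (rank_inv N (\<alpha> \<circ> ?s)) (bv T) = tp ?s (p \<alpha>)"
      using tp_comp[OF s rank_inv_permutes V_bv[OF T], of \<alpha>] isJ_D(2)[OF p] by simp
    thus ?thesis using z by (intro ext) (simp add: act_def)
  qed
qed (use T in auto)

text \<open>The effect of \<Theta> on exponents: (\<alpha>_2, ..., \<alpha>_N, \<alpha>_1 +
  1).\<close>

definition phi :: "mi \<Rightarrow> mi" where "phi \<alpha> = (\<alpha> \<circ> inv cyc)(N := \<alpha> 1 + 1)"

lemma cyc_1 [simp]: "cyc 1 = N" "cyc (Suc 0) = N"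
  using N_pos by (auto simp: cyc_def)

lemma phi_cyc: "k \<in> {1..N} \<Longrightarrow> phi \<alpha> (cyc k) = \<alpha> k + (if k = 1 then 1 else 0)"
proof -
  assume "k \<in> {1..N}"
  hence c: "cyc k = N \<longleftrightarrow> k = 1" by (auto simp: cyc_def)
  thus ?thesis using permutes_inverses(2)[OF cyc_permutes, of k] by (simp add: phi_def)
qed

lemma supp_ok_phi: "supp_ok N (phi \<alpha>) \<longleftrightarrow> supp_ok N \<alpha>"
  using N_pos supp_ok_comp[OF permutes_inv[OF cyc_permutes], of \<alpha>] by (simp add: phi_def supp_ok_upd)

lemma phi_sub: "((phi \<alpha>)(N := phi \<alpha> N - 1)) \<circ> cyc = \<alpha>"
proof -
  have "inv cyc N = 1" by (metis cyc_1(1) cyc_permutes permutes_inverses(2))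
  hence "(phi \<alpha>)(N := phi \<alpha> N - 1) = \<alpha> \<circ> inv cyc" by (auto simp: phi_def)
  thus ?thesis by (simp add: comp_assoc permutes_inv_o[OF cyc_permutes])
qed

text \<open>Position 1 wins all ties, position \<open>N\<close> loses them all. Raising the entry by
  1 compensates exactly, since \<alpha>_1 + 1 > \<alpha>_j is the same as \<alpha>_1 \<ge>
  \<alpha>_j.\<close>

lemma before_phi:
  assumes "i \<in> {1..N}" "j \<in> {1..N}"
  shows "before (phi \<alpha>) (cyc j) (cyc i) \<longleftrightarrow> before \<alpha> j i"
  using assms unfolding before_def phi_cyc[OF assms(1)] phi_cyc[OF assms(2)]
  by (cases "i = 1"; cases "j = 1"; auto simp: cyc_def)

lemma rank_phi: "k \<in> {1..N} \<Longrightarrow> rank N (phi \<alpha>) (cyc k) = rank N \<alpha> k"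
  by (intro rank_transfer cyc_permutes before_phi)

lemma isJ_Theta:
  assumes p: "isJ \<alpha> T p" and \<alpha>: "supp_ok N \<alpha>" and T: "T \<in> Y"
  shows "isJ (phi \<alpha>) T (Theta p)"
proof (rule isJ_I)
  note lp = isJ_D(1)[OF p]
  show "lp (Theta p)" using lp by (rule lp_Theta)
  have "rank_inv N (phi \<alpha>) = cyc \<circ> rank_inv N \<alpha>"
    by (intro rank_inv_transfer cyc_permutes before_phi)
  thus "Theta p (phi \<alpha>) = tp (rank_inv N (phi \<alpha>)) (bv T)"
    using isJ_D(2)[OF p] by (simp add: Theta_def xmul_def act_def phi_sub tp_comp[OF cyc_permutes rank_inv_permutes V_bv[OF T]])
  fix i assume i: "i \<in> {1..N}"
  have x: "xi N \<kappa> (phi \<alpha>) T (cyc k) = xi N \<kappa> \<alpha> T k + (if k = 1 then 1 else 0)" if "k \<in> {1..N}" for k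
    using phi_cyc[OF that] rank_phi[OF that] by (simp add: xi_def)
  show "UL i (Theta p) = sc (of_real (xi N \<kappa> (phi \<alpha>) T i)) (Theta p)"
  proof (cases "i = N")
    case True
    thus ?thesis using UL_N_Theta[OF lp] isJ_D(4)[OF p, of 1] x[of 1] N_pos
      by (simp add: Theta_sc sc_simps)
  next
    case False
    hence "i \<in> {1..<N}" "cyc (Suc i) = i" using i by (auto simp: cyc_def)
    thus ?thesis using UL_Theta[OF lp] isJ_D(4)[OF p, of "Suc i"] x[of "Suc i"] by (simp add: Theta_sc)
  qed
qed (use \<alpha> T in \<open>auto simp: supp_ok_phi\<close>)

text \<open>A positive last entry is removed by undoing \<Theta>, which lowers the degree. Otherwise
  the last positive entry is moved one place to the right, keeping the degree and lowering the
  second measure, and \<open>isJ_up\<close> leads back.\<close>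

lemma isJ_exists_nonneg:
  assumes T: "T \<in> Y" and "supp_ok N \<alpha>" "\<And>k. 0 \<le> \<alpha> k"
  shows "\<exists>p. isJ \<alpha> T p"
  using assms(2,3)
proof (induction \<alpha> rule: wf_induct_rule[OF wf_measures[of "[\<lambda>\<alpha>. nat (msum N \<alpha>), \<lambda>\<alpha>. nat (\<Sum>k\<in>{1..N}. (int N - int k) * \<alpha> k)]"]])
  case (1 \<alpha>)
  note ok = \<open>supp_ok N \<alpha>\<close>
  have N: "N \<in> {1..N}" using N_pos by simp
  consider "\<alpha> = (\<lambda>_. 0)" | "0 < \<alpha> N" | "\<alpha> \<noteq> (\<lambda>_. 0)" "\<alpha> N = 0" using "1.prems"(2)[of N] by linarith
  thus ?case
  proof cases
    case 1
    thus ?thesis using isJ_zero[OF T] by blast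
  next
    case 2
    define \<beta> where "\<beta> = \<alpha>(N := \<alpha> N - 1) \<circ> cyc"
    have "inv cyc N = 1" by (metis cyc_1(1) cyc_permutes permutes_inverses(2))
    have "\<beta> \<circ> inv cyc = \<alpha>(N := \<alpha> N - 1)"
      by (simp add: \<beta>_def comp_assoc permutes_inv_o[OF cyc_permutes])
    moreover have "\<beta> 1 = \<alpha> N - 1" by (simp add: \<beta>_def)
    ultimately have phi: "phi \<beta> = \<alpha>" by (auto simp: phi_def)
    hence \<beta>: "supp_ok N \<beta>" using ok supp_ok_phi by metis
    have "msum N \<beta> = msum N (\<alpha>(N := \<alpha> N - 1))" unfolding \<beta>_def by (rule msum_comp[OF cyc_permutes])
    also have "\<dots> = msum N \<alpha> - 1"
      using sum.remove[of "{1..N}" N "\<alpha>(N := \<alpha> N - 1)"] sum.remove[of "{1..N}" N \<alpha>] N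
      by (simp add: msum_def)
    finally have m: "msum N \<beta> = msum N \<alpha> - 1" .
    have nn: "0 \<le> \<beta> k" for k using "1.prems"(2) 2 by (auto simp: \<beta>_def)
    hence "0 \<le> msum N \<beta>" by (auto simp: msum_def intro: sum_nonneg)
    hence "nat (msum N \<beta>) < nat (msum N \<alpha>)" using m by simp
    hence "\<exists>p. isJ \<beta> T p" using \<beta> nn by (intro "1.IH") auto
    thus ?thesis using isJ_Theta[OF _ \<beta> T] phi by metis
  next
    case 3
    define A where "A = {k\<in>{1..N}. 0 < \<alpha> k}"
    obtain k where "\<alpha> k \<noteq> 0" using 3 by auto
    hence "k \<in> A" using ok "1.prems"(2)[of k] unfolding A_def supp_ok_def by force
    define i where "i = Max A"
    have fin: "finite A" by (simp add: A_def)
    have iA: "i \<in> A" unfolding i_def using fin \<open>k \<in> A\<close> by (intro Max_in) auto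
    have i: "i \<in> {1..<N}" "0 < \<alpha> i" using iA 3(2) by (auto simp: A_def nat_less_le)
    have "Suc i \<notin> A" using Max_ge[OF fin, of "Suc i"] unfolding i_def by auto
    hence z: "\<alpha> (Suc i) = 0" using i "1.prems"(2)[of "Suc i"] by (auto simp: A_def)
    let ?s = "sw i (Suc i)"
    have s: "?s permutes {1..N}" using i by (intro sw_permutes) auto
    define \<beta> where "\<beta> = \<alpha> \<circ> ?s"
    have \<beta>: "supp_ok N \<beta>" "\<And>k. 0 \<le> \<beta> k" "\<beta> i < \<beta> (Suc i)" "\<beta> \<circ> ?s = \<alpha>"
      using ok supp_ok_comp[OF s] "1.prems"(2) z i by (auto simp: \<beta>_def)
    have ii: "i \<in> {1..N}" "Suc i \<in> {1..N}" "i \<noteq> Suc i" using i by auto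
    have rest: "(\<Sum>k\<in>{1..N} - {i, Suc i}. (int N - int k) * \<beta> k) = (\<Sum>k\<in>{1..N} - {i, Suc i}. (int N - int k) * \<alpha> k)"
      by (intro sum.cong) (auto simp: \<beta>_def)
    have "(\<Sum>k\<in>{1..N}. (int N - int k) * \<beta> k) < (\<Sum>k\<in>{1..N}. (int N - int k) * \<alpha> k)"
      unfolding sum_two[OF ii finite_atLeastAtMost] rest using z i by (simp add: \<beta>_def algebra_simps)
    moreover have "0 \<le> (\<Sum>k\<in>{1..N}. (int N - int k) * \<beta> k)" using \<beta>(2) by (intro sum_nonneg) auto
    moreover have "msum N \<beta> = msum N \<alpha>" unfolding \<beta>_def by (rule msum_comp[OF s])
    ultimately have "\<exists>p. isJ \<beta> T p" using \<beta> by (intro "1.IH") auto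
    thus ?thesis using isJ_up[OF _ \<beta>(1) T i(1) \<beta>(3)] \<beta>(4) by auto
  qed
qed

lemma isJ_exists:
  assumes T: "T \<in> Y" and \<alpha>: "supp_ok N \<alpha>"
  shows "\<exists>p. isJ \<alpha> T p"
proof -
  define m where "m = max 0 (- Min (\<alpha> ` {1..N}))"
  have "0 \<le> upm m \<alpha> k" for k
  proof (cases "k \<in> {1..N}")
    case True
    hence "Min (\<alpha> ` {1..N}) \<le> \<alpha> k" by (intro Min_le) auto
    moreover have "- Min (\<alpha> ` {1..N}) \<le> m" unfolding m_def by (rule max.cobounded2)
    moreover have "upm m \<alpha> k = \<alpha> k + m" using True by (simp add: upm_def)
    ultimately show ?thesis by linarith
  next
    case False
    have "upm m \<alpha> k = \<alpha> k" using False by (simp only: upm_def if_False)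
    moreover have "\<alpha> k = 0" using \<alpha> False unfolding supp_ok_def by blast
    ultimately show ?thesis by simp
  qed
  then obtain p where "isJ (upm m \<alpha>) T p" using isJ_exists_nonneg[OF T, of "upm m \<alpha>"] \<alpha> by auto
  from isJ_shiftm[OF this _ T, of "-m"] show ?thesis using \<alpha> by auto
qed

section \<open>Simple transpositions in the Jack basis\<close>

definition J :: "mi \<Rightarrow> tab \<Rightarrow> lpoly" where "J \<alpha> T = (THE p. isJ \<alpha> T p)"

lemma J_isJ: assumes "T \<in> Y" "supp_ok N \<alpha>" shows "isJ \<alpha> T (J \<alpha> T)"
proof -
  obtain p where p: "isJ \<alpha> T p" using isJ_exists[OF assms] by blast
  moreover have "J \<alpha> T = p"
    unfolding J_def using p isJ_unique[OF _ p assms(2,1)] by (rule the_equality)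
  ultimately show ?thesis by simp
qed

lemma J_eqI: "isJ \<alpha> T p \<Longrightarrow> T \<in> Y \<Longrightarrow> supp_ok N \<alpha> \<Longrightarrow> J \<alpha> T = p"
  using J_isJ isJ_unique by blast

lemma lp_J: "T \<in> Y \<Longrightarrow> supp_ok N \<alpha> \<Longrightarrow> lp (J \<alpha> T)"
  using J_isJ isJ_D(1) by blast

lemma zeta_eq_J:
  assumes T: "T \<in> Y" and \<alpha>: "supp_ok N \<alpha>" and nn: "\<And>k. 0 \<le> \<alpha> k"
  shows "zeta N \<tau> \<kappa> \<alpha> T = J \<alpha> T"
proof -
  note J = J_isJ[OF T \<alpha>]
  have scU: "cherednik N \<tau> \<kappa> i p = (\<lambda>\<beta> S. complex_of_real (xi N \<kappa> \<alpha> T i) * p \<beta> S) \<longleftrightarrow>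
     UL i p = sc (of_real (xi N \<kappa> \<alpha> T i)) p" if "is_poly N \<tau> p" for i p
    unfolding cherednik_eq_UL[OF that] sc_def ..
  have poly: "is_poly N \<tau> (J \<alpha> T)"
    unfolding is_poly_def
  proof (intro conjI allI impI)
    show "lp (J \<alpha> T)" by (rule isJ_D(1)[OF J])
    fix \<beta> k assume b: "J \<alpha> T \<beta> \<noteq> 0"
    show "0 \<le> \<beta> k"
    proof (cases "k \<in> {1..N} \<and> \<beta> \<noteq> \<alpha>")
      case True
      thus ?thesis using tri_lt_lower_bound[OF isJ_D(3)[OF J _ b]] nn by blast
    next
      case False
      moreover have "supp_ok N \<beta>" using lp_supp[OF isJ_D(1)[OF J] b] .
      ultimately show ?thesis using nn unfolding supp_ok_def by (metis order_refl)
    qed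
  qed
  show ?thesis unfolding zeta_def
  proof (rule the_equality)
    show "is_poly N \<tau> (J \<alpha> T) \<and> J \<alpha> T \<alpha> = tp (rank_inv N \<alpha>) (bv T) \<and> (\<forall>\<beta>. \<beta> \<noteq> \<alpha> \<and> J \<alpha> T \<beta> \<noteq> 0 \<longrightarrow> tri_lt N \<beta> \<alpha>)
       \<and> (\<forall>i\<in>{1..N}. cherednik N \<tau> \<kappa> i (J \<alpha> T) = (\<lambda>\<beta> S. complex_of_real (xi N \<kappa> \<alpha> T i) * J \<alpha> T \<beta> S))"
      using poly scU[OF poly] isJ_D[OF J] by blast
  next
    fix p
    assume p: "is_poly N \<tau> p \<and> p \<alpha> = tp (rank_inv N \<alpha>) (bv T) \<and> (\<forall>\<beta>. \<beta> \<noteq> \<alpha> \<and> p \<beta> \<noteq> 0 \<longrightarrow> tri_lt N \<beta> \<alpha>)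
       \<and> (\<forall>i\<in>{1..N}. cherednik N \<tau> \<kappa> i p = (\<lambda>\<beta> S. complex_of_real (xi N \<kappa> \<alpha> T i) * p \<beta> S))"
    hence "isJ \<alpha> T p" using scU unfolding isJ_def by (auto simp: is_poly_def)
    thus "p = J \<alpha> T" using J_eqI[OF _ T \<alpha>] by simp
  qed
qed

lemma zetaL_eq_J:
  assumes T: "T \<in> Y" and \<alpha>: "supp_ok N \<alpha>"
  shows "zetaL N \<tau> \<kappa> \<alpha> T = J \<alpha> T"
proof -
  define m where "m = max 0 (- Min (\<alpha> ` {1..N}))"
  have nn: "0 \<le> upm m \<alpha> k" for k
  proof (cases "k \<in> {1..N}")
    case True
    hence "Min (\<alpha> ` {1..N}) \<le> \<alpha> k" by (intro Min_le) auto
    moreover have "- Min (\<alpha> ` {1..N}) \<le> m" unfolding m_def by (rule max.cobounded2)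
    moreover have "upm m \<alpha> k = \<alpha> k + m" using True by (simp add: upm_def)
    ultimately show ?thesis by linarith
  next
    case False
    have "upm m \<alpha> k = \<alpha> k" using False by (simp only: upm_def if_False)
    moreover have "\<alpha> k = 0" using \<alpha> False unfolding supp_ok_def by blast
    ultimately show ?thesis by simp
  qed
  have "zetaL N \<tau> \<kappa> \<alpha> T = shiftm N m (J (upm m \<alpha>) T)"
    unfolding zetaL_def Let_def m_def[symmetric] upm_def[symmetric]
    using zeta_eq_J[OF T, of "upm m \<alpha>"] nn \<alpha> by simp
  also have "\<dots> = J \<alpha> T"
    using isJ_shiftm[OF J_isJ[OF T, of "upm m \<alpha>"] _ T, of "-m"] \<alpha> J_eqI[OF _ T \<alpha>] by simp
  finally show ?thesis .
qed

lemma J_Theta: "T \<in> Y \<Longrightarrow> supp_ok N \<alpha> \<Longrightarrow> Theta (J \<alpha> T) = J (phi \<alpha>) T"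
  using J_eqI[OF isJ_Theta[OF J_isJ]] supp_ok_phi by metis

lemma J_up:
  assumes T: "T \<in> Y" and \<alpha>: "supp_ok N \<alpha>" and i: "i \<in> {1..<N}" and lt: "\<alpha> i < \<alpha> (Suc i)"
  shows "act (sw i (Suc i)) (J \<alpha> T) = sc (of_real (bJ i \<alpha> T)) (J \<alpha> T) + J (\<alpha> \<circ> sw i (Suc i)) T"
proof -
  have "sw i (Suc i) permutes {1..N}" using i by (intro sw_permutes) auto
  hence "supp_ok N (\<alpha> \<circ> sw i (Suc i))" using \<alpha> supp_ok_comp by blast
  from J_eqI[OF isJ_up[OF J_isJ[OF T \<alpha>] \<alpha> T i lt] T this] show ?thesis by simp
qed

lemma bJ_swap:
  assumes "i \<in> {1..<N}" "\<alpha> i \<noteq> \<alpha> (Suc i)"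
  shows "bJ i (\<alpha> \<circ> sw i (Suc i)) T = - bJ i \<alpha> T"
  unfolding bJ_def using assms xi_swap[of i \<alpha> i T] xi_swap[of i \<alpha> "Suc i" T]
  by (simp add: divide_simps) (simp add: algebra_simps)

text \<open>Solved from \<open>J_up\<close> at the transposed exponent, using that the transposition
  is an involution and that \<open>bJ\<close> changes sign.\<close>

lemma J_down:
  assumes T: "T \<in> Y" and \<alpha>: "supp_ok N \<alpha>" and i: "i \<in> {1..<N}" and lt: "\<alpha> (Suc i) < \<alpha> i"
  shows "act (sw i (Suc i)) (J \<alpha> T) = sc (of_real (bJ i \<alpha> T)) (J \<alpha> T)
     + sc (of_real (1 - (bJ i \<alpha> T)\<^sup>2)) (J (\<alpha> \<circ> sw i (Suc i)) T)"
proof -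
  let ?s = "sw i (Suc i)"
  let ?\<beta> = "\<alpha> \<circ> ?s"
  have s: "?s permutes {1..N}" using i by (intro sw_permutes) auto
  have \<beta>: "supp_ok N ?\<beta>" using \<alpha> supp_ok_comp[OF s] by blast
  have up: "act ?s (J ?\<beta> T) = sc (of_real (- bJ i \<alpha> T)) (J ?\<beta> T) + J \<alpha> T"
    using J_up[OF T \<beta> i] lt bJ_swap[OF i, of \<alpha> T] by simp
  hence "act ?s (act ?s (J ?\<beta> T)) = sc (of_real (- bJ i \<alpha> T)) (act ?s (J ?\<beta> T)) + act ?s (J \<alpha> T)"
    by (simp add: act_add act_sc)
  hence "J ?\<beta> T = sc (of_real (- bJ i \<alpha> T)) (act ?s (J ?\<beta> T)) + act ?s (J \<alpha> T)"
    using act_s_s[OF lp_J[OF T \<beta>] i] by simp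
  hence "act ?s (J \<alpha> T) = J ?\<beta> T - sc (of_real (- bJ i \<alpha> T)) (act ?s (J ?\<beta> T))"
    by (metis add_diff_cancel_left')
  thus ?thesis unfolding up by (simp add: fun_eq_iff algebra_simps power2_eq_square)
qed

lemma rank_Suc_eq: "\<alpha> i = \<alpha> (Suc i) \<Longrightarrow> rank N \<alpha> (Suc i) = Suc (rank N \<alpha> i)"
proof -
  assume a: "\<alpha> i = \<alpha> (Suc i)"
  have "{j\<in>{1..Suc i}. \<alpha> j = \<alpha> (Suc i)} = insert (Suc i) {j\<in>{1..i}. \<alpha> j = \<alpha> i}"
    using a by (auto simp: le_Suc_eq)
  thus ?thesis using a by (simp add: rank_def)
qed

lemma rank_sw_eq:
  assumes i: "i \<in> {1..<N}" and eq: "\<alpha> i = \<alpha> (Suc i)" and k: "k \<in> {1..N}"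
  shows "rank N \<alpha> (sw i (Suc i) k) = sw (rank N \<alpha> i) (Suc (rank N \<alpha> i)) (rank N \<alpha> k)"
proof -
  have ii: "i \<in> {1..N}" "Suc i \<in> {1..N}" using i by auto
  have inj: "inj_on (rank N \<alpha>) {1..N}" using rank_bij by (auto simp: bij_betw_def)
  have "rank N \<alpha> k = rank N \<alpha> i \<longleftrightarrow> k = i" "rank N \<alpha> k = rank N \<alpha> (Suc i) \<longleftrightarrow> k = Suc i"
    using inj_onD[OF inj _ k ii(1)] inj_onD[OF inj _ k ii(2)] by blast+
  thus ?thesis unfolding rank_Suc_eq[OF eq] using rank_Suc_eq[OF eq] by (simp add: sw_def)
qed

text \<open>The transposition fixes x^\<alpha>, so on the leading coefficient it acts through the
  rank permutation as Young's generator number \<open>j\<close>. The difference of the two sides is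
  a joint eigenvector without the exponent \<alpha>, hence zero.\<close>

lemma J_same:
  assumes T: "T \<in> Y" and \<alpha>: "supp_ok N \<alpha>" and i: "i \<in> {1..<N}" and eq: "\<alpha> i = \<alpha> (Suc i)"
  defines "j \<equiv> rank N \<alpha> i"
  shows "act (sw i (Suc i)) (J \<alpha> T) = sc (of_real (bq j T)) (J \<alpha> T) + sc (of_real (gq j T)) (J \<alpha> (T \<circ> sw j (Suc j)))"
proof -
  let ?s = "sw i (Suc i)" and ?T = "T \<circ> sw j (Suc j)" and ?r = "rank_inv N \<alpha>"
  have s: "?s permutes {1..N}" using i by (intro sw_permutes) auto
  have ii: "i \<in> {1..N}" "Suc i \<in> {1..N}" using i by auto
  have rs: "rank N \<alpha> (Suc i) = Suc j" using rank_Suc_eq[of \<alpha> i] eq by (simp add: j_def)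
  have j: "j \<in> {1..<N}" using rank_in[OF ii(1), of \<alpha>] rank_in[OF ii(2), of \<alpha>] rs by (auto simp: j_def)
  have sj: "sw j (Suc j) permutes {1..N}" using j by (intro sw_permutes) auto
  have \<alpha>s: "\<alpha> \<circ> ?s = \<alpha>" using eq by (auto simp: fun_eq_iff sw_def)
  define p where "p = J \<alpha> T"
  have p: "isJ \<alpha> T p" unfolding p_def by (rule J_isJ[OF T \<alpha>])
  note lp = isJ_D(1)[OF p]
  define q where "q = act ?s p - sc (of_real (bq j T)) p"
  define r where "r = q - sc (of_real (gq j T)) (J \<alpha> ?T)"
  have "cont j T \<noteq> cont (Suc j) T" using cont_neq[OF T] j by auto
  hence b: "bq j T * (xi N \<kappa> \<alpha> T i - xi N \<kappa> \<alpha> T (Suc i)) = \<kappa>"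
    unfolding xi_def bq_def rs j_def[symmetric] eq by (simp add: field_simps)
  have lq: "lp q" unfolding q_def using lp s by (intro lp_diff lp_act lp_sc)
  have eq_q: "UL k q = sc (of_real (xi N \<kappa> \<alpha> T (?s k))) q" if "k \<in> {1..N}" for k
    unfolding q_def by (rule eigen_swap[OF lp i isJ_D(4)[OF p] b that])
  have sk: "?s k \<in> {1..N}" if "k \<in> {1..N}" for k using that ii by (auto simp: sw_def)
  have J': "lp (sc (of_real (gq j T)) (J \<alpha> ?T)) \<and>
      UL k (sc (of_real (gq j T)) (J \<alpha> ?T)) = sc (of_real (xi N \<kappa> \<alpha> T (?s k))) (sc (of_real (gq j T)) (J \<alpha> ?T))" if "k \<in> {1..N}" for k
  proof (cases "?T \<in> Y")
    case True
    have "xi N \<kappa> \<alpha> ?T k = xi N \<kappa> \<alpha> T (?s k)"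
      using rank_sw_eq[OF i eq that] fun_cong[OF \<alpha>s, of k] unfolding xi_def j_def cont_comp_sw by simp
    thus ?thesis using isJ_D(4)[OF J_isJ[OF True \<alpha>] that] lp_J[OF True \<alpha>]
      by (simp add: lp_sc UL_sc sc_simps mult.commute)
  next
    \<comment> \<open>\<open>J \<alpha> ?T\<close> has no specified value for a nonstandard filling,
      but then its coefficient \<open>gq j T\<close> is 0.\<close>
    case False
    hence "gq j T = 0" using gq_eq_0_iff[OF T j] by simp
    thus ?thesis using UL_sc[OF lp, of k 0] by (simp add: sc_simps lp_0 fun_eq_iff)
  qed
  have lr: "lp r" unfolding r_def using lq J'[of 1] N_pos by (intro lp_diff) auto
  have eig_r: "UL k r = sc (of_real (xi N \<kappa> \<alpha> T (?s k))) r" if "k \<in> {1..N}" for k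
    unfolding r_def using J'[OF that] eq_q[OF that] lq by (simp add: UL_diff sc_simps)
  have "r \<alpha> = 0"
  proof -
    have rj: "?r j = i" "?r (Suc j) = Suc i"
      using rank_inv_rank[OF ii(1), of \<alpha>] rank_inv_rank[OF ii(2), of \<alpha>] rs by (simp_all add: j_def)
    have "tp ?s (p \<alpha>) = tp (?s \<circ> ?r) (bv T)"
      using isJ_D(2)[OF p] tp_comp[OF s rank_inv_permutes V_bv[OF T]] by simp
    also have "?s \<circ> ?r = ?r \<circ> sw j (Suc j)"
      using sw_conj[OF permutes_bij[OF rank_inv_permutes[of N \<alpha>]], of j "Suc j"] rj by simp
    also have "tp (?r \<circ> sw j (Suc j)) (bv T) = tp ?r (tau_s N \<tau> j (bv T))"
      using tp_comp[OF rank_inv_permutes sj V_bv[OF T]] tp_s[OF j V_bv[OF T]] by simp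
    also have "\<dots> = (\<lambda>S. of_real (bq j T) * p \<alpha> S + of_real (gq j T) * tp ?r (bv ?T) S)"
      unfolding tau_s_bv[OF T j] tp_add tp_scale isJ_D(2)[OF p] ..
    finally have sp: "tp ?s (p \<alpha>) = (\<lambda>S. of_real (bq j T) * p \<alpha> S + of_real (gq j T) * tp ?r (bv ?T) S)" .
    have g: "of_real (gq j T) * J \<alpha> ?T \<alpha> S = of_real (gq j T) * tp ?r (bv ?T) S" for S
      using isJ_D(2)[OF J_isJ[OF _ \<alpha>]] gq_eq_0_iff[OF T j] by (cases "?T \<in> Y") (auto simp del: o_apply)
    have "r \<alpha> S = 0" for S using g[of S] by (auto simp: r_def q_def act_def \<alpha>s sp)
    thus ?thesis by (simp add: fun_eq_iff)
  qed
  moreover have "1 \<in> {1..N}" using N_pos by simp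
  ultimately have "r = 0"
    using lr eig_r T \<alpha> rank_in[OF sk] fun_cong[OF \<alpha>s, unfolded comp_apply]
    by (intro joint_eigenvector_zero[of r "\<lambda>k. xi N \<kappa> \<alpha> T (?s k)" \<alpha> "\<lambda>k. rank N \<alpha> (?s k)" T])
      (simp_all only: xi_def)
  thus ?thesis by (simp add: r_def q_def p_def algebra_simps)
qed

end

section \<open>The basis of Jack polynomials and the form\<close>

context jack begin

abbreviation "K \<equiv> Idx N \<tau>"

definition Z :: "mi \<times> tab \<Rightarrow> lpoly" where "Z k = J (fst k) (snd k)"

lemma K_iff: "k \<in> K \<longleftrightarrow> supp_ok N (fst k) \<and> snd k \<in> Y"
  by (cases k) (simp add: Idx_def)

lemma lp_Z: "k \<in> K \<Longrightarrow> lp (Z k)"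
  by (auto simp: K_iff Z_def lp_J)

lemma Z_isJ: "k \<in> K \<Longrightarrow> isJ (fst k) (snd k) (Z k)"
  by (auto simp: K_iff Z_def J_isJ)

definition valid :: "(mi \<times> tab \<Rightarrow> complex) \<Rightarrow> bool" where
  "valid c \<longleftrightarrow> finite {k. c k \<noteq> 0} \<and> (\<forall>k. c k \<noteq> 0 \<longrightarrow> k \<in> K)"

definition expand :: "(mi \<times> tab \<Rightarrow> complex) \<Rightarrow> lpoly" where
  "expand c = (\<Sum>k\<in>{k. c k \<noteq> 0}. sc (c k) (Z k))"

lemma expand_sup: "finite B \<Longrightarrow> {k. c k \<noteq> 0} \<subseteq> B \<Longrightarrow> expand c = (\<Sum>k\<in>B. sc (c k) (Z k))"
  unfolding expand_def by (intro sum.mono_neutral_left) (auto simp: sc_simps)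

lemma expand_add: assumes "valid c" "valid d" shows "expand (\<lambda>k. c k + d k) = expand c + expand d"
  using assms unfolding valid_def
  by (subst (1 2 3) expand_sup[of "{k. c k \<noteq> 0} \<union> {k. d k \<noteq> 0}"]) (auto simp: sc_simps sum.distrib)

lemma sc_sum: "sc a (\<Sum>k\<in>A. f k) = (\<Sum>k\<in>A. sc a (f k))"
proof (induction A rule: infinite_finite_induct)
  case (insert k A)
  show ?case by (simp only: sum.insert[OF insert.hyps] sc_simps(1) insert.IH)
qed (simp_all add: fun_eq_iff)

lemma expand_sc: assumes "valid c" shows "expand (\<lambda>k. a * c k) = sc a (expand c)"
  using assms unfolding valid_def
  by (subst (1 2) expand_sup[of "{k. c k \<noteq> 0}"]) (auto simp: sc_sum sc_simps)

lemma valid_add: assumes "valid c" "valid d" shows "valid (\<lambda>k. c k + d k)"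
  unfolding valid_def
proof
  have "{k. c k + d k \<noteq> 0} \<subseteq> {k. c k \<noteq> 0} \<union> {k. d k \<noteq> 0}" by auto
  thus "finite {k. c k + d k \<noteq> 0}" by (rule finite_subset) (use assms in \<open>simp add: valid_def\<close>)
  show "\<forall>k. c k + d k \<noteq> 0 \<longrightarrow> k \<in> K" using assms unfolding valid_def by (metis add_0)
qed

lemma valid_sc: "valid c \<Longrightarrow> valid (\<lambda>k. a * c k)"
  unfolding valid_def by (auto elim: rev_finite_subset)

lemma valid_delta: "k \<in> K \<Longrightarrow> valid (\<lambda>l. if l = k then 1 else 0)"
  by (auto simp: valid_def)

lemma expand_delta: "expand (\<lambda>l. if l = k then 1 else 0) = Z k"
  by (subst expand_sup[of "{k}"]) (auto simp: sc_simps)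

lemma sum_fun_apply: "(\<Sum>k\<in>A. f k) x = (\<Sum>k\<in>A. f k x)"
  by (induction A rule: infinite_finite_induct) auto

text \<open>At an exponent maximal among the indices in use, only polynomials with that very
  exponent contribute. Their leading coefficients are the images of distinct tableaux under one
  invertible operator.\<close>

lemma expand_eq_0:
  assumes c: "valid c" and e: "expand c = 0"
  shows "c k = 0"
proof (rule ccontr)
  assume "c k \<noteq> 0"
  define B where "B = {k. c k \<noteq> 0}"
  have B: "finite B" "\<And>k. k \<in> B \<Longrightarrow> k \<in> K" "k \<in> B" using c \<open>c k \<noteq> 0\<close> by (auto simp: B_def valid_def)
  obtain \<alpha> where \<alpha>: "\<alpha> \<in> fst ` B" "\<And>\<beta>. \<beta> \<in> fst ` B \<Longrightarrow> \<not> tri_lt N \<alpha> \<beta>"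
  proof -
    have "\<And>a. a \<in> fst ` B \<Longrightarrow> supp_ok N a" using B(2) K_iff by blast
    from tri_lt_maximal[OF finite_imageI[OF B(1)] this imageI[OF B(3)]] show ?thesis using that by blast
  qed
  then obtain T0 where T0: "(\<alpha>, T0) \<in> B" by auto
  hence \<alpha>T: "supp_ok N \<alpha>" "T0 \<in> Y" using B(2)[OF T0] by (auto simp: K_iff)
  define v where "v = (\<lambda>T. c (\<alpha>, T))"
  have v: "v \<in> V" using c by (auto simp: V_def v_def valid_def K_iff)
  let ?r = "rank_inv N \<alpha>"
  have "tp ?r v S = expand c \<alpha> S" for S
  proof -
    have "expand c \<alpha> S = (\<Sum>k\<in>B. c k * Z k \<alpha> S)"
      by (simp add: expand_def B_def sum_fun_apply)
    also have "\<dots> = (\<Sum>k\<in>Pair \<alpha> ` Y. c k * Z k \<alpha> S)"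
    proof (rule sum.mono_neutral_cong)
      show "finite (Pair \<alpha> ` Y)" using finite_Y by simp
      fix k assume k: "k \<in> B - Pair \<alpha> ` Y"
      hence kK: "k \<in> K" using B by auto
      have ne: "\<alpha> \<noteq> fst k"
      proof
        assume "\<alpha> = fst k"
        hence "k = Pair \<alpha> (snd k)" by simp
        thus False using k kK unfolding K_iff by blast
      qed
      have "Z k \<alpha> = 0"
        using isJ_D(3)[OF Z_isJ[OF kK] ne] \<alpha>(2)[of "fst k"] k by auto
      thus "c k * Z k \<alpha> S = 0" by simp
    qed (use B in \<open>auto simp: B_def\<close>)
    also have "\<dots> = (\<Sum>T\<in>Y. v T * tp ?r (bv T) S)"
      using isJ_D(2)[OF J_isJ[OF _ \<alpha>T(1)]] by (subst sum.reindex) (auto simp: inj_on_def Z_def v_def)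
    also have "\<dots> = tp ?r v S"
      unfolding tp_sum[symmetric, THEN fun_cong] V_expand[OF v, symmetric] ..
    finally show ?thesis by simp
  qed
  hence "tp ?r v = 0" using e by (auto simp: fun_eq_iff)
  hence "v = 0" using tp_inv[OF rank_inv_permutes[of N \<alpha>] v] by (simp add: tp_0)
  hence "v T0 = 0" by simp
  thus False using T0 by (simp add: v_def B_def)
qed

lemma expand_inj:
  assumes "valid c" "valid d" "expand c = expand d"
  shows "c = d"
proof
  fix k
  have v: "valid (\<lambda>k. c k + (-1) * d k)" by (intro valid_add valid_sc assms)
  have "expand (\<lambda>k. c k + (-1) * d k) = expand c + sc (-1) (expand d)"
    by (subst expand_add) (simp_all only: assms valid_sc expand_sc)
  also have "\<dots> = 0" using assms(3) by (simp add: fun_eq_iff)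
  finally show "c k = d k" using expand_eq_0[OF v, of k] by simp
qed

section \<open>Spanning, with control of the degree\<close>

definition Sp :: "(mi \<times> tab) set \<Rightarrow> lpoly \<Rightarrow> bool" where
  "Sp A f \<longleftrightarrow> (\<exists>c. valid c \<and> (\<forall>k. c k \<noteq> 0 \<longrightarrow> k \<in> A) \<and> f = expand c)"

lemma Sp_add: assumes "Sp A f" "Sp A g" shows "Sp A (f + g)"
proof -
  obtain c d where c: "valid c" "\<And>k. c k \<noteq> 0 \<Longrightarrow> k \<in> A" "f = expand c"
    and d: "valid d" "\<And>k. d k \<noteq> 0 \<Longrightarrow> k \<in> A" "g = expand d"
    using assms unfolding Sp_def by blast
  show ?thesis unfolding Sp_def
  proof (intro exI[of _ "\<lambda>k. c k + d k"] conjI allI impI)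
    show "valid (\<lambda>k. c k + d k)" using c(1) d(1) by (rule valid_add)
    show "f + g = expand (\<lambda>k. c k + d k)" using expand_add[OF c(1) d(1)] c(3) d(3) by simp
    fix k assume "c k + d k \<noteq> 0"
    hence "c k \<noteq> 0 \<or> d k \<noteq> 0" by auto
    thus "k \<in> A" using c(2) d(2) by blast
  qed
qed

lemma Sp_sc: assumes "Sp A f" shows "Sp A (sc a f)"
proof -
  obtain c where "valid c" "\<forall>k. c k \<noteq> 0 \<longrightarrow> k \<in> A" "f = expand c"
    using assms by (auto simp: Sp_def)
  thus ?thesis unfolding Sp_def
    by (intro exI[of _ "\<lambda>k. a * c k"]) (auto simp: valid_sc expand_sc)
qed

lemma Sp_0: "Sp A 0"
  unfolding Sp_def by (intro exI[of _ "\<lambda>_. 0"]) (simp add: valid_def expand_def)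

lemma Sp_sum: "(\<And>k. k \<in> B \<Longrightarrow> Sp A (f k)) \<Longrightarrow> Sp A (sum f B)"
  by (induction B rule: infinite_finite_induct) (auto intro: Sp_0 Sp_add)

lemma Sp_Z: "k \<in> K \<Longrightarrow> k \<in> A \<Longrightarrow> Sp A (Z k)"
  unfolding Sp_def using valid_delta[of k] expand_delta[of k]
  by (intro exI[of _ "\<lambda>l. if l = k then 1 else 0"]) auto

lemma Sp_mono: "Sp A f \<Longrightarrow> A \<subseteq> B \<Longrightarrow> Sp B f"
  unfolding Sp_def by blast

lemma lp_decompose: assumes "lp p" shows "p = (\<Sum>\<beta>\<in>supp p. monov \<beta> (p \<beta>))"
proof (intro ext)
  fix \<gamma> S
  have "(\<Sum>\<beta>\<in>supp p. monov \<beta> (p \<beta>)) \<gamma> S = (\<Sum>\<beta>\<in>supp p. if \<beta> = \<gamma> then p \<gamma> S else 0)"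
    by (auto simp: sum_fun_apply monov_def intro!: sum.cong)
  thus "p \<gamma> S = (\<Sum>\<beta>\<in>supp p. monov \<beta> (p \<beta>)) \<gamma> S"
    using lp_finite[OF assms] by (auto simp: sum.delta)
qed

text \<open>Entries may be negative, so the bound comes from both sides: the minimum of \<alpha>
  bounds every entry from below, and together with the fixed total this also bounds each entry from
  above.\<close>

lemma finite_tri_lt_below:
  "finite {\<beta>. supp_ok N \<beta> \<and> tri_lt N \<beta> \<alpha>}"
proof -
  define c where "c = Min (\<alpha> ` {1..N})"
  have c: "c \<le> \<alpha> k" if "k \<in> {1..N}" for k unfolding c_def using that by (intro Min_le) auto
  define M where "M = msum N \<alpha> - int (N - 1) * c"
  have "{\<beta>. supp_ok N \<beta> \<and> tri_lt N \<beta> \<alpha>} \<subseteq> {\<beta>. \<forall>k. (k \<in> {1..N} \<longrightarrow> \<beta> k \<in> {c..M}) \<and> (k \<notin> {1..N} \<longrightarrow> \<beta> k = 0)}"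
  proof (intro subsetI CollectI allI conjI impI)
    fix \<beta> k assume b: "\<beta> \<in> {\<beta>. supp_ok N \<beta> \<and> tri_lt N \<beta> \<alpha>}"
    have lo: "c \<le> \<beta> l" if "l \<in> {1..N}" for l using tri_lt_lower_bound[of N \<beta> \<alpha> c l] c that b by blast
    show "\<beta> k \<in> {c..M}" if k: "k \<in> {1..N}"
    proof -
      have "of_nat (card ({1..N} - {k})) * c \<le> sum \<beta> ({1..N} - {k})"
        using lo by (intro sum_bounded_below) auto
      moreover have "sum \<beta> {1..N} = \<beta> k + sum \<beta> ({1..N} - {k})" using k by (simp add: sum.remove)
      moreover have "sum \<beta> {1..N} = msum N \<alpha>" using b by (simp add: tri_lt_def msum_def)
      ultimately show ?thesis using lo[OF k] k by (simp add: M_def)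
    qed
    show "k \<notin> {1..N} \<Longrightarrow> \<beta> k = 0" using b unfolding supp_ok_def by blast
  qed
  thus ?thesis by (rule finite_subset) (intro finite_set_of_finite_funs; simp)
qed

text \<open>A combination of Jack polynomials with exponent \<alpha> matches the leading term, and
  the remainder involves only lower exponents. Recording the degree of the indices yields
  orthogonality of different degrees.\<close>

lemma Sp_monov:
  assumes "supp_ok N \<alpha>" "v \<in> V"
  shows "Sp {k\<in>K. msum N (fst k) = msum N \<alpha>} (monov \<alpha> v)"
  using assms
proof (induction "card {\<beta>. supp_ok N \<beta> \<and> tri_lt N \<beta> \<alpha>}" arbitrary: \<alpha> v rule: less_induct)
  case less
  let ?A = "{k\<in>K. msum N (fst k) = msum N \<alpha>}" and ?r = "rank_inv N \<alpha>"
  note \<alpha> = \<open>supp_ok N \<alpha>\<close>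
  have r: "?r permutes {1..N}" by (rule rank_inv_permutes)
  define a where "a = tp (inv ?r) v"
  have aV: "a \<in> V" unfolding a_def by (intro tp_V permutes_inv r less.prems)
  define q where "q = (\<Sum>T\<in>Y. sc (a T) (J \<alpha> T))"
  have lq: "lp q" unfolding q_def by (intro lp_sum lp_sc lp_J \<alpha>)
  have Sq: "Sp ?A q" unfolding q_def
    using \<alpha> Sp_Z[of "(\<alpha>, _)" ?A] by (intro Sp_sum Sp_sc) (auto simp: Z_def K_iff)
  have q\<alpha>: "q \<alpha> = v"
  proof -
    have "q \<alpha> S = tp ?r a S" for S
    proof -
      have "q \<alpha> S = (\<Sum>T\<in>Y. a T * tp ?r (bv T) S)"
        unfolding q_def using isJ_D(2)[OF J_isJ[OF _ \<alpha>]] by (simp add: sum_fun_apply)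
      thus ?thesis unfolding tp_sum[symmetric, THEN fun_cong] V_expand[OF aV, symmetric] .
    qed
    thus ?thesis unfolding a_def using tp_inv'[OF r less.prems(2)] by auto
  qed
  define p where "p = monov \<alpha> v - q"
  have lp: "lp p" unfolding p_def by (intro lp_diff lp_monov less.prems lq)
  have low: "supp_ok N \<beta> \<and> tri_lt N \<beta> \<alpha>" if "p \<beta> \<noteq> 0" for \<beta>
  proof -
    have ne: "\<beta> \<noteq> \<alpha>" using that q\<alpha> by (auto simp: p_def monov_def)
    have "q \<beta> \<noteq> 0" using that ne by (auto simp: p_def monov_def)
    moreover have "q \<beta> = (\<Sum>T\<in>Y. sc (a T) (J \<alpha> T) \<beta>)" unfolding q_def by (rule sum_fun_apply)
    ultimately have "\<exists>T\<in>Y. sc (a T) (J \<alpha> T) \<beta> \<noteq> 0"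
      using sum.neutral[of Y "\<lambda>T. sc (a T) (J \<alpha> T) \<beta>"] by metis
    then obtain T where T: "T \<in> Y" "sc (a T) (J \<alpha> T) \<beta> \<noteq> 0" by blast
    have "J \<alpha> T \<beta> \<noteq> 0"
    proof
      assume "J \<alpha> T \<beta> = 0"
      hence "sc (a T) (J \<alpha> T) \<beta> = 0" by (intro ext) simp
      thus False using T by simp
    qed
    thus ?thesis using isJ_D(3)[OF J_isJ[OF T(1) \<alpha>] ne] lp_supp[OF lp that] by blast
  qed
  have "Sp ?A (\<Sum>\<beta>\<in>supp p. monov \<beta> (p \<beta>))"
  proof (rule Sp_sum)
    fix \<beta> assume "\<beta> \<in> supp p"
    hence \<beta>: "supp_ok N \<beta>" "tri_lt N \<beta> \<alpha>" using low by auto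
    have "{\<gamma>. supp_ok N \<gamma> \<and> tri_lt N \<gamma> \<beta>} \<subset> {\<gamma>. supp_ok N \<gamma> \<and> tri_lt N \<gamma> \<alpha>}"
      using \<beta> \<alpha> tri_lt_trans tri_lt_irrefl by blast
    hence "card {\<gamma>. supp_ok N \<gamma> \<and> tri_lt N \<gamma> \<beta>} < card {\<gamma>. supp_ok N \<gamma> \<and> tri_lt N \<gamma> \<alpha>}"
      by (intro psubset_card_mono finite_tri_lt_below)
    from less.hyps[OF this \<beta>(1) lp_V[OF lp, of \<beta>]] show "Sp ?A (monov \<beta> (p \<beta>))"
      using \<beta>(2) by (simp add: tri_lt_def)
  qed
  hence "Sp ?A p" using lp_decompose[OF lp] by simp
  hence "Sp ?A (p + q)" using Sq by (rule Sp_add)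
  thus ?case by (simp add: p_def)
qed

lemma Sp_lp: assumes "lp f" shows "Sp K f"
proof -
  have "Sp K (\<Sum>\<beta>\<in>supp f. monov \<beta> (f \<beta>))"
  proof (rule Sp_sum)
    fix \<beta> assume "\<beta> \<in> supp f"
    hence "supp_ok N \<beta>" using lp_supp[OF assms] by simp
    from Sp_mono[OF Sp_monov[OF this lp_V[OF assms, of \<beta>]]] show "Sp K (monov \<beta> (f \<beta>))" by simp
  qed
  thus ?thesis using lp_decompose[OF assms] by simp
qed

section \<open>Coordinates and the sesquilinear form\<close>

lemma coeffs_expand:
  assumes c: "valid c"
  shows "coeffs N \<tau> \<kappa> (expand c) = c"
proof -
  have e: "(\<Sum>k\<in>{k. d k \<noteq> 0}. (\<lambda>\<beta> S. d k * zetaL N \<tau> \<kappa> (fst k) (snd k) \<beta> S)) = expand d" if "valid d" for d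
    unfolding expand_def sc_def[symmetric]
    using that by (intro sum.cong refl) (auto simp: valid_def K_iff Z_def zetaL_eq_J)
  show ?thesis unfolding coeffs_def
  proof (rule the_equality)
    show "finite {k. c k \<noteq> 0} \<and> (\<forall>k. c k \<noteq> 0 \<longrightarrow> k \<in> K) \<and>
      expand c = (\<Sum>k\<in>{k. c k \<noteq> 0}. (\<lambda>\<beta> S. c k * zetaL N \<tau> \<kappa> (fst k) (snd k) \<beta> S))"
      using c e[OF c] by (simp add: valid_def)
  next
    fix d assume d: "finite {k. d k \<noteq> 0} \<and> (\<forall>k. d k \<noteq> 0 \<longrightarrow> k \<in> K) \<and>
      expand c = (\<Sum>k\<in>{k. d k \<noteq> 0}. (\<lambda>\<beta> S. d k * zetaL N \<tau> \<kappa> (fst k) (snd k) \<beta> S))"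
    hence vd: "valid d" by (simp add: valid_def)
    show "d = c" using expand_inj[OF vd c] e[OF vd] d by simp
  qed
qed

abbreviation "co \<equiv> coeffs N \<tau> \<kappa>"

lemma co_valid: assumes "lp f" shows "valid (co f)" "expand (co f) = f"
proof -
  obtain c where "valid c" "f = expand c" using Sp_lp[OF assms] by (auto simp: Sp_def)
  thus "valid (co f)" "expand (co f) = f" using coeffs_expand by auto
qed

lemma co_eqI: "valid c \<Longrightarrow> f = expand c \<Longrightarrow> co f = c"
  using coeffs_expand by simp

lemma co_add: assumes "lp f" "lp g" shows "co (f + g) = (\<lambda>k. co f k + co g k)"
  by (rule co_eqI) (simp_all add: assms co_valid valid_add expand_add)

lemma co_sc: assumes "lp f" shows "co (sc a f) = (\<lambda>k. a * co f k)"
  by (rule co_eqI) (simp_all add: assms co_valid valid_sc expand_sc)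

lemma co_Z: "k \<in> K \<Longrightarrow> co (Z k) = (\<lambda>l. if l = k then 1 else 0)"
  by (rule co_eqI) (simp_all add: valid_delta expand_delta)

lemma co_monov:
  assumes "supp_ok N \<alpha>" "v \<in> V" "co (monov \<alpha> v) k \<noteq> 0"
  shows "msum N (fst k) = msum N \<alpha>"
proof -
  obtain c where "valid c" "\<forall>k. c k \<noteq> 0 \<longrightarrow> k \<in> {k\<in>K. msum N (fst k) = msum N \<alpha>}" "monov \<alpha> v = expand c"
    using Sp_monov[OF assms(1,2)] by (auto simp: Sp_def)
  thus ?thesis using co_eqI assms(3) by fastforce
qed

abbreviation "n k \<equiv> nrm N \<kappa> (fst k) (snd k)"
abbreviation "F \<equiv> formT N \<tau> \<kappa>"

lemma F_sup:
  assumes "finite B" "{k. co f k \<noteq> 0} \<subseteq> B"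
  shows "F f g = (\<Sum>k\<in>B. cnj (co f k) * co g k * of_real (n k))"
  unfolding formT_def using assms by (intro sum.mono_neutral_left) auto

lemma finite_co: "lp f \<Longrightarrow> finite {k. co f k \<noteq> 0}"
  using co_valid(1) by (simp add: valid_def)

lemma F_add_left: "lp f \<Longrightarrow> lp g \<Longrightarrow> F (f + g) h = F f h + F g h"
  using finite_co[of f] finite_co[of g]
  by (subst (1 2 3) F_sup[of "{k. co f k \<noteq> 0} \<union> {k. co g k \<noteq> 0}"]) (auto simp: co_add algebra_simps sum.distrib)

lemma F_add_right: "lp g \<Longrightarrow> lp h \<Longrightarrow> F f (g + h) = F f g + F f h"
  by (simp add: formT_def co_add algebra_simps sum.distrib)

lemma F_sc_left: "lp f \<Longrightarrow> F (sc a f) h = cnj a * F f h"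
  using finite_co[of f]
  by (subst (1 2) F_sup[of "{k. co f k \<noteq> 0}"]) (auto simp: co_sc sum_distrib_left algebra_simps)

lemma F_sc_right: "lp h \<Longrightarrow> F f (sc a h) = a * F f h"
  by (simp add: formT_def co_sc sum_distrib_left algebra_simps)

lemma F_Z: assumes "k \<in> K" "l \<in> K" shows "F (Z k) (Z l) = (if k = l then of_real (n k) else 0)"
  using assms by (subst F_sup[of "{k}"]) (auto simp: co_Z)

lemma F_0: "F 0 h = 0" "F h 0 = 0"
  using F_sc_left[OF lp_0, of 0 h] F_sc_right[OF lp_0, of h 0] by (simp_all add: sc_simps)

lemma F_sum_left: "(\<And>k. k \<in> B \<Longrightarrow> lp (f k)) \<Longrightarrow> F (sum f B) h = (\<Sum>k\<in>B. F (f k) h)"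
  by (induction B rule: infinite_finite_induct) (auto simp: F_0 F_add_left lp_sum)

lemma F_sum_right: "(\<And>k. k \<in> B \<Longrightarrow> lp (f k)) \<Longrightarrow> F h (sum f B) = (\<Sum>k\<in>B. F h (f k))"
  by (induction B rule: infinite_finite_induct) (auto simp: F_0 F_add_right lp_sum)

lemma F_sum_sc:
  assumes f: "\<And>k. k \<in> B \<Longrightarrow> lp (f k)" and g: "\<And>l. l \<in> C \<Longrightarrow> lp (g l)"
  shows "F (\<Sum>k\<in>B. sc (a k) (f k)) (\<Sum>l\<in>C. sc (b l) (g l)) = (\<Sum>k\<in>B. \<Sum>l\<in>C. cnj (a k) * (b l * F (f k) (g l)))"
proof -
  let ?G = "\<Sum>l\<in>C. sc (b l) (g l)"
  have "F (\<Sum>k\<in>B. sc (a k) (f k)) ?G = (\<Sum>k\<in>B. F (sc (a k) (f k)) ?G)"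
    by (rule F_sum_left) (use f lp_sc in blast)
  also have "\<dots> = (\<Sum>k\<in>B. cnj (a k) * F (f k) ?G)"
    by (intro sum.cong refl F_sc_left f)
  also have "\<dots> = (\<Sum>k\<in>B. cnj (a k) * (\<Sum>l\<in>C. b l * F (f k) (g l)))"
  proof (intro sum.cong refl arg_cong[of _ _ "(*) _"])
    fix k
    have "F (f k) ?G = (\<Sum>l\<in>C. F (f k) (sc (b l) (g l)))"
      by (rule F_sum_right) (use g lp_sc in blast)
    thus "F (f k) ?G = (\<Sum>l\<in>C. b l * F (f k) (g l))"
      using g by (simp add: F_sc_right cong: sum.cong)
  qed
  finally show ?thesis by (simp only: sum_distrib_left)
qed

lemma F_pos:
  assumes "\<And>k. k \<in> K \<Longrightarrow> 0 \<le> n k" "lp f"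
  shows "F f f \<in> \<real> \<and> 0 \<le> Re (F f f)"
proof -
  have "F f f = of_real (\<Sum>k\<in>{k. co f k \<noteq> 0}. (cmod (co f k))\<^sup>2 * n k)"
    unfolding formT_def of_real_sum
    by (intro sum.cong refl) (simp add: complex_norm_square mult.commute flip: of_real_power)
  moreover have "0 \<le> (\<Sum>k\<in>{k. co f k \<noteq> 0}. (cmod (co f k))\<^sup>2 * n k)"
    using assms co_valid(1)[OF assms(2)] by (intro sum_nonneg) (auto simp: valid_def)
  ultimately show ?thesis by simp
qed

lemma F_degree:
  assumes "supp_ok N \<alpha>" "v \<in> V" "supp_ok N \<beta>" "w \<in> V" "msum N \<alpha> \<noteq> msum N \<beta>"
  shows "F (monov \<alpha> v) (monov \<beta> w) = 0"
  unfolding formT_def using co_monov[OF assms(1,2)] co_monov[OF assms(3,4)] assms(5)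
  by (intro sum.neutral ballI) fastforce

lemma F_eq_on_basis:
  assumes A: "\<And>f. lp f \<Longrightarrow> lp (A f)" "\<And>f g. lp f \<Longrightarrow> lp g \<Longrightarrow> A (f + g) = A f + A g" "\<And>a f. lp f \<Longrightarrow> A (sc a f) = sc a (A f)"
    and B: "\<And>f. lp f \<Longrightarrow> lp (B f)" "\<And>f g. lp f \<Longrightarrow> lp g \<Longrightarrow> B (f + g) = B f + B g" "\<And>a f. lp f \<Longrightarrow> B (sc a f) = sc a (B f)"
    and C: "\<And>f. lp f \<Longrightarrow> lp (C f)" "\<And>f g. lp f \<Longrightarrow> lp g \<Longrightarrow> C (f + g) = C f + C g" "\<And>a f. lp f \<Longrightarrow> C (sc a f) = sc a (C f)"
    and D: "\<And>f. lp f \<Longrightarrow> lp (D f)" "\<And>f g. lp f \<Longrightarrow> lp g \<Longrightarrow> D (f + g) = D f + D g" "\<And>a f. lp f \<Longrightarrow> D (sc a f) = sc a (D f)"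
    and basis: "\<And>k l. k \<in> K \<Longrightarrow> l \<in> K \<Longrightarrow> F (A (Z k)) (B (Z l)) = F (C (Z k)) (D (Z l))"
    and fg: "lp f" "lp g"
  shows "F (A f) (B g) = F (C f) (D g)"
proof -
  have lin: "L (expand c) = (\<Sum>k\<in>{k. c k \<noteq> 0}. sc (c k) (L (Z k)))"
    if L: "\<And>f. lp f \<Longrightarrow> lp (L f)" "\<And>f g. lp f \<Longrightarrow> lp g \<Longrightarrow> L (f + g) = L f + L g" "\<And>a f. lp f \<Longrightarrow> L (sc a f) = sc a (L f)"
      and c: "valid c" for L c
  proof -
    have "L (\<Sum>k\<in>E. sc (c k) (Z k)) = (\<Sum>k\<in>E. sc (c k) (L (Z k)))" if "finite E" "E \<subseteq> K" for E
      using that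
    proof (induction E rule: finite_induct)
      case empty
      have "L 0 = 0" using L(3)[OF lp_0, of 0] by (simp add: sc_simps)
      thus ?case unfolding sum.empty .
    next
      case (insert k E)
      have "lp (sc (c k) (Z k))" "lp (\<Sum>k\<in>E. sc (c k) (Z k))"
        using insert by (auto intro!: lp_sum lp_sc lp_Z)
      from L(2)[OF this] have "L (sum (\<lambda>k. sc (c k) (Z k)) (insert k E))
          = L (sc (c k) (Z k)) + L (\<Sum>k\<in>E. sc (c k) (Z k))"
        unfolding sum.insert[OF insert.hyps] .
      also have "L (sc (c k) (Z k)) = sc (c k) (L (Z k))" using insert.prems by (intro L(3) lp_Z) auto
      also have "L (\<Sum>k\<in>E. sc (c k) (Z k)) = (\<Sum>k\<in>E. sc (c k) (L (Z k)))" using insert.prems by (intro insert.IH) auto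
      finally show ?case unfolding sum.insert[OF insert.hyps] .
    qed
    moreover have "finite {k. c k \<noteq> 0}" "{k. c k \<noteq> 0} \<subseteq> K" using c unfolding valid_def by blast+
    ultimately show ?thesis unfolding expand_def by blast
  qed
  define c d where "c = co f" and "d = co g"
  have c: "valid c" "f = expand c" and d: "valid d" "g = expand d"
    using co_valid[OF fg(1)] co_valid[OF fg(2)] by (simp_all add: c_def d_def)
  have K: "k \<in> K" if "c k \<noteq> 0 \<or> d k \<noteq> 0" for k using c(1) d(1) that unfolding valid_def by blast
  have eA: "A f = (\<Sum>k\<in>{k. c k \<noteq> 0}. sc (c k) (A (Z k)))"
    unfolding c(2) by (rule lin[OF A c(1)])
  have eC: "C f = (\<Sum>k\<in>{k. c k \<noteq> 0}. sc (c k) (C (Z k)))"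
    unfolding c(2) by (rule lin[OF C c(1)])
  have eB: "B g = (\<Sum>k\<in>{k. d k \<noteq> 0}. sc (d k) (B (Z k)))"
    unfolding d(2) by (rule lin[OF B d(1)])
  have eD: "D g = (\<Sum>k\<in>{k. d k \<noteq> 0}. sc (d k) (D (Z k)))"
    unfolding d(2) by (rule lin[OF D d(1)])
  have "F (A f) (B g) = (\<Sum>k\<in>{k. c k \<noteq> 0}. \<Sum>l\<in>{k. d k \<noteq> 0}. cnj (c k) * (d l * F (A (Z k)) (B (Z l))))"
    unfolding eA eB using K by (intro F_sum_sc A(1) B(1) lp_Z) auto
  also have "\<dots> = (\<Sum>k\<in>{k. c k \<noteq> 0}. \<Sum>l\<in>{k. d k \<noteq> 0}. cnj (c k) * (d l * F (C (Z k)) (D (Z l))))"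
    using K basis by (intro sum.cong refl) auto
  also have "\<dots> = F (C f) (D g)"
    unfolding eC eD using K by (intro F_sum_sc[symmetric] C(1) D(1) lp_Z) auto
  finally show ?thesis .
qed

end

section \<open>Norms and invariance of the form\<close>

context jack begin

definition Gf :: "int \<Rightarrow> nat \<Rightarrow> nat \<Rightarrow> tab \<Rightarrow> real" where
  "Gf l a b T = 1 - (\<kappa> / (real_of_int l + \<kappa> * real_of_int (cont a T - cont b T)))\<^sup>2"

text \<open>With d the content difference, |\<kappa>| (|d| + 1) \<le> |\<kappa>| h < 1 \<le> l,
  hence |\<kappa>| < l + \<kappa> d. The additional 1 is what the bound on \<kappa> in terms of h
  leaves room for.\<close>

lemma Gf_pos:
  assumes "T \<in> Y" "a \<in> {1..N}" "b \<in> {1..N}" "1 \<le> l"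
  shows "0 < Gf l a b T"
proof -
  let ?d = "real_of_int (cont a T - cont b T)"
  have "\<bar>cont a T - cont b T\<bar> \<le> int (htau \<tau>) - 1" by (intro cont_diff_le assms)
  hence "\<bar>?d\<bar> \<le> real (htau \<tau>) - 1" by linarith
  hence "\<bar>\<kappa>\<bar> * \<bar>?d\<bar> \<le> \<bar>\<kappa>\<bar> * (real (htau \<tau>) - 1)" by (intro mult_left_mono) auto
  moreover have "\<bar>\<kappa>\<bar> * (real (htau \<tau>) - 1) = \<bar>\<kappa>\<bar> * real (htau \<tau>) - \<bar>\<kappa>\<bar>"
    by (simp add: right_diff_distrib)
  moreover have "\<bar>\<kappa> * ?d\<bar> = \<bar>\<kappa>\<bar> * \<bar>?d\<bar>" by (rule abs_mult)
  ultimately have "\<bar>\<kappa> * ?d\<bar> + \<bar>\<kappa>\<bar> < 1" using kappa by linarith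
  hence lt: "\<bar>\<kappa>\<bar> < real_of_int l + \<kappa> * ?d" using assms(4) by linarith
  have "0 < real_of_int l + \<kappa> * ?d" by (rule le_less_trans[OF abs_ge_zero lt])
  hence "\<bar>\<kappa> / (real_of_int l + \<kappa> * ?d)\<bar> < 1" using lt by (simp only: abs_divide abs_of_pos divide_less_eq_1_pos)
  thus ?thesis unfolding Gf_def by (simp add: abs_square_less_1)
qed

text \<open>Both orders of each pair are present, so a permutation of the indices merely reindexes a
  product.\<close>

definition pairs :: "(nat \<times> nat) set" where "pairs = {(i, j). i \<in> {1..N} \<and> j \<in> {1..N} \<and> i \<noteq> j}"

lemma finite_pairs: "finite pairs"
  by (rule finite_subset[of _ "{1..N} \<times> {1..N}"]) (auto simp: pairs_def)

lemma pairs_reindex: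
  assumes w: "w permutes {1..N}"
  shows "bij_betw (map_prod w w) pairs pairs"
proof (rule bij_betwI[where g = "map_prod (inv w) (inv w)"])
  have in1: "w i \<in> {1..N} \<longleftrightarrow> i \<in> {1..N}" and in2: "inv w i \<in> {1..N} \<longleftrightarrow> i \<in> {1..N}" for i
    using permutes_in_image[OF w] permutes_in_image[OF permutes_inv[OF w]] by auto
  have i1: "w i = w j \<longleftrightarrow> i = j" and i2: "inv w i = inv w j \<longleftrightarrow> i = j" for i j
    using permutes_inj[OF w] permutes_inj[OF permutes_inv[OF w]] by (auto dest: injD)
  have "map_prod w w p \<in> pairs" "map_prod (inv w) (inv w) p \<in> pairs" if "p \<in> pairs" for p
    using that unfolding pairs_def
    by (cases p, simp only: map_prod_simp mem_Collect_eq prod.case in1 i1 in2 i2 simp_thms)+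
  thus "map_prod w w \<in> pairs \<rightarrow> pairs" "map_prod (inv w) (inv w) \<in> pairs \<rightarrow> pairs" by auto
  show "map_prod (inv w) (inv w) (map_prod w w x) = x" for x
    using permutes_inverses(2)[OF w] by (cases x) simp
  show "map_prod w w (map_prod (inv w) (inv w) x) = x" for x
    using permutes_inverses(1)[OF w] by (cases x) simp
qed

lemma prod_pairs_reindex:
  fixes f :: "nat \<times> nat \<Rightarrow> real"
  assumes "w permutes {1..N}"
  shows "prod f pairs = (\<Prod>(i, j)\<in>pairs. f (w i, w j))"
  using prod.reindex_bij_betw[OF pairs_reindex[OF assms], of f] by (simp add: map_prod_def case_prod_unfold)

definition red :: "mi \<Rightarrow> tab \<Rightarrow> nat \<Rightarrow> nat \<Rightarrow> real" where
  "red \<alpha> T i j = (\<Prod>l\<in>{1..\<alpha> i - \<alpha> j - (if j < i then 1 else 0)}. Gf l (rank N \<alpha> i) (rank N \<alpha> j) T)"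

lemma prod_int_nat: "(\<Prod>l\<in>{1..nat m}. f (int l)) = (\<Prod>l\<in>{1..m}. f l)" for f :: "int \<Rightarrow> real"
  by (rule prod.reindex_bij_witness[of _ nat int]) auto

text \<open>Each factor of \<^term>\<open>Efac\<close> cancels the last factor of one of the products in \<^term>\<open>normpart\<close>.\<close>
lemma nrm_eq:
  assumes T: "T \<in> Y"
  shows "nrm N \<kappa> \<alpha> T = ip0 N T * (\<Prod>(i, j)\<in>pairs. red \<alpha> T i j)"
proof -
  let ?r = "rank N \<alpha>"
  define full where "full = (\<lambda>i j. \<Prod>l\<in>{1..\<alpha> i - \<alpha> j}. Gf l (?r i) (?r j) T)"
  define E where "E = (\<lambda>i j. if j < i \<and> \<alpha> j < \<alpha> i then Gf (\<alpha> i - \<alpha> j) (?r i) (?r j) T else 1)"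
  have full: "full i j = red \<alpha> T i j * E i j" if "i \<noteq> j" for i j
  proof (cases "j < i \<and> \<alpha> j < \<alpha> i")
    case True
    hence "{1..\<alpha> i - \<alpha> j} = insert (\<alpha> i - \<alpha> j) {1..\<alpha> i - \<alpha> j - 1}" by auto
    thus ?thesis using True by (simp add: full_def red_def E_def)
  next
    case False
    thus ?thesis by (auto simp: full_def red_def E_def)
  qed
  have np: "normpart N \<kappa> (mplus N \<alpha>) T = ip0 N T * (\<Prod>(i, j)\<in>pairs. full i j)"
  proof -
    let ?lam = "mplus N \<alpha>"
    let ?f = "\<lambda>(a, b). if a < b then \<Prod>l\<in>{1..?lam a - ?lam b}. Gf l a b T else 1"
    have "(\<Prod>(i, j)\<in>{(i, j). 1 \<le> i \<and> i < j \<and> j \<le> N}. \<Prod>l\<in>{1..nat (?lam i - ?lam j)}.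
       1 - (\<kappa> / (real l + \<kappa> * real_of_int (cont i T - cont j T)))\<^sup>2)
      = (\<Prod>(a, b)\<in>{(i, j). 1 \<le> i \<and> i < j \<and> j \<le> N}. \<Prod>l\<in>{1..?lam a - ?lam b}. Gf l a b T)"
      by (intro prod.cong refl) (auto simp: prod_int_nat[symmetric] Gf_def)
    also have "\<dots> = prod ?f pairs"
      by (rule prod.mono_neutral_cong_left[OF finite_pairs]) (auto simp: pairs_def split: if_splits)
    also have "\<dots> = (\<Prod>(i, j)\<in>pairs. ?f (rk N \<alpha> i, rk N \<alpha> j))"
      by (rule prod_pairs_reindex[OF rk_permutes])
    also have "\<dots> = (\<Prod>(i, j)\<in>pairs. full i j)"
    proof (intro prod.cong refl)
      fix p assume p: "p \<in> pairs"
      obtain i j where pij: "p = (i, j)" by (cases p)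
      hence ij: "i \<in> {1..N}" "j \<in> {1..N}" "i \<noteq> j" using p by (auto simp: pairs_def)
      have lam: "?lam (?r k) = \<alpha> k" if "k \<in> {1..N}" for k using rank_inv_rank[OF that] by (simp add: mplus_eq)
      \<comment> \<open>A position not ranked before another has an exponent that is not larger, and
        its product is empty.\<close>
      have "full i j = 1" if "\<not> ?r i < ?r j"
        using that unfolding rank_less_iff[OF ij(1,2)] full_def using ij by (auto simp: before_def)
      thus "(case p of (i, j) \<Rightarrow> ?f (rk N \<alpha> i, rk N \<alpha> j)) = (case p of (i, j) \<Rightarrow> full i j)"
        using ij by (simp add: pij rk_eq lam full_def del: atLeastAtMost_iff)
    qed
    finally show ?thesis by (simp add: normpart_def)
  qed
  have En: "(\<Prod>(i, j)\<in>pairs. E i j) = Efac N \<kappa> 1 \<alpha> T * Efac N \<kappa> (-1) \<alpha> T"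
  proof -
    let ?S = "{(i, j). 1 \<le> i \<and> i < j \<and> j \<le> N \<and> \<alpha> i < \<alpha> j}"
    have "Efac N \<kappa> 1 \<alpha> T * Efac N \<kappa> (-1) \<alpha> T = (\<Prod>(i, j)\<in>?S. Gf (\<alpha> j - \<alpha> i) (?r j) (?r i) T)"
      unfolding Efac_def prod.distrib[symmetric]
      by (intro prod.cong refl) (auto simp: Gf_def power2_eq_square algebra_simps)
    also have "\<dots> = (\<Prod>(j, i)\<in>prod.swap ` ?S. Gf (\<alpha> j - \<alpha> i) (?r j) (?r i) T)"
      by (subst prod.reindex) (auto simp: case_prod_unfold)
    also have "\<dots> = (\<Prod>(i, j)\<in>pairs. E i j)"
      by (rule prod.mono_neutral_cong_left[OF finite_pairs]) (auto simp: pairs_def E_def image_iff)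
    finally show ?thesis by simp
  qed
  have E0: "(\<Prod>(i, j)\<in>pairs. E i j) \<noteq> 0"
  proof (subst prod_zero_iff[OF finite_pairs], clarify)
    fix i j assume "(i, j) \<in> pairs" "E i j = 0"
    thus False using Gf_pos[OF T rank_in rank_in, of i j "\<alpha> i - \<alpha> j" \<alpha> \<alpha>]
      by (auto simp: E_def pairs_def split: if_splits)
  qed
  have "(\<Prod>(i, j)\<in>pairs. full i j) = (\<Prod>(i, j)\<in>pairs. red \<alpha> T i j) * (\<Prod>(i, j)\<in>pairs. E i j)"
    unfolding prod.distrib[symmetric] by (intro prod.cong refl) (auto simp: full pairs_def)
  thus ?thesis unfolding nrm_def np En[symmetric] using E0 by simp
qed

lemma ip0_pos: "0 < ip0 N T"
  unfolding ip0_def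
proof (rule prod_pos, clarify)
  fix i j assume "cont i T \<le> cont j T - 2"
  hence "2 \<le> \<bar>real_of_int (cont i T - cont j T)\<bar>" by linarith
  hence "2\<^sup>2 \<le> \<bar>real_of_int (cont i T - cont j T)\<bar>\<^sup>2" by (intro power_mono) auto
  hence "4 \<le> (real_of_int (cont i T - cont j T))\<^sup>2" unfolding power2_abs by simp
  thus "0 < 1 - 1 / (real_of_int (cont i T - cont j T))\<^sup>2" by (simp add: divide_simps)
qed

lemma nrm_nonneg:
  assumes "k \<in> K" shows "0 \<le> n k"
proof -
  have "0 \<le> red \<alpha> (snd k) i j" if "(i, j) \<in> pairs" for i j \<alpha>
    unfolding red_def using assms that
    by (intro prod_nonneg ballI less_imp_le[OF Gf_pos] rank_in) (auto simp: K_iff pairs_def)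
  hence "0 \<le> (\<Prod>(i, j)\<in>pairs. red (fst k) (snd k) i j)" by (intro prod_nonneg) auto
  thus ?thesis using assms ip0_pos[of "snd k"] by (simp add: nrm_eq K_iff)
qed

text \<open>Moving position 1 to the end increases its exponent by 1 and makes the bracket [j < i]
  change along with it; the length of every product is unaffected.\<close>

lemma nrm_phi:
  assumes T: "T \<in> Y" shows "nrm N \<kappa> (phi \<alpha>) T = nrm N \<kappa> \<alpha> T"
proof -
  have "red (phi \<alpha>) T (cyc i) (cyc j) = red \<alpha> T i j" if "(i, j) \<in> pairs" for i j
  proof -
    have ij: "i \<in> {1..N}" "j \<in> {1..N}" "i \<noteq> j" using that by (auto simp: pairs_def)
    have "phi \<alpha> (cyc i) - phi \<alpha> (cyc j) - (if cyc j < cyc i then 1 else 0) = \<alpha> i - \<alpha> j - (if j < i then 1 else 0)"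
      unfolding phi_cyc[OF ij(1)] phi_cyc[OF ij(2)] using ij by (auto simp: cyc_def)
    thus ?thesis unfolding red_def rank_phi[OF ij(1)] rank_phi[OF ij(2)] by simp
  qed
  hence "(\<Prod>(i, j)\<in>pairs. red (phi \<alpha>) T i j) = (\<Prod>(i, j)\<in>pairs. red \<alpha> T i j)"
    unfolding prod_pairs_reindex[OF cyc_permutes, of "\<lambda>(i, j). red (phi \<alpha>) T i j"]
    by (intro prod.cong refl) auto
  thus ?thesis by (simp add: nrm_eq[OF T])
qed

text \<open>Only one ordered pair is affected by the tie-breaking bracket: its product gains the
  factor with l = \<alpha>_(i+1) - \<alpha>_i, and that factor is 1 - b^2.\<close>

lemma nrm_up:
  assumes T: "T \<in> Y" and i: "i \<in> {1..<N}" and lt: "\<alpha> i < \<alpha> (Suc i)"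
  shows "nrm N \<kappa> (\<alpha> \<circ> sw i (Suc i)) T = (1 - (bJ i \<alpha> T)\<^sup>2) * nrm N \<kappa> \<alpha> T"
proof -
  let ?s = "sw i (Suc i)"
  have s: "?s permutes {1..N}" using i by (intro sw_permutes) auto
  have ii: "i \<in> {1..N}" "Suc i \<in> {1..N}" using i by auto
  have rs: "rank N (\<alpha> \<circ> ?s) (?s k) = rank N \<alpha> k" if "k \<in> {1..N}" for k
    using rank_swap[OF i _ that, of \<alpha>] lt by simp
  have G: "Gf (\<alpha> (Suc i) - \<alpha> i) (rank N \<alpha> (Suc i)) (rank N \<alpha> i) T = 1 - (bJ i \<alpha> T)\<^sup>2"
  proof -
    have "xi N \<kappa> \<alpha> T i - xi N \<kappa> \<alpha> T (Suc i) = - (real_of_int (\<alpha> (Suc i) - \<alpha> i) + \<kappa> * real_of_int (cont (rank N \<alpha> (Suc i)) T - cont (rank N \<alpha> i) T))"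
      by (simp add: xi_def algebra_simps)
    thus ?thesis by (simp only: Gf_def bJ_def divide_minus_right power2_minus)
  qed
  have key: "red (\<alpha> \<circ> ?s) T (?s a) (?s b) = red \<alpha> T a b * (if (a, b) = (Suc i, i) then 1 - (bJ i \<alpha> T)\<^sup>2 else 1)"
    if "(a, b) \<in> pairs" for a b
  proof -
    have ab: "a \<in> {1..N}" "b \<in> {1..N}" "a \<noteq> b" using that by (auto simp: pairs_def)
    consider "(a, b) = (Suc i, i)" | "(a, b) = (i, Suc i)" | "{a, b} \<noteq> {i, Suc i}" by (auto simp: doubleton_eq_iff)
    thus ?thesis
    proof cases
      case 1
      have "{1..\<alpha> (Suc i) - \<alpha> i} = insert (\<alpha> (Suc i) - \<alpha> i) {1..\<alpha> (Suc i) - \<alpha> i - 1}" using lt by auto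
      thus ?thesis using 1 rs[OF ii(1)] rs[OF ii(2)] G by (simp add: red_def)
    next
      case 2
      thus ?thesis using lt by (simp add: red_def)
    next
      case 3
      have "?s b < ?s a \<longleftrightarrow> b < a" using 3 ab by (auto simp: sw_def doubleton_eq_iff)
      thus ?thesis using 3 rs[OF ab(1)] rs[OF ab(2)] by (auto simp: red_def)
    qed
  qed
  have "(\<Prod>(a, b)\<in>pairs. red (\<alpha> \<circ> ?s) T a b)
      = (\<Prod>p\<in>pairs. (case p of (a, b) \<Rightarrow> red \<alpha> T a b) * (if p = (Suc i, i) then 1 - (bJ i \<alpha> T)\<^sup>2 else 1))"
    unfolding prod_pairs_reindex[OF s, of "\<lambda>(a, b). red (\<alpha> \<circ> ?s) T a b"]
  proof (intro prod.cong refl)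
    fix p assume p: "p \<in> pairs"
    obtain a b where ab: "p = (a, b)" by (cases p)
    show "(case p of (a, b) \<Rightarrow> case (?s a, ?s b) of (a, b) \<Rightarrow> red (\<alpha> \<circ> ?s) T a b)
       = (case p of (a, b) \<Rightarrow> red \<alpha> T a b) * (if p = (Suc i, i) then 1 - (bJ i \<alpha> T)\<^sup>2 else 1)"
      using key[OF p[unfolded ab]] unfolding ab prod.case .
  qed
  also have "\<dots> = (\<Prod>(a, b)\<in>pairs. red \<alpha> T a b) * (1 - (bJ i \<alpha> T)\<^sup>2)"
    unfolding prod.distrib prod.delta[OF finite_pairs] using ii by (simp add: pairs_def)
  finally show ?thesis by (simp add: nrm_eq[OF T])
qed

text \<open>The pair of \<open>j\<close> and \<open>Suc j\<close> has the wrong sign of content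
  difference to contribute for \<open>T\<close>, and contributes after the interchange.\<close>

lemma ip0_swap:
  assumes T: "T \<in> Y" and j: "j \<in> {1..<N}" and lt: "rw j T < rw (Suc j) T"
  shows "ip0 N (T \<circ> sw j (Suc j)) = (1 - (bq j T)\<^sup>2) * ip0 N T"
proof -
  let ?s = "sw j (Suc j)"
  have s: "?s permutes {1..N}" using j by (intro sw_permutes) auto
  have jj: "j \<in> {1..N}" "Suc j \<in> {1..N}" using j by auto
  define w where "w = (\<lambda>T (a, b). if a < b \<and> cont a T \<le> cont b T - 2 then 1 - 1 / (real_of_int (cont a T - cont b T))\<^sup>2 else 1)"
  have ip: "ip0 N S = prod (w S) pairs" for S
    unfolding ip0_def by (rule prod.mono_neutral_cong_left[OF finite_pairs]) (auto simp: pairs_def w_def split: if_splits)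
  have c: "cont j T - cont (Suc j) T \<ge> 2" by (rule cont_up[OF T j lt])
  have key: "w (T \<circ> ?s) (?s a, ?s b) = w T (a, b) * (if (a, b) = (Suc j, j) then 1 - (bq j T)\<^sup>2 else 1)"
    if "(a, b) \<in> pairs" for a b
  proof -
    consider "(a, b) = (Suc j, j)" | "(a, b) = (j, Suc j)" | "{a, b} \<noteq> {j, Suc j}" by (auto simp: doubleton_eq_iff)
    thus ?thesis
    proof cases
      case 1
      have "(real_of_int (cont (Suc j) T - cont j T))\<^sup>2 = (real_of_int (cont j T - cont (Suc j) T))\<^sup>2"
        by (simp add: power2_commute)
      thus ?thesis using 1 c by (simp add: w_def bq_def power_divide)
    next
      case 2
      thus ?thesis using c by (simp add: w_def)
    next
      case 3
      have "a \<noteq> b" using that by (auto simp: pairs_def)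
      hence "?s a < ?s b \<longleftrightarrow> a < b" using 3 by (auto simp: sw_def doubleton_eq_iff)
      thus ?thesis using 3 by (auto simp: w_def)
    qed
  qed
  have "prod (w (T \<circ> ?s)) pairs = (\<Prod>p\<in>pairs. w T p * (if p = (Suc j, j) then 1 - (bq j T)\<^sup>2 else 1))"
    unfolding prod_pairs_reindex[OF s, of "w (T \<circ> ?s)"]
  proof (intro prod.cong refl)
    fix p assume p: "p \<in> pairs"
    obtain a b where ab: "p = (a, b)" by (cases p)
    show "(case p of (a, b) \<Rightarrow> w (T \<circ> ?s) (?s a, ?s b)) = w T p * (if p = (Suc j, j) then 1 - (bq j T)\<^sup>2 else 1)"
      using key[OF p[unfolded ab]] unfolding ab prod.case .
  qed
  also have "\<dots> = prod (w T) pairs * (1 - (bq j T)\<^sup>2)"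
    unfolding prod.distrib prod.delta[OF finite_pairs] using jj by (simp add: pairs_def)
  finally show ?thesis by (simp add: ip)
qed

text \<open>Interchanging two consecutive ranks of equal exponent only permutes the factors
  \<open>red\<close>, so the whole change comes from the norm of the tableau.\<close>

lemma nrm_same:
  assumes T: "T \<in> Y" and i: "i \<in> {1..<N}" and eq: "\<alpha> i = \<alpha> (Suc i)"
  defines "j \<equiv> rank N \<alpha> i"
  assumes T': "T \<circ> sw j (Suc j) \<in> Y" and lt: "rw j T < rw (Suc j) T"
  shows "nrm N \<kappa> \<alpha> (T \<circ> sw j (Suc j)) = (1 - (bq j T)\<^sup>2) * nrm N \<kappa> \<alpha> T"
proof -
  let ?s = "sw i (Suc i)" and ?T = "T \<circ> sw j (Suc j)"
  have s: "?s permutes {1..N}" using i by (intro sw_permutes) auto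
  have ii: "i \<in> {1..N}" "Suc i \<in> {1..N}" using i by auto
  have "rank N \<alpha> (Suc i) = Suc j" using rank_Suc_eq[OF eq] by (simp add: j_def)
  hence j: "j \<in> {1..<N}" using rank_in[OF ii(1), of \<alpha>] rank_in[OF ii(2), of \<alpha>] by (auto simp: j_def)
  have \<alpha>s: "\<alpha> (?s k) = \<alpha> k" for k using eq by (auto simp: sw_def)
  have "red \<alpha> ?T a b = red \<alpha> T (?s a) (?s b)" if "(a, b) \<in> pairs" for a b
  proof -
    have ab: "a \<in> {1..N}" "b \<in> {1..N}" "a \<noteq> b" using that by (auto simp: pairs_def)
    have g: "Gf l (rank N \<alpha> a) (rank N \<alpha> b) ?T = Gf l (rank N \<alpha> (?s a)) (rank N \<alpha> (?s b)) T" for l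
      unfolding Gf_def cont_comp_sw j_def rank_sw_eq[OF i eq ab(1)] rank_sw_eq[OF i eq ab(2)] ..
    have e: "{1..\<alpha> a - \<alpha> b - (if b < a then 1 else 0)} = {1..\<alpha> (?s a) - \<alpha> (?s b) - (if ?s b < ?s a then 1 else 0)}"
    proof (cases "{a, b} = {i, Suc i}")
      case True
      hence "\<alpha> a = \<alpha> b" using eq by (auto simp: doubleton_eq_iff)
      thus ?thesis by (simp add: \<alpha>s)
    next
      case False
      hence "?s b < ?s a \<longleftrightarrow> b < a" using ab by (auto simp: sw_def doubleton_eq_iff)
      thus ?thesis by (simp add: \<alpha>s)
    qed
    show ?thesis unfolding red_def by (simp only: e g)
  qed
  hence "(\<Prod>(a, b)\<in>pairs. red \<alpha> ?T a b) = (\<Prod>(a, b)\<in>pairs. red \<alpha> T a b)"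
    unfolding prod_pairs_reindex[OF s, of "\<lambda>(a, b). red \<alpha> T a b"] by (intro prod.cong refl) auto
  thus ?thesis using ip0_swap[OF T j lt] by (simp add: nrm_eq[OF T] nrm_eq[OF T'])
qed

section \<open>Self-adjointness of transpositions\<close>

definition partner :: "nat \<Rightarrow> mi \<times> tab \<Rightarrow> mi \<times> tab" where
  "partner i k = (let j = rank N (fst k) i in if fst k i \<noteq> fst k (Suc i) then (fst k \<circ> sw i (Suc i), snd k)
     else (fst k, snd k \<circ> sw j (Suc j)))"

definition bs :: "nat \<Rightarrow> mi \<times> tab \<Rightarrow> real" where
  "bs i k = (if fst k i \<noteq> fst k (Suc i) then bJ i (fst k) (snd k) else bq (rank N (fst k) i) (snd k))"

definition hs :: "nat \<Rightarrow> mi \<times> tab \<Rightarrow> real" where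
  "hs i k = (if fst k i < fst k (Suc i) then 1 else if fst k (Suc i) < fst k i then 1 - (bJ i (fst k) (snd k))\<^sup>2
     else gq (rank N (fst k) i) (snd k))"

lemma partner_partner: "partner i (partner i k) = k"
  by (auto simp: partner_def Let_def prod_eq_iff)

lemma rank_lt_N:
  assumes i: "i \<in> {1..<N}" and eq: "\<alpha> i = \<alpha> (Suc i)" shows "rank N \<alpha> i \<in> {1..<N}"
proof -
  have "i \<in> {1..N}" "Suc i \<in> {1..N}" using i by auto
  from rank_in[OF this(1), of \<alpha>] rank_in[OF this(2), of \<alpha>] show ?thesis
    unfolding rank_Suc_eq[OF eq] by auto
qed

text \<open>\<open>partner i\<close> is an involution on all pairs, including those with nonstandard
  fillings. Whenever it leaves the index set, the off-diagonal coefficient vanishes.\<close>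

lemma hs_partner_K:
  assumes k: "k \<in> K" and i: "i \<in> {1..<N}" and h: "hs i k \<noteq> 0" shows "partner i k \<in> K"
proof (cases "fst k i = fst k (Suc i)")
  case True
  thus ?thesis using k h gq_eq_0_iff[OF _ rank_lt_N[OF i True], of "snd k"]
    by (auto simp: K_iff partner_def hs_def Let_def)
next
  case False
  have "sw i (Suc i) permutes {1..N}" using i by (intro sw_permutes) auto
  thus ?thesis using False k supp_ok_comp by (auto simp: K_iff partner_def Let_def)
qed

lemma act_s_Z:
  assumes k: "k \<in> K" and i: "i \<in> {1..<N}"
  shows "act (sw i (Suc i)) (Z k) = sc (of_real (bs i k)) (Z k) + sc (of_real (hs i k)) (Z (partner i k))"
proof -
  have k': "snd k \<in> Y" "supp_ok N (fst k)" using k by (auto simp: K_iff)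
  consider "fst k i < fst k (Suc i)" | "fst k (Suc i) < fst k i" | "fst k i = fst k (Suc i)" by linarith
  thus ?thesis
  proof cases
    case 1
    thus ?thesis using J_up[OF k' i 1] by (simp add: bs_def hs_def Z_def partner_def sc_simps)
  next
    case 2
    thus ?thesis using J_down[OF k' i 2] by (simp add: bs_def hs_def Z_def partner_def)
  next
    case 3
    thus ?thesis using J_same[OF k' i 3] unfolding bs_def hs_def Z_def partner_def Let_def by simp
  qed
qed

text \<open>The condition for a two-dimensional block with real entries to be self-adjoint with
  respect to the given norms.\<close>

lemma hs_nrm:
  assumes k: "k \<in> K" and i: "i \<in> {1..<N}" and s: "partner i k \<in> K"
  shows "hs i k * n (partner i k) = hs i (partner i k) * n k"
proof -
  let ?\<alpha> = "fst k" and ?T = "snd k" and ?s = "sw i (Suc i)"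
  have k': "?T \<in> Y" "supp_ok N ?\<alpha>" using k by (auto simp: K_iff)
  consider "?\<alpha> i < ?\<alpha> (Suc i)" | "?\<alpha> (Suc i) < ?\<alpha> i" | "?\<alpha> i = ?\<alpha> (Suc i)" by linarith
  thus ?thesis
  proof cases
    case 1
    thus ?thesis using nrm_up[OF k'(1) i 1] bJ_swap[OF i, of ?\<alpha> ?T]
      by (simp add: hs_def partner_def)
  next
    case 2
    thus ?thesis using nrm_up[OF k'(1) i, of "?\<alpha> \<circ> ?s"] bJ_swap[OF i, of ?\<alpha> ?T]
      by (simp add: hs_def partner_def)
  next
    case 3
    let ?j = "rank N ?\<alpha> i"
    let ?T' = "?T \<circ> sw ?j (Suc ?j)"
    have j: "?j \<in> {1..<N}" by (rule rank_lt_N[OF i 3])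
    have T': "?T' \<in> Y" using s 3 by (simp add: partner_def K_iff Let_def)
    hence ne: "rw ?j ?T \<noteq> rw (Suc ?j) ?T" "cm ?j ?T \<noteq> cm (Suc ?j) ?T" using swap_in_Y_iff[OF k'(1) j] by auto
    have "gq ?j ?T * nrm N \<kappa> ?\<alpha> ?T' = gq ?j ?T' * nrm N \<kappa> ?\<alpha> ?T"
    proof (cases "rw ?j ?T < rw (Suc ?j) ?T")
      case True
      thus ?thesis using ne nrm_same[OF k'(1) i 3 T' True] by (simp add: gq_def)
    next
      case False
      have "?T' \<circ> sw ?j (Suc ?j) = ?T" by simp
      thus ?thesis using False ne nrm_same[OF T' i 3] k'(1) by (simp add: gq_def del: o_apply)
    qed
    thus ?thesis using 3 by (simp add: hs_def partner_def Let_def)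
  qed
qed

lemma F_act_s_selfadjoint:
  assumes i: "i \<in> {1..<N}" and fg: "lp f" "lp g"
  shows "F (act (sw i (Suc i)) f) g = F f (act (sw i (Suc i)) g)"
proof -
  have s: "sw i (Suc i) permutes {1..N}" using i by (intro sw_permutes) auto
  have FZ: "F (sc (of_real h) (Z (partner i k))) (Z l) = (if partner i k = l then of_real (h * n l) else 0)"
    "F (Z l) (sc (of_real h) (Z (partner i k))) = (if partner i k = l then of_real (h * n l) else 0)"
    if kl: "k \<in> K" "l \<in> K" "h = hs i k" for k l h
  proof -
    consider "h = 0" | "partner i k \<in> K" using hs_partner_K[OF \<open>k \<in> K\<close> i] kl(3) by blast
    hence "F (sc (of_real h) (Z (partner i k))) (Z l) = (if partner i k = l then of_real (h * n l) else 0) \<and>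
      F (Z l) (sc (of_real h) (Z (partner i k))) = (if partner i k = l then of_real (h * n l) else 0)"
    proof cases
      case 1
      thus ?thesis by (simp add: sc_simps F_0)
    next
      case 2
      thus ?thesis using kl by (auto simp: F_sc_left F_sc_right lp_Z F_Z)
    qed
    thus "F (sc (of_real h) (Z (partner i k))) (Z l) = (if partner i k = l then of_real (h * n l) else 0)"
      "F (Z l) (sc (of_real h) (Z (partner i k))) = (if partner i k = l then of_real (h * n l) else 0)" by auto
  qed
  have lps: "lp (sc (of_real (hs i k)) (Z (partner i k)))" if "k \<in> K" for k
    using hs_partner_K[OF that i] lp_Z by (cases "hs i k = 0") (auto simp: sc_simps lp_0 lp_sc)
  show ?thesis
  proof (rule F_eq_on_basis[of "act (sw i (Suc i))" "\<lambda>f. f" "\<lambda>f. f" "act (sw i (Suc i))"])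
    fix k l assume kl: "k \<in> K" "l \<in> K"
    have "F (act (sw i (Suc i)) (Z k)) (Z l)
      = (if k = l then of_real (bs i k * n k) else 0) + (if partner i k = l then of_real (hs i k * n l) else 0)"
      unfolding act_s_Z[OF kl(1) i] using kl lps
      by (simp add: F_add_left lp_sc lp_Z F_sc_left[OF lp_Z[OF kl(1)]] F_Z FZ)
    also have "\<dots> = (if k = l then of_real (bs i l * n k) else 0) + (if partner i l = k then of_real (hs i l * n k) else 0)"
      using hs_nrm[OF kl(1) i] partner_partner[of i k] partner_partner[of i l] kl
      by (auto simp flip: of_real_mult)
    also have "\<dots> = F (Z k) (act (sw i (Suc i)) (Z l))"
      unfolding act_s_Z[OF kl(2) i] using kl lps
      by (simp add: F_add_right lp_sc lp_Z F_sc_right[OF lp_Z[OF kl(2)]] F_Z FZ)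
    finally show "F (act (sw i (Suc i)) (Z k)) (Z l) = F (Z k) (act (sw i (Suc i)) (Z l))" .
  qed (use s fg in \<open>auto simp: act_add act_sc lp_act\<close>)
qed

text \<open>A self-adjoint involution is an isometry, and the simple transpositions generate the
  group.\<close>

lemma F_act:
  assumes w: "w permutes {1..N}" and fg: "lp f" "lp g"
  shows "F (act w f) (act w g) = F f g"
proof -
  obtain ws where ws: "set ws \<subseteq> {1..<N}" "word_perm ws = w" using word_perm_surj[OF w] by blast
  have "F (act (word_perm ws) f) (act (word_perm ws) g) = F f g" using ws(1)
  proof (induction ws)
    case Nil
    thus ?case using fg act_id by (simp add: id_def)
  next
    case (Cons i ws)
    have i: "i \<in> {1..<N}" using Cons.prems by auto
    have s: "sw i (Suc i) permutes {1..N}" using i by (intro sw_permutes) auto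
    have p: "word_perm ws permutes {1..N}" using Cons.prems by (intro word_perm_permutes) auto
    have "act (word_perm (i # ws)) h = act (sw i (Suc i)) (act (word_perm ws) h)" if "lp h" for h
      using act_act[OF s p that] by simp
    hence "F (act (word_perm (i # ws)) f) (act (word_perm (i # ws)) g) = F (act (word_perm ws) f) (act (word_perm ws) g)"
      using F_act_s_selfadjoint[OF i] act_s_s[OF _ i] lp_act[OF p] lp_act[OF s] fg by simp
    also have "\<dots> = F f g" using Cons by auto
    finally show ?case .
  qed
  thus ?thesis using ws by simp
qed

section \<open>The affine step and the variables as isometries\<close>

lemma phi_inj: "phi \<alpha> = phi \<beta> \<Longrightarrow> \<alpha> = \<beta>"
  using phi_sub by metis

lemma Theta_add: "Theta (f + g) = Theta f + Theta g"
  unfolding Theta_def act_add by (simp add: xmul_def fun_eq_iff)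

lemma F_Theta:
  assumes fg: "lp f" "lp g"
  shows "F (Theta f) (Theta g) = F f g"
proof (rule F_eq_on_basis[of Theta Theta "\<lambda>f. f" "\<lambda>f. f"])
  fix k l assume kl: "k \<in> K" "l \<in> K"
  have T: "Theta (Z k) = Z (phi (fst k), snd k)" "(phi (fst k), snd k) \<in> K" if "k \<in> K" for k
    using that J_Theta[of "snd k" "fst k"] by (auto simp: K_iff Z_def supp_ok_phi)
  have "n (phi (fst k), snd k) = n k" using kl(1) nrm_phi by (simp add: K_iff)
  moreover have "phi (fst k) = phi (fst l) \<longleftrightarrow> fst k = fst l" using phi_inj[of "fst k" "fst l"] by metis
  ultimately
  show "F (Theta (Z k)) (Theta (Z l)) = F (Z k) (Z l)"
    unfolding T(1)[OF kl(1)] T(1)[OF kl(2)] F_Z[OF T(2)[OF kl(1)] T(2)[OF kl(2)]] F_Z[OF kl]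
    by (auto simp: prod_eq_iff)
qed (use fg in \<open>auto simp: Theta_add Theta_sc lp_Theta\<close>)

text \<open>x_N is \<Theta> after the inverse cyclic shift, and x_k is x_N conjugated by the
  transposition of \<open>k\<close> and \<open>N\<close>; all factors are isometries.\<close>

lemma F_xmul:
  assumes k: "k \<in> {1..N}" and fg: "lp f" "lp g"
  shows "F (xmul k f) (xmul k g) = F f g"
proof -
  have N: "N \<in> {1..N}" using N_pos by simp
  let ?c = "inv cyc" and ?u = "sw k N"
  have c: "?c permutes {1..N}" by (intro permutes_inv cyc_permutes)
  have u: "?u permutes {1..N}" using k N by (intro sw_permutes)
  have xN: "xmul N h = Theta (act ?c h)" if "lp h" for h
    using act_act[OF cyc_permutes c that] act_id[OF that] permutes_inv_o(1)[OF cyc_permutes]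
    by (simp add: Theta_def)
  have FN: "F (xmul N f) (xmul N g) = F f g" if "lp f" "lp g" for f g
    using F_Theta[OF lp_act[OF c that(1)] lp_act[OF c that(2)]] F_act[OF c that] by (simp add: xN that)
  have xk: "xmul k h = act ?u (xmul N (act ?u h))" if "lp h" for h
  proof
    fix \<gamma> :: mi
    have "((\<gamma> \<circ> ?u)(N := (\<gamma> \<circ> ?u) N - 1)) \<circ> ?u = \<gamma>(k := \<gamma> k - 1)" by (auto simp: fun_eq_iff sw_def)
    hence "act ?u (xmul N (act ?u h)) \<gamma> = tp ?u (tp ?u (h (\<gamma>(k := \<gamma> k - 1))))"
      by (simp add: act_def xmul_def)
    also have "\<dots> = h (\<gamma>(k := \<gamma> k - 1))"
      using tp_comp[OF u u lp_V[OF that]] tp_id[OF lp_V[OF that]] by (simp add: id_def)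
    finally show "xmul k h \<gamma> = act ?u (xmul N (act ?u h)) \<gamma>" by (simp add: xmul_def)
  qed
  show ?thesis unfolding xk[OF fg(1)] xk[OF fg(2)]
    using F_act[OF u lp_xmul[OF lp_act[OF u fg(1)] N] lp_xmul[OF lp_act[OF u fg(2)] N]]
      FN[OF lp_act[OF u fg(1)] lp_act[OF u fg(2)]] F_act[OF u fg] by simp
qed

lemma xmul_monov: "xmul k (monov \<beta> v) = monov (\<beta>(k := \<beta> k + 1)) v"
proof -
  have "\<gamma>(k := \<gamma> k - 1) = \<beta> \<longleftrightarrow> \<gamma> = \<beta>(k := \<beta> k + 1)" for \<gamma> by (auto simp: fun_eq_iff)
  thus ?thesis by (auto simp: xmul_def monov_def fun_eq_iff)
qed

section \<open>The Gram matrix of the monomials\<close>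

lemma F_monov_shift:
  assumes "supp_ok N \<alpha>" "supp_ok N \<beta>" "v \<in> V" "w \<in> V" "supp_ok N \<delta>"
  shows "F (monov (\<alpha> + \<delta>) v) (monov (\<beta> + \<delta>) w) = F (monov \<alpha> v) (monov \<beta> w)"
  using assms
proof (induction "\<Sum>k\<in>{1..N}. nat \<bar>\<delta> k\<bar>" arbitrary: \<delta> rule: less_induct)
  case less
  show ?case
  proof (cases "\<exists>k\<in>{1..N}. \<delta> k \<noteq> 0")
    case False
    hence "\<delta> = (\<lambda>_. 0)" using less.prems(5) unfolding supp_ok_def by (intro ext) blast
    thus ?thesis by (simp add: plus_fun_def)
  next
    case True
    then obtain k where k: "k \<in> {1..N}" "\<delta> k \<noteq> 0" by blast
    define \<epsilon> where "\<epsilon> = \<delta>(k := \<delta> k - sgn (\<delta> k))"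
    have \<epsilon>: "supp_ok N \<epsilon>" unfolding \<epsilon>_def using less.prems(5) supp_ok_upd[OF k(1)] by simp
    have "(\<Sum>l\<in>{1..N}. nat \<bar>\<epsilon> l\<bar>) < (\<Sum>l\<in>{1..N}. nat \<bar>\<delta> l\<bar>)"
      using k by (intro sum_strict_mono_ex1) (auto simp: \<epsilon>_def sgn_if intro!: bexI[of _ k])
    from less.hyps[OF this less.prems(1-4) \<epsilon>]
    have IH: "F (monov (\<alpha> + \<epsilon>) v) (monov (\<beta> + \<epsilon>) w) = F (monov \<alpha> v) (monov \<beta> w)" .
    have ok: "supp_ok N (\<gamma> + \<eta>)" if "supp_ok N \<gamma>" "supp_ok N \<eta>" for \<gamma> \<eta>
      using that by (auto simp: supp_ok_def)
    have step: "F (monov (\<gamma>(k := \<gamma> k + 1)) v) (monov (\<eta>(k := \<eta> k + 1)) w) = F (monov \<gamma> v) (monov \<eta> w)"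
      if "supp_ok N \<gamma>" "supp_ok N \<eta>" for \<gamma> \<eta>
      unfolding xmul_monov[symmetric] using that less.prems by (intro F_xmul k lp_monov)
    show ?thesis
    proof (cases "0 < \<delta> k")
      case True
      have "(\<gamma> + \<epsilon>)(k := (\<gamma> + \<epsilon>) k + 1) = \<gamma> + \<delta>" for \<gamma> using True by (auto simp: \<epsilon>_def fun_eq_iff)
      thus ?thesis using step[OF ok[OF less.prems(1) \<epsilon>] ok[OF less.prems(2) \<epsilon>]] IH by simp
    next
      \<comment> \<open>For a negative entry the unit step is used backwards: multiplying by x_k
        leads from \<delta> to \<epsilon>.\<close>
      case False
      hence "(\<gamma> + \<delta>)(k := (\<gamma> + \<delta>) k + 1) = \<gamma> + \<epsilon>" for \<gamma> using k by (auto simp: \<epsilon>_def fun_eq_iff)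
      thus ?thesis using step[OF ok[OF less.prems(1,5)] ok[OF less.prems(2,5)]] IH by simp
    qed
  qed
qed

text \<open>Dividing both monomials by their common factor, with exponent \<alpha> - max(\<alpha> -
  \<beta>, 0) = min(\<alpha>, \<beta>), leaves the positive and negative parts of \<alpha> -
  \<beta>. For different degrees both sides vanish.\<close>

lemma F_monov_Amat:
  assumes \<alpha>: "supp_ok N \<alpha>" and \<beta>: "supp_ok N \<beta>" and T: "T \<in> Y" "T' \<in> Y"
  shows "F (monov \<alpha> (bv T)) (monov \<beta> (bv T')) = of_real (sqrt (ip0 N T) * sqrt (ip0 N T')) * Amat N \<tau> \<kappa> (\<alpha> - \<beta>) T T'"
proof -
  let ?\<gamma> = "\<alpha> - \<beta>"
  have m: "msum N ?\<gamma> = msum N \<alpha> - msum N \<beta>" by (simp add: msum_def sum_subtractf)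
  have pos: "0 < ip0 N T" "0 < ip0 N T'" by (rule ip0_pos)+
  show ?thesis
  proof (cases "msum N ?\<gamma> = 0")
    case False
    thus ?thesis using F_degree[OF \<alpha> V_bv[OF T(1)] \<beta> V_bv[OF T(2)]] m by (simp add: Amat_def)
  next
    case True
    define a b where "a = (\<lambda>k. max (?\<gamma> k) 0)" and "b = (\<lambda>k. max (- ?\<gamma> k) 0)"
    have ab: "supp_ok N a" "supp_ok N b" "supp_ok N (\<alpha> - a)"
      using \<alpha> \<beta> by (auto simp: supp_ok_def a_def b_def)
    have "a + (\<alpha> - a) = \<alpha>" "b + (\<alpha> - a) = \<beta>" by (auto simp: fun_eq_iff a_def b_def)
    hence "F (monov a (bv T)) (monov b (bv T')) = F (monov \<alpha> (bv T)) (monov \<beta> (bv T'))"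
      using F_monov_shift[OF ab(1,2) V_bv[OF T(1)] V_bv[OF T(2)] ab(3)] by simp
    moreover have "complex_of_real (sqrt (ip0 N T) * sqrt (ip0 N T')) * of_real (1 / sqrt (ip0 N T * ip0 N T')) = 1"
      using pos by (simp add: real_sqrt_mult flip: of_real_mult of_real_divide)
    ultimately show ?thesis using True unfolding Amat_def a_def b_def by (simp add: mult.assoc[symmetric])
  qed
qed

lemma lp_expand_bv:
  assumes "lp f" shows "f = (\<Sum>x\<in>supp f \<times> Y. sc (f (fst x) (snd x)) (monov (fst x) (bv (snd x))))"
proof (intro ext)
  fix \<gamma> S
  have "(\<Sum>x\<in>supp f \<times> Y. sc (f (fst x) (snd x)) (monov (fst x) (bv (snd x)))) \<gamma> S
      = (\<Sum>\<beta>\<in>supp f. \<Sum>T\<in>Y. f \<beta> T * monov \<beta> (bv T) \<gamma> S)"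
    by (simp add: sum_fun_apply sum.cartesian_product case_prod_unfold)
  also have "\<dots> = (\<Sum>\<beta>\<in>supp f. if \<beta> = \<gamma> then f \<gamma> S else 0)"
    using V_expand[OF lp_V[OF assms], THEN fun_cong, of _ S]
    by (intro sum.cong refl) (auto simp: monov_def)
  also have "\<dots> = f \<gamma> S" using lp_finite[OF assms] by (auto simp: sum.delta)
  finally show "f \<gamma> S = (\<Sum>x\<in>supp f \<times> Y. sc (f (fst x) (snd x)) (monov (fst x) (bv (snd x)))) \<gamma> S" ..
qed

lemma F_Amat:
  assumes f: "lp f" and g: "lp g"
  shows "F f g = (\<Sum>T\<in>Y. \<Sum>T'\<in>Y. \<Sum>\<beta>\<in>supp f. \<Sum>\<beta>'\<in>supp g.
     cnj (f \<beta> T) * of_real (sqrt (ip0 N T)) * (g \<beta>' T' * of_real (sqrt (ip0 N T'))) * Amat N \<tau> \<kappa> (\<beta> - \<beta>') T T')"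
    (is "_ = (\<Sum>T\<in>Y. \<Sum>T'\<in>Y. \<Sum>\<beta>\<in>supp f. \<Sum>\<beta>'\<in>supp g. ?t T T' \<beta> \<beta>')")
proof -
  have "F f g = F (\<Sum>x\<in>supp f \<times> Y. sc (f (fst x) (snd x)) (monov (fst x) (bv (snd x))))
      (\<Sum>x\<in>supp g \<times> Y. sc (g (fst x) (snd x)) (monov (fst x) (bv (snd x))))"
    using lp_expand_bv[OF f] lp_expand_bv[OF g] by simp
  also have "\<dots> = (\<Sum>x\<in>supp f \<times> Y. \<Sum>y\<in>supp g \<times> Y. cnj (f (fst x) (snd x)) *
      (g (fst y) (snd y) * F (monov (fst x) (bv (snd x))) (monov (fst y) (bv (snd y)))))"
    using lp_supp[OF f] lp_supp[OF g] by (intro F_sum_sc lp_monov V_bv) auto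
  also have "\<dots> = (\<Sum>x\<in>supp f \<times> Y. \<Sum>y\<in>supp g \<times> Y. ?t (snd x) (snd y) (fst x) (fst y))"
    using lp_supp[OF f] lp_supp[OF g] by (intro sum.cong refl) (auto simp: F_monov_Amat)
  also have "\<dots> = (\<Sum>\<beta>\<in>supp f. \<Sum>T\<in>Y. \<Sum>\<beta>'\<in>supp g. \<Sum>T'\<in>Y. ?t T T' \<beta> \<beta>')"
    by (simp add: sum.cartesian_product')
  also have "\<dots> = (\<Sum>T\<in>Y. \<Sum>\<beta>\<in>supp f. \<Sum>\<beta>'\<in>supp g. \<Sum>T'\<in>Y. ?t T T' \<beta> \<beta>')"
    by (rule sum.swap)
  also have "\<dots> = (\<Sum>T\<in>Y. \<Sum>\<beta>\<in>supp f. \<Sum>T'\<in>Y. \<Sum>\<beta>'\<in>supp g. ?t T T' \<beta> \<beta>')"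
    by (intro sum.cong refl sum.swap)
  also have "\<dots> = (\<Sum>T\<in>Y. \<Sum>T'\<in>Y. \<Sum>\<beta>\<in>supp f. \<Sum>\<beta>'\<in>supp g. ?t T T' \<beta> \<beta>')"
    by (intro sum.cong refl sum.swap)
  finally show ?thesis .
qed

text \<open>The quadratic expression is \<open>F h h\<close>, where \<open>h\<close> has
  coefficients c_\<alpha> v_T in the normalized tableau basis; hence the division by the square
  roots.\<close>

lemma Amat_pos_def:
  fixes c :: "mi \<Rightarrow> complex" and v :: vec
  assumes A: "finite A" "\<And>\<alpha>. \<alpha> \<in> A \<Longrightarrow> supp_ok N \<alpha>"
  defines "q \<equiv> (\<Sum>\<alpha>\<in>A. \<Sum>\<beta>\<in>A. cnj (c \<alpha>) * c \<beta> * (\<Sum>T\<in>Y. \<Sum>T'\<in>Y. cnj (v T) * v T' * Amat N \<tau> \<kappa> (\<alpha> - \<beta>) T T'))"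
  shows "q \<in> \<real> \<and> 0 \<le> Re q"
proof -
  define d where "d = (\<lambda>\<alpha> T. c \<alpha> * v T / of_real (sqrt (ip0 N T)))"
  define h where "h = (\<Sum>x\<in>A \<times> Y. sc (d (fst x) (snd x)) (monov (fst x) (bv (snd x))))"
  have l: "lp (monov (fst x) (bv (snd x)))" if "x \<in> A \<times> Y" for x using that A by (intro lp_monov V_bv) auto
  have pos: "complex_of_real (sqrt (ip0 N T)) \<noteq> 0" for T using ip0_pos[of T] by simp
  let ?t = "\<lambda>\<alpha> \<beta> T T'. cnj (c \<alpha>) * c \<beta> * (cnj (v T) * v T' * Amat N \<tau> \<kappa> (\<alpha> - \<beta>) T T')"
  have "F h h = (\<Sum>x\<in>A \<times> Y. \<Sum>y\<in>A \<times> Y. cnj (d (fst x) (snd x)) *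
      (d (fst y) (snd y) * F (monov (fst x) (bv (snd x))) (monov (fst y) (bv (snd y)))))"
    unfolding h_def by (intro F_sum_sc l)
  also have "\<dots> = (\<Sum>x\<in>A \<times> Y. \<Sum>y\<in>A \<times> Y. ?t (fst x) (fst y) (snd x) (snd y))"
  proof (intro sum.cong refl)
    fix x y assume "x \<in> A \<times> Y" "y \<in> A \<times> Y"
    thus "cnj (d (fst x) (snd x)) * (d (fst y) (snd y) * F (monov (fst x) (bv (snd x))) (monov (fst y) (bv (snd y))))
      = ?t (fst x) (fst y) (snd x) (snd y)"
      using A pos[of "snd x"] pos[of "snd y"] by (auto simp: F_monov_Amat d_def)
  qed
  also have "\<dots> = (\<Sum>\<alpha>\<in>A. \<Sum>T\<in>Y. \<Sum>\<beta>\<in>A. \<Sum>T'\<in>Y. ?t \<alpha> \<beta> T T')"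
    by (simp add: sum.cartesian_product')
  also have "\<dots> = (\<Sum>\<alpha>\<in>A. \<Sum>\<beta>\<in>A. \<Sum>T\<in>Y. \<Sum>T'\<in>Y. ?t \<alpha> \<beta> T T')"
    by (intro sum.cong refl sum.swap)
  also have "\<dots> = q" unfolding q_def sum_distrib_left ..
  finally have "F h h = q" .
  moreover have "lp h" unfolding h_def using l by (intro lp_sum lp_sc) auto
  ultimately show ?thesis using F_pos[OF nrm_nonneg, of h] by simp
qed

end

section \<open>The matrix of measures\<close>

context jack begin

lemma Amat_herglotz:
  fixes v :: vec
  shows "\<exists>\<nu>. finite_measure \<nu> \<and> sets \<nu> = sets (torusM N) \<and>
    (\<forall>\<gamma>. supp_ok N \<gamma> \<longrightarrow> integral\<^sup>L \<nu> (\<lambda>x. xpow N x (- \<gamma>)) = (\<Sum>T\<in>Y. \<Sum>T'\<in>Y. cnj (v T) * v T' * Amat N \<tau> \<kappa> \<gamma> T T'))"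
  using herglotz_torus[OF N_pos Amat_pos_def] by blast

definition meas :: "vec \<Rightarrow> (nat \<Rightarrow> complex) measure" where
  "meas v = (SOME \<nu>. finite_measure \<nu> \<and> sets \<nu> = sets (torusM N) \<and>
    (\<forall>\<gamma>. supp_ok N \<gamma> \<longrightarrow> integral\<^sup>L \<nu> (\<lambda>x. xpow N x (- \<gamma>)) = (\<Sum>T\<in>Y. \<Sum>T'\<in>Y. cnj (v T) * v T' * Amat N \<tau> \<kappa> \<gamma> T T')))"

lemma meas:
  shows "finite_measure (meas v)" "sets (meas v) = sets (torusM N)"
    "supp_ok N \<gamma> \<Longrightarrow> integral\<^sup>L (meas v) (\<lambda>x. xpow N x (- \<gamma>)) = (\<Sum>T\<in>Y. \<Sum>T'\<in>Y. cnj (v T) * v T' * Amat N \<tau> \<kappa> \<gamma> T T')"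
  using someI_ex[OF Amat_herglotz[of v]] by (auto simp: meas_def)

text \<open>Polarization; \<open>- \<i>\<close> comes before \<open>\<i>\<close> because the form is conjugate-linear in its first argument.\<close>
definition mu :: "tab \<Rightarrow> tab \<Rightarrow> cmeas" where
  "mu T T' = (if T = T' then (meas (bv T), null_measure (torusM N), null_measure (torusM N), null_measure (torusM N))
     else let u = \<lambda>z S. (bv T S + z * bv T' S) / 2 in (meas (u 1), meas (u (-1)), meas (u (- \<i>)), meas (u \<i>)))"

lemma cmeasure_mu: "cmeasure_on (torusM N) (mu T T')"
  using meas by (auto simp: cmeasure_on_def mu_def cm1_def cm2_def cm3_def cm4_def Let_def intro!: finite_measureI)

lemma cpositive_mu: "cpositive (torusM N) (mu T T)"
  by (auto simp: cpositive_def cval_def mu_def cm1_def cm2_def cm3_def cm4_def)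

lemma sum_bv: "T \<in> Y \<Longrightarrow> (\<Sum>S\<in>Y. bv T S * g S) = g T"
proof -
  assume T: "T \<in> Y"
  have "(\<Sum>S\<in>Y. bv T S * g S) = (\<Sum>S\<in>Y. if S = T then g S else 0)" by (intro sum.cong) (auto simp: bv_def)
  thus ?thesis using T finite_Y by simp
qed

text \<open>Among the four terms of the quadratic form at \<open>u z\<close>, the combination over z
  = 1, -1, -i, i retains only the one with the factor z. The division by 2 in \<open>u\<close>
  supplies the factor 1/4 of the polarization identity.\<close>

lemma cint_mu_xpow:
  assumes T: "T \<in> Y" "T' \<in> Y" and \<gamma>: "supp_ok N \<gamma>"
  shows "cint (mu T T') (\<lambda>x. xpow N x (- \<gamma>)) = Amat N \<tau> \<kappa> \<gamma> T T'"
proof -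
  let ?A = "Amat N \<tau> \<kappa> \<gamma>"
  define q where "q v = (\<Sum>T\<in>Y. \<Sum>T'\<in>Y. cnj (v T) * v T' * ?A T T')" for v :: vec
  have m: "integral\<^sup>L (meas v) (\<lambda>x. xpow N x (- \<gamma>)) = q v" for v
    unfolding q_def by (rule meas(3)[OF \<gamma>])
  have cb: "cnj (bv S X) = bv S X" for S X by (simp add: bv_def)
  have qb: "q (bv T) = ?A T T"
  proof -
    have "q (bv T) = (\<Sum>X\<in>Y. bv T X * (\<Sum>X'\<in>Y. bv T X' * ?A X X'))"
      unfolding q_def sum_distrib_left cb by (intro sum.cong refl) (simp add: mult.assoc)
    thus ?thesis using T by (simp add: sum_bv)
  qed
  have qu: "q (\<lambda>S. (bv T S + z * bv T' S) / 2) = (?A T T + z * ?A T T' + cnj z * ?A T' T + cnj z * z * ?A T' T') / 4" for z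
  proof -
    have "q (\<lambda>S. (bv T S + z * bv T' S) / 2) = (\<Sum>X\<in>Y. \<Sum>X'\<in>Y.
        (bv T X * (bv T X' * ?A X X') + z * (bv T X * (bv T' X' * ?A X X'))
          + cnj z * (bv T' X * (bv T X' * ?A X X')) + cnj z * z * (bv T' X * (bv T' X' * ?A X X'))) / 4)"
      unfolding q_def by (intro sum.cong refl) (simp add: cb field_simps)
    also have "\<dots> = ((\<Sum>X\<in>Y. bv T X * (\<Sum>X'\<in>Y. bv T X' * ?A X X')) + z * (\<Sum>X\<in>Y. bv T X * (\<Sum>X'\<in>Y. bv T' X' * ?A X X'))
          + cnj z * (\<Sum>X\<in>Y. bv T' X * (\<Sum>X'\<in>Y. bv T X' * ?A X X')) + cnj z * z * (\<Sum>X\<in>Y. bv T' X * (\<Sum>X'\<in>Y. bv T' X' * ?A X X'))) / 4"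
      by (simp add: sum_distrib_left sum.distrib flip: sum_divide_distrib)
    finally show ?thesis using T by (simp add: sum_bv)
  qed
  show ?thesis
  proof (cases "T = T'")
    case True
    thus ?thesis using qb by (simp add: cint_def mu_def cm1_def cm2_def cm3_def cm4_def m)
  next
    case False
    define u where "u = (\<lambda>z S. (bv T S + z * bv T' S) / 2)"
    have "mu T T' = (meas (u 1), meas (u (-1)), meas (u (- \<i>)), meas (u \<i>))"
      unfolding mu_def Let_def u_def using False by (simp only: if_False)
    hence "cint (mu T T') (\<lambda>x. xpow N x (- \<gamma>)) = (q (u 1) - q (u (-1))) + \<i> * (q (u (- \<i>)) - q (u \<i>))"
      by (simp only: cint_def cm1_def cm2_def cm3_def cm4_def fst_conv snd_conv m)
    also have "\<dots> = ?A T T'" unfolding u_def qu by (simp add: field_simps)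
    finally show ?thesis .
  qed
qed

lemma space_torusM: "x \<in> space (torusM N) \<Longrightarrow> k \<in> {1..N} \<Longrightarrow> cmod (x k) = 1"
  by (auto simp: torusM_def space_PiM circle_def PiE_iff)

text \<open>Writing each coordinate as \<open>cis\<close> of its argument reduces products and
  conjugates of monomials to addition of exponents.\<close>

lemma xpow_torus:
  assumes "x \<in> space (torusM N)"
  shows "cnj (xpow N x \<alpha>) * xpow N x \<beta> = xpow N x (- (\<alpha> - \<beta>))" and "cmod (xpow N x \<alpha>) = 1"
proof -
  define \<theta> where "\<theta> k = Arg (x k)" for k
  have "x k = cis (\<theta> k)" if "k \<in> {1..N}" for k
  proof -
    have n: "cmod (x k) = 1" by (rule space_torusM[OF assms that])
    hence "x k \<noteq> 0" by auto
    thus ?thesis using cis_Arg[of "x k"] n by (simp add: \<theta>_def sgn_eq)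
  qed
  hence e: "xpow N x \<delta> = xpow N (\<lambda>k. cis (\<theta> k)) \<delta>" for \<delta>
    unfolding xpow_def by (intro prod.cong) auto
  show "cnj (xpow N x \<alpha>) * xpow N x \<beta> = xpow N x (- (\<alpha> - \<beta>))"
    unfolding e xpow_cis_cnj xpow_cis_add[symmetric] by (simp add: algebra_simps)
  show "cmod (xpow N x \<alpha>) = 1" by (simp add: e xpow_cis)
qed

lemma integrable_xpow:
  assumes "finite_measure \<nu>" "sets \<nu> = sets (torusM N)"
  shows "integrable \<nu> (\<lambda>x. xpow N x \<delta>)"
proof -
  interpret finite_measure \<nu> by fact
  have "space \<nu> = space (torusM N)" using assms(2) by (rule sets_eq_imp_space_eq)
  moreover have "(\<lambda>x. xpow N x \<delta>) \<in> borel_measurable \<nu>"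
    using xpow_measurable[of N \<delta>] assms(2) by (simp cong: measurable_cong_sets)
  ultimately show ?thesis
    by (intro integrable_const_bound[where B = 1]) (auto simp: xpow_torus(2))
qed

lemma cint_sum_xpow:
  assumes \<mu>: "cmeasure_on (torusM N) \<mu>" and "finite I"
  shows "cint \<mu> (\<lambda>x. \<Sum>i\<in>I. a i * xpow N x (\<delta> i)) = (\<Sum>i\<in>I. a i * cint \<mu> (\<lambda>x. xpow N x (\<delta> i)))"
proof -
  have "integral\<^sup>L \<nu> (\<lambda>x. \<Sum>i\<in>I. a i * xpow N x (\<delta> i)) = (\<Sum>i\<in>I. a i * integral\<^sup>L \<nu> (\<lambda>x. xpow N x (\<delta> i)))"
    if "\<nu> \<in> {cm1 \<mu>, cm2 \<mu>, cm3 \<mu>, cm4 \<mu>}" for \<nu>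
    using \<mu> that integrable_xpow by (subst Bochner_Integration.integral_sum) (auto simp: cmeasure_on_def)
  thus ?thesis
    by (simp add: cint_def sum_subtractf sum.distrib sum_distrib_left algebra_simps)
qed

lemma cint_cong:
  assumes \<mu>: "cmeasure_on (torusM N) \<mu>" and "\<And>x. x \<in> space (torusM N) \<Longrightarrow> f x = g x"
  shows "cint \<mu> f = cint \<mu> g"
proof -
  have "integral\<^sup>L \<nu> f = integral\<^sup>L \<nu> g" if "\<nu> \<in> {cm1 \<mu>, cm2 \<mu>, cm3 \<mu>, cm4 \<mu>}" for \<nu>
  proof -
    have "space \<nu> = space (torusM N)" using \<mu> that unfolding cmeasure_on_def by (metis sets_eq_imp_space_eq)
    thus ?thesis using assms(2) by (intro Bochner_Integration.integral_cong) auto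
  qed
  thus ?thesis by (simp add: cint_def)
qed

lemma cint_mu_coord:
  assumes f: "lp f" and g: "lp g" and T: "T \<in> Y" "T' \<in> Y"
  shows "cint (mu T T') (\<lambda>x. cnj (coord N f T x) * coord N g T' x) = (\<Sum>\<beta>\<in>supp f. \<Sum>\<beta>'\<in>supp g.
     cnj (f \<beta> T) * of_real (sqrt (ip0 N T)) * (g \<beta>' T' * of_real (sqrt (ip0 N T'))) * Amat N \<tau> \<kappa> (\<beta> - \<beta>') T T')"
proof -
  define a where "a = (\<lambda>p. cnj (f (fst p) T) * of_real (sqrt (ip0 N T)) * (g (snd p) T' * of_real (sqrt (ip0 N T'))))"
  let ?I = "supp f \<times> supp g"
  have "cint (mu T T') (\<lambda>x. cnj (coord N f T x) * coord N g T' x)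
      = cint (mu T T') (\<lambda>x. \<Sum>p\<in>?I. a p * xpow N x (- (fst p - snd p)))"
  proof (rule cint_cong[OF cmeasure_mu])
    fix x assume x: "x \<in> space (torusM N)"
    have "cnj (coord N f T x) * coord N g T' x = (\<Sum>\<beta>\<in>supp f. cnj (f \<beta> T) * of_real (sqrt (ip0 N T)) * cnj (xpow N x \<beta>))
       * (\<Sum>\<beta>\<in>supp g. g \<beta> T' * of_real (sqrt (ip0 N T')) * xpow N x \<beta>)"
      by (simp add: coord_def sum_distrib_left mult_ac)
    also have "\<dots> = (\<Sum>p\<in>?I. a p * (cnj (xpow N x (fst p)) * xpow N x (snd p)))"
      unfolding sum_product a_def by (simp add: sum.cartesian_product' mult_ac)
    finally show "cnj (coord N f T x) * coord N g T' x = (\<Sum>p\<in>?I. a p * xpow N x (- (fst p - snd p)))"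
      by (simp only: xpow_torus(1)[OF x])
  qed
  also have "\<dots> = (\<Sum>p\<in>?I. a p * cint (mu T T') (\<lambda>x. xpow N x (- (fst p - snd p))))"
    by (rule cint_sum_xpow[OF cmeasure_mu]) (use lp_finite f g in auto)
  also have "\<dots> = (\<Sum>p\<in>?I. a p * Amat N \<tau> \<kappa> (fst p - snd p) T T')"
  proof (intro sum.cong refl)
    fix p assume "p \<in> ?I"
    hence "supp_ok N (fst p)" "supp_ok N (snd p)" using lp_supp[OF f] lp_supp[OF g] by auto
    hence "supp_ok N (fst p - snd p)" by (simp add: supp_ok_def)
    thus "a p * cint (mu T T') (\<lambda>x. xpow N x (- (fst p - snd p))) = a p * Amat N \<tau> \<kappa> (fst p - snd p) T T'"
      using cint_mu_xpow[OF T, of "fst p - snd p"] by (simp del: minus_diff_eq)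
  qed
  finally show ?thesis by (simp add: sum.cartesian_product' a_def)
qed

end

theorem theorem4p4:
  fixes N :: nat and \<tau> :: "nat list" and \<kappa> :: real
  assumes "N \<ge> 2" and "is_partition N \<tau>" and "\<tau> \<noteq> [N]" and "\<tau> \<noteq> replicate N 1"
    and "- 1 / real (htau \<tau>) < \<kappa>" and "\<kappa> < 1 / real (htau \<tau>)"
  shows "\<exists>\<mu> :: tab \<Rightarrow> tab \<Rightarrow> cmeas.
     (\<forall>T\<in>RSYT N \<tau>. \<forall>T'\<in>RSYT N \<tau>. cmeasure_on (torusM N) (\<mu> T T'))
   \<and> (\<forall>\<alpha>. supp_ok N \<alpha> \<longrightarrow> (\<forall>T\<in>RSYT N \<tau>. \<forall>T'\<in>RSYT N \<tau>.
          cint (\<mu> T T') (\<lambda>x. xpow N x (- \<alpha>)) = Amat N \<tau> \<kappa> \<alpha> T T'))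
   \<and> (\<forall>T\<in>RSYT N \<tau>. cpositive (torusM N) (\<mu> T T))
   \<and> (\<forall>f g. is_lpoly N \<tau> f \<longrightarrow> is_lpoly N \<tau> g \<longrightarrow>
          formT N \<tau> \<kappa> f g = (\<Sum>T\<in>RSYT N \<tau>. \<Sum>T'\<in>RSYT N \<tau>.
             cint (\<mu> T T') (\<lambda>x. cnj (coord N f T x) * coord N g T' x)))"
proof -
  \<comment> \<open>The product form of the bound involves no division, and it is trivial in the
    case \<open>htau \<tau> = 0\<close>.\<close>
  have "\<bar>\<kappa>\<bar> * real (htau \<tau>) < 1"
  proof (cases "htau \<tau> = 0")
    case False
    hence "\<bar>\<kappa>\<bar> < 1 / real (htau \<tau>)" using assms(5,6) by (simp add: abs_less_iff)
    thus ?thesis using False by (simp add: pos_less_divide_eq)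
  qed simp
  then interpret jack N \<tau> \<kappa>
    using assms(1,2) by unfold_locales auto
  show ?thesis
    using cmeasure_mu cint_mu_xpow cpositive_mu F_Amat cint_mu_coord
    by (intro exI[of _ mu]) (simp cong: sum.cong)
qed

end
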